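(* Let $E$ be a topos, $A$ a sheaf of commutative rings on $E$, $B$ an $A$-algebra, $J$ a $B$-module, and $B'\to B$ a square-zero extension of $B$, as an $A$-algebra, with ideal $J$. Let $\omega \in H^1\big(A\text{-}\mathbf{Alg}/B,\ \underline{\mathrm{Der}}_A(B,J)\big)$ be the class of $B'$ as a torsor under $\underline{\mathrm{Der}}_A(B,J)$ on the site $A\text{-}\mathbf{Alg}/B$. Then $\omega = 0$ if and only if $B'\to B$ admits a section which is a homomorphism of $A$-algebras. In that case, the $A$-algebra sections of $B'\to B$ form a torsor under $$H^0\big(A\text{-}\mathbf{Alg}/B,\ \underline{\mathrm{Der}}_A(B,J)\big) = \mathrm{Der}_A(B,J).$$
   Context: All rings and algebras are commutative and unital. For an object $U$ of $E$, a subscript $U$ denotes restriction to $E/U$. The site $A\text{-}\mathbf{Alg}/B$: objects are pairs $(U,C)$ with $U\in E$ and $C$ an $A_U$-algebra (a sheaf of algebras on $E/U$) equipped with an $A_U$-algebra map $C\to B_U$. A morphism $(U_1,C_1)\to(U_2,C_2)$ is a map $f:U_1\to U_2$ in $E$ together with a map $C_1\to f^*C_2$ of $A_{U_1}$-algebras commuting with the maps to $B_{U_1}$. A family $(U_i,C_i)\to(U,C)$ is covering if for every $V\to U$ in $E$ and every finite set $\Lambda\subset\Gamma(V,C)$ there is a cover of $V$ in $E$ such that for each member $V'$ of the cover there are an index $i$, a map $V'\to U_i$ over $U$, and a lift of $\Lambda|_{V'}$ to $\Gamma(V',C_i)$. The final object is $(E,B)$, where $E$ also denotes the final object of the topos.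 $H^p(A\text{-}\mathbf{Alg}/B,F)$ denotes the $p$-th derived functor of global sections of sheaves of abelian groups on this site. A square-zero $A$-algebra extension of $B$ with ideal $J$ is a surjection of $A$-algebras $B'\to B$ whose kernel has square zero and is identified, as a $B$-module, with $J$. $\mathrm{Der}_A(B,J)$ is the group of $A$-derivations $B\to J$. $\underline{\mathrm{Der}}_A(B,J)$ is the sheaf of abelian groups $(U,C)\mapsto \mathrm{Der}_{A_U}(C,J_U)$ on $A\text{-}\mathbf{Alg}/B$ ($J_U$ being a $C$-module via $C\to B_U$); it is represented by $(E,B+J)$, where $B+J$ is the trivial square-zero extension. For a sheaf of abelian groups $G$ on a topos, a $G$-torsor is a sheaf $F$ with an action of $G$ such that $G\times F\to F\times F$, $(g,x)\mapsto(gx,x)$ is an isomorphism and $F$ covers the final object (i.e. $F$ has sections locally). Isomorphism classes of $G$-torsors correspond to $H^1(-,G)$, the trivial torsor corresponding to $0$. The extension $B'$ is regarded as the sheaf on $A\text{-}\mathbf{Alg}/B$ represented by $(E,B')$, i.e. $(U,C)\mapsto\{A_U\text{-algebra maps } C\to B'_U \text{ over } B_U\}$, with $\underline{\mathrm{Der}}_A(B,J)$ acting by adding derivations; with this action it is a $\underline{\mathrm{Der}}_A(B,J)$-torsor, and $\omega$ is its class. *)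

theory Defs
  imports "HOL-Algebra.Group_Action" "HOL-Algebra.Module" "HOL-Algebra.AbelCoset"
begin

section \<open>Categories and sheaves\<close>

record ('x, 'y) cat =
  Ob :: "'x set"
  Ar :: "'y set"
  src :: "'y \<Rightarrow> 'x"
  tgt :: "'y \<Rightarrow> 'x"
  idn :: "'x \<Rightarrow> 'y"
  cmp :: "'y \<Rightarrow> 'y \<Rightarrow> 'y"

definition arrows :: "('x, 'y) cat \<Rightarrow> 'x \<Rightarrow> 'x \<Rightarrow> 'y set" where
  "arrows T x y = {f \<in> Ar T. src T f = x \<and> tgt T f = y}"

definition category :: "('x, 'y) cat \<Rightarrow> bool" where
  "category T \<longleftrightarrow>
     (\<forall>f\<in>Ar T. src T f \<in> Ob T \<and> tgt T f \<in> Ob T) \<and>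
     (\<forall>x\<in>Ob T. idn T x \<in> arrows T x x) \<and>
     (\<forall>f\<in>Ar T. \<forall>g\<in>Ar T. tgt T f = src T g \<longrightarrow> cmp T g f \<in> arrows T (src T f) (tgt T g)) \<and>
     (\<forall>f\<in>Ar T. cmp T f (idn T (src T f)) = f \<and> cmp T (idn T (tgt T f)) f = f) \<and>
     (\<forall>f\<in>Ar T. \<forall>g\<in>Ar T. \<forall>h\<in>Ar T. tgt T f = src T g \<longrightarrow> tgt T g = src T h \<longrightarrow>
        cmp T h (cmp T g f) = cmp T (cmp T h g) f)"

definition terminal :: "('x, 'y) cat \<Rightarrow> 'x \<Rightarrow> bool" where
  "terminal T z \<longleftrightarrow> z \<in> Ob T \<and> (\<forall>x\<in>Ob T. \<exists>!f. f \<in> arrows T x z)"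

definition bang :: "('x, 'y) cat \<Rightarrow> 'x \<Rightarrow> 'x \<Rightarrow> 'y" where
  "bang T z x = (THE f. f \<in> arrows T x z)"

text \<open>A presheaf assigns to each object a structure whose carrier is the set of sections;
  the structure may be a bare set, a monoid, a ring or a module of HOL-Algebra.\<close>

record ('x, 'y, 'v, 's) presheaf =
  Sec :: "'x \<Rightarrow> ('v, 's) partial_object_scheme"
  Res :: "'y \<Rightarrow> 'v \<Rightarrow> 'v"

type_synonym ('x, 'y, 'v) set_presheaf = "('x, 'y, 'v, unit) presheaf"
type_synonym ('x, 'y, 'v) group_presheaf =
  "('x, 'y, 'v, ('v, unit) monoid_ext) presheaf"
type_synonym ('x, 'y, 'v) ring_presheaf =
  "('x, 'y, 'v, ('v, ('v, unit) ring_ext) monoid_ext) presheaf"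
type_synonym ('x, 'y, 'v) module_presheaf =
  "('x, 'y, 'v, ('v, ('v, ('v, 'v, unit) module_ext) ring_ext) monoid_ext) presheaf"

definition presheaf :: "('x, 'y) cat \<Rightarrow> ('x, 'y, 'v, 's, 'r) presheaf_scheme \<Rightarrow> bool" where
  "presheaf T F \<longleftrightarrow>
     (\<forall>f\<in>Ar T. Res F f \<in> carrier (Sec F (tgt T f)) \<rightarrow> carrier (Sec F (src T f))) \<and>
     (\<forall>x\<in>Ob T. \<forall>s\<in>carrier (Sec F x). Res F (idn T x) s = s) \<and>
     (\<forall>f\<in>Ar T. \<forall>g\<in>Ar T. tgt T f = src T g \<longrightarrow>
        (\<forall>s\<in>carrier (Sec F (tgt T g)). Res F (cmp T g f) s = Res F f (Res F g s)))"

definition matching ::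
  "('x, 'y) cat \<Rightarrow> ('x, 'y, 'v, 's, 'r) presheaf_scheme \<Rightarrow> 'y set \<Rightarrow> ('y \<Rightarrow> 'v) \<Rightarrow> bool" where
  "matching T F R m \<longleftrightarrow>
     (\<forall>r\<in>R. m r \<in> carrier (Sec F (src T r))) \<and>
     (\<forall>r\<in>R. \<forall>r'\<in>R. \<forall>g\<in>Ar T. \<forall>g'\<in>Ar T.
        tgt T g = src T r \<and> tgt T g' = src T r' \<and> cmp T r g = cmp T r' g' \<longrightarrow>
        Res F g (m r) = Res F g' (m r'))"

text \<open>\<open>cov x R\<close> says that the family \<open>R\<close> of arrows with target \<open>x\<close> is covering.\<close>

definition sheaf ::
  "('x, 'y) cat \<Rightarrow> ('x \<Rightarrow> 'y set \<Rightarrow> bool) \<Rightarrow> ('x, 'y, 'v, 's, 'r) presheaf_scheme \<Rightarrow> bool" where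
  "sheaf T cov F \<longleftrightarrow> presheaf T F \<and>
     (\<forall>x\<in>Ob T. \<forall>R. R \<subseteq> {f \<in> Ar T. tgt T f = x} \<and> cov x R \<longrightarrow>
        (\<forall>m. matching T F R m \<longrightarrow>
           (\<exists>!s. s \<in> carrier (Sec F x) \<and> (\<forall>r\<in>R. Res F r s = m r))))"

text \<open>Morphisms are extensional families of functions, so that equal morphisms are equal in HOL.\<close>

definition maps ::
  "('x, 'y) cat \<Rightarrow> ('x, 'y, 'v, 's, 'r) presheaf_scheme \<Rightarrow> ('x, 'y, 'w, 't, 'q) presheaf_scheme
     \<Rightarrow> ('x \<Rightarrow> 'v \<Rightarrow> 'w) set" where
  "maps T F G =
     {\<eta> \<in> (\<Pi>\<^sub>E x\<in>Ob T. carrier (Sec F x) \<rightarrow>\<^sub>E carrier (Sec G x)).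
        \<forall>f\<in>Ar T. \<forall>s\<in>carrier (Sec F (tgt T f)).
          \<eta> (src T f) (Res F f s) = Res G f (\<eta> (tgt T f) s)}"

definition id_map ::
  "('x, 'y) cat \<Rightarrow> ('x, 'y, 'v, 's, 'r) presheaf_scheme \<Rightarrow> 'x \<Rightarrow> 'v \<Rightarrow> 'v" where
  "id_map T F = (\<lambda>x\<in>Ob T. \<lambda>s\<in>carrier (Sec F x). s)"

definition comp_map ::
  "('x, 'y) cat \<Rightarrow> ('x, 'y, 'v, 's, 'r) presheaf_scheme \<Rightarrow> ('x \<Rightarrow> 'w \<Rightarrow> 'z) \<Rightarrow> ('x \<Rightarrow> 'v \<Rightarrow> 'w)
     \<Rightarrow> 'x \<Rightarrow> 'v \<Rightarrow> 'z" where
  "comp_map T F \<psi> \<eta> = (\<lambda>x\<in>Ob T. compose (carrier (Sec F x)) (\<psi> x) (\<eta> x))"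

section \<open>Topoi\<close>

text \<open>The type \<open>'u\<close> plays the role of a Grothendieck universe: a set is small if it has fewer
  elements than \<open>'u\<close>, and the cardinality of \<open>'u\<close> is infinite, regular and a strong limit.
  Uncountability is not required, so the universe of finite sets is allowed as well.\<close>

definition small :: "'u itself \<Rightarrow> 'a set \<Rightarrow> bool" where
  "small U X \<longleftrightarrow> (card_of X, card_of (UNIV :: 'u set)) \<in> ordLess"

definition universe :: "'u itself \<Rightarrow> bool" where
  "universe U \<longleftrightarrow> infinite (UNIV :: 'u set) \<and>
     (\<forall>X :: 'u set. small U X \<longrightarrow> small U (Pow X)) \<and>
     (\<forall>(X :: 'u set) (Y :: 'u \<Rightarrow> 'u set). small U X \<longrightarrow> (\<forall>x\<in>X. small U (Y x)) \<longrightarrow>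
        small U (\<Union>x\<in>X. Y x))"

definition sieve :: "('x, 'y) cat \<Rightarrow> 'x \<Rightarrow> 'y set \<Rightarrow> bool" where
  "sieve T x R \<longleftrightarrow> R \<subseteq> {f \<in> Ar T. tgt T f = x} \<and>
     (\<forall>r\<in>R. \<forall>g\<in>Ar T. tgt T g = src T r \<longrightarrow> cmp T r g \<in> R)"

definition pullback_sieve :: "('x, 'y) cat \<Rightarrow> 'y \<Rightarrow> 'y set \<Rightarrow> 'y set" where
  "pullback_sieve T f R = {g \<in> Ar T. tgt T g = src T f \<and> cmp T f g \<in> R}"

definition grothendieck_topology ::
  "('x, 'y) cat \<Rightarrow> ('x \<Rightarrow> 'y set \<Rightarrow> bool) \<Rightarrow> bool" where
  "grothendieck_topology T cov \<longleftrightarrow>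
     (\<forall>x R. cov x R \<longrightarrow> x \<in> Ob T \<and> sieve T x R) \<and>
     (\<forall>x\<in>Ob T. cov x {f \<in> Ar T. tgt T f = x}) \<and>
     (\<forall>f\<in>Ar T. \<forall>R. cov (tgt T f) R \<longrightarrow> cov (src T f) (pullback_sieve T f R)) \<and>
     (\<forall>x\<in>Ob T. \<forall>R R'. cov x R \<and> sieve T x R' \<and>
        (\<forall>f\<in>R. cov (src T f) (pullback_sieve T f R')) \<longrightarrow> cov x R')"

definition small_sheaf ::
  "('x, 'y) cat \<Rightarrow> ('x \<Rightarrow> 'y set \<Rightarrow> bool) \<Rightarrow> ('x, 'y, 'u, 's, 'r) presheaf_scheme \<Rightarrow> bool" where
  "small_sheaf T cov F \<longleftrightarrow>
     sheaf T cov F \<and> (\<forall>x\<in>Ob T. small TYPE('u) (carrier (Sec F x)))"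

text \<open>A topos is a category equivalent to the category of sheaves of small sets on a small site:
  \<open>\<Phi>\<close> and \<open>\<phi>\<close> are the object and arrow parts of a fully faithful, essentially surjective functor.\<close>

definition topos :: "'u itself \<Rightarrow> ('o, 'm) cat \<Rightarrow> bool" where
  "topos U E \<longleftrightarrow> category E \<and>
     (\<exists>(S :: ('u, 'u) cat) cov (\<Phi> :: 'o \<Rightarrow> ('u, 'u, 'u) set_presheaf) (\<phi> :: 'm \<Rightarrow> 'u \<Rightarrow> 'u \<Rightarrow> 'u).
        category S \<and> small U (Ob S) \<and> small U (Ar S) \<and> grothendieck_topology S cov \<and>
        (\<forall>x\<in>Ob E. small_sheaf S cov (\<Phi> x)) \<and>
        (\<forall>x\<in>Ob E. \<phi> (idn E x) = id_map S (\<Phi> x)) \<and>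
        (\<forall>f\<in>Ar E. \<forall>g\<in>Ar E. tgt E f = src E g \<longrightarrow>
           \<phi> (cmp E g f) = comp_map S (\<Phi> (src E f)) (\<phi> g) (\<phi> f)) \<and>
        (\<forall>x\<in>Ob E. \<forall>y\<in>Ob E. bij_betw \<phi> (arrows E x y) (maps S (\<Phi> x) (\<Phi> y))) \<and>
        (\<forall>F :: ('u, 'u, 'u) set_presheaf. small_sheaf S cov F \<longrightarrow>
           (\<exists>x\<in>Ob E. \<exists>\<eta>\<in>maps S F (\<Phi> x).
              \<forall>c\<in>Ob S. bij_betw (\<eta> c) (carrier (Sec F c)) (carrier (Sec (\<Phi> x) c)))))"

text \<open>In a topos (and hence in its slices) the covering families of the canonical topology are
  the jointly epimorphic ones.  Sheaves on a topos are sheaves for this topology.\<close>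

definition epi_family :: "('x, 'y) cat \<Rightarrow> 'x \<Rightarrow> 'y set \<Rightarrow> bool" where
  "epi_family T x R \<longleftrightarrow> R \<subseteq> {f \<in> Ar T. tgt T f = x} \<and>
     (\<forall>y\<in>Ob T. \<forall>g\<in>arrows T x y. \<forall>h\<in>arrows T x y.
        (\<forall>r\<in>R. cmp T g r = cmp T h r) \<longrightarrow> g = h)"

text \<open>The slice \<open>T/U\<close>: an object is an arrow with target \<open>U\<close>; the pair \<open>(h, w)\<close> is the arrow
  \<open>w \<circ> h \<rightarrow> w\<close> given by \<open>h\<close>.\<close>

definition slice :: "('x, 'y) cat \<Rightarrow> 'x \<Rightarrow> ('y, 'y \<times> 'y) cat" where
  "slice T U =
     \<lparr>Ob = {v \<in> Ar T. tgt T v = U},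
      Ar = {(h, w). h \<in> Ar T \<and> w \<in> Ar T \<and> tgt T w = U \<and> tgt T h = src T w},
      src = (\<lambda>(h, w). cmp T w h),
      tgt = (\<lambda>(h, w). w),
      idn = (\<lambda>w. (idn T (src T w), w)),
      cmp = (\<lambda>(h, w) (h', w'). (cmp T h h', w))\<rparr>"

section \<open>Sheaves of rings, algebras and modules on a topos\<close>

definition ring_sheaf ::
  "('x, 'y) cat \<Rightarrow> ('x, 'y, 'u, ('u, ('u, 't) ring_ext) monoid_ext, 'r) presheaf_scheme \<Rightarrow> bool" where
  "ring_sheaf T F \<longleftrightarrow> small_sheaf T (epi_family T) F \<and>
     (\<forall>x\<in>Ob T. cring (Sec F x)) \<and>
     (\<forall>f\<in>Ar T. Res F f \<in> ring_hom (Sec F (tgt T f)) (Sec F (src T f)))"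

definition ring_maps ::
  "('x, 'y) cat \<Rightarrow> ('x, 'y, 'u, ('u, ('u, 't) ring_ext) monoid_ext, 'r) presheaf_scheme
     \<Rightarrow> ('x, 'y, 'u, ('u, ('u, 's) ring_ext) monoid_ext, 'q) presheaf_scheme
     \<Rightarrow> ('x \<Rightarrow> 'u \<Rightarrow> 'u) set" where
  "ring_maps T F G = {\<eta> \<in> maps T F G. \<forall>x\<in>Ob T. \<eta> x \<in> ring_hom (Sec F x) (Sec G x)}"

text \<open>An \<open>A\<close>-algebra is a sheaf of rings with a structure map \<open>Str\<close> from \<open>A\<close>.\<close>

record ('x, 'y, 'u) alg =
  "('x, 'y, 'u, ('u, ('u, unit) ring_ext) monoid_ext) presheaf" +
  Str :: "'x \<Rightarrow> 'u \<Rightarrow> 'u"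

definition alg_sheaf ::
  "('x, 'y) cat \<Rightarrow> ('x, 'y, 'u) ring_presheaf \<Rightarrow> ('x, 'y, 'u) alg \<Rightarrow> bool" where
  "alg_sheaf T A C \<longleftrightarrow> ring_sheaf T C \<and> Str C \<in> ring_maps T A C"

definition alg_maps ::
  "('x, 'y) cat \<Rightarrow> ('x, 'y, 'u) ring_presheaf \<Rightarrow> ('x, 'y, 'u) alg \<Rightarrow> ('x, 'y, 'u) alg
     \<Rightarrow> ('x \<Rightarrow> 'u \<Rightarrow> 'u) set" where
  "alg_maps T A C D = {\<eta> \<in> ring_maps T C D.
     \<forall>x\<in>Ob T. \<forall>a\<in>carrier (Sec A x). \<eta> x (Str C x a) = Str D x a}"

definition module_sheaf ::
  "('x, 'y) cat \<Rightarrow> ('x, 'y, 'u) alg \<Rightarrow> ('x, 'y, 'u) module_presheaf \<Rightarrow> bool" where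
  "module_sheaf T B J \<longleftrightarrow> small_sheaf T (epi_family T) J \<and>
     (\<forall>x\<in>Ob T. module (Sec B x) (Sec J x)) \<and>
     (\<forall>f\<in>Ar T. \<forall>j\<in>carrier (Sec J (tgt T f)). \<forall>k\<in>carrier (Sec J (tgt T f)).
        Res J f (j \<oplus>\<^bsub>Sec J (tgt T f)\<^esub> k) = Res J f j \<oplus>\<^bsub>Sec J (src T f)\<^esub> Res J f k) \<and>
     (\<forall>f\<in>Ar T. \<forall>b\<in>carrier (Sec B (tgt T f)). \<forall>j\<in>carrier (Sec J (tgt T f)).
        Res J f (b \<odot>\<^bsub>Sec J (tgt T f)\<^esub> j) = Res B f b \<odot>\<^bsub>Sec J (src T f)\<^esub> Res J f j)"

text \<open>Derivations \<open>C \<rightarrow> J\<close> over \<open>A\<close>, where \<open>C\<close> acts on the \<open>B\<close>-module \<open>J\<close> through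
  \<open>\<beta> : C \<rightarrow> B\<close>.\<close>

definition derivations ::
  "('x, 'y) cat \<Rightarrow> ('x, 'y, 'u) ring_presheaf \<Rightarrow> ('x, 'y, 'u) alg \<Rightarrow> ('x \<Rightarrow> 'u \<Rightarrow> 'u)
     \<Rightarrow> ('x, 'y, 'u) module_presheaf \<Rightarrow> ('x \<Rightarrow> 'u \<Rightarrow> 'u) set" where
  "derivations T A C \<beta> J = {D \<in> maps T C J. \<forall>x\<in>Ob T.
     (\<forall>c\<in>carrier (Sec C x). \<forall>c'\<in>carrier (Sec C x).
        D x (c \<oplus>\<^bsub>Sec C x\<^esub> c') = D x c \<oplus>\<^bsub>Sec J x\<^esub> D x c' \<and>
        D x (c \<otimes>\<^bsub>Sec C x\<^esub> c') =
          \<beta> x c \<odot>\<^bsub>Sec J x\<^esub> D x c' \<oplus>\<^bsub>Sec J x\<^esub> \<beta> x c' \<odot>\<^bsub>Sec J x\<^esub> D x c) \<and>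
     (\<forall>a\<in>carrier (Sec A x). \<forall>c\<in>carrier (Sec C x).
        D x (Str C x a \<otimes>\<^bsub>Sec C x\<^esub> c) = \<beta> x (Str C x a) \<odot>\<^bsub>Sec J x\<^esub> D x c)}"

definition der_group ::
  "('x, 'y) cat \<Rightarrow> ('x, 'y, 'u) ring_presheaf \<Rightarrow> ('x, 'y, 'u) alg \<Rightarrow> ('x \<Rightarrow> 'u \<Rightarrow> 'u)
     \<Rightarrow> ('x, 'y, 'u) module_presheaf \<Rightarrow> ('x \<Rightarrow> 'u \<Rightarrow> 'u) monoid" where
  "der_group T A C \<beta> J =
     \<lparr>carrier = derivations T A C \<beta> J,
      mult = (\<lambda>D D'. \<lambda>x\<in>Ob T. \<lambda>c\<in>carrier (Sec C x). D x c \<oplus>\<^bsub>Sec J x\<^esub> D' x c),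
      one = (\<lambda>x\<in>Ob T. \<lambda>c\<in>carrier (Sec C x). \<zero>\<^bsub>Sec J x\<^esub>)\<rparr>"

section \<open>Square-zero extensions\<close>

definition locally_surjective ::
  "('x, 'y) cat \<Rightarrow> ('x \<Rightarrow> 'y set \<Rightarrow> bool) \<Rightarrow> ('x, 'y, 'v, 's, 'r) presheaf_scheme
     \<Rightarrow> ('x, 'y, 'w, 't, 'q) presheaf_scheme \<Rightarrow> ('x \<Rightarrow> 'v \<Rightarrow> 'w) \<Rightarrow> bool" where
  "locally_surjective T cov F G \<eta> \<longleftrightarrow>
     (\<forall>x\<in>Ob T. \<forall>s\<in>carrier (Sec G x). \<exists>R \<subseteq> {f \<in> Ar T. tgt T f = x}. cov x R \<and>
        (\<forall>r\<in>R. \<exists>t\<in>carrier (Sec F (src T r)). \<eta> (src T r) t = Res G r s))"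

text \<open>\<open>p : B' \<rightarrow> B\<close> is a surjection of \<open>A\<close>-algebras and \<open>\<iota>\<close> identifies \<open>J\<close> with its kernel.  As the
  kernel has square zero, its \<open>B\<close>-module structure is multiplication in \<open>B'\<close> by local lifts.\<close>

definition square_zero_extension ::
  "('x, 'y) cat \<Rightarrow> ('x, 'y, 'u) ring_presheaf \<Rightarrow> ('x, 'y, 'u) alg \<Rightarrow> ('x, 'y, 'u) module_presheaf
     \<Rightarrow> ('x, 'y, 'u) alg \<Rightarrow> ('x \<Rightarrow> 'u \<Rightarrow> 'u) \<Rightarrow> ('x \<Rightarrow> 'u \<Rightarrow> 'u) \<Rightarrow> bool" where
  "square_zero_extension T A B J B' p \<iota> \<longleftrightarrow>
     alg_sheaf T A B' \<and> p \<in> alg_maps T A B' B \<and> locally_surjective T (epi_family T) B' B p \<and>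
     (\<forall>x\<in>Ob T. \<forall>k\<in>a_kernel (Sec B' x) (Sec B x) (p x). \<forall>l\<in>a_kernel (Sec B' x) (Sec B x) (p x).
        k \<otimes>\<^bsub>Sec B' x\<^esub> l = \<zero>\<^bsub>Sec B' x\<^esub>) \<and>
     \<iota> \<in> maps T J B' \<and>
     (\<forall>x\<in>Ob T. bij_betw (\<iota> x) (carrier (Sec J x)) (a_kernel (Sec B' x) (Sec B x) (p x)) \<and>
        (\<forall>j\<in>carrier (Sec J x). \<forall>k\<in>carrier (Sec J x).
           \<iota> x (j \<oplus>\<^bsub>Sec J x\<^esub> k) = \<iota> x j \<oplus>\<^bsub>Sec B' x\<^esub> \<iota> x k) \<and>
        (\<forall>b\<in>carrier (Sec B' x). \<forall>j\<in>carrier (Sec J x).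
           \<iota> x (p x b \<odot>\<^bsub>Sec J x\<^esub> j) = b \<otimes>\<^bsub>Sec B' x\<^esub> \<iota> x j))"

definition alg_sections ::
  "('x, 'y) cat \<Rightarrow> ('x, 'y, 'u) ring_presheaf \<Rightarrow> ('x, 'y, 'u) alg \<Rightarrow> ('x, 'y, 'u) alg
     \<Rightarrow> ('x \<Rightarrow> 'u \<Rightarrow> 'u) \<Rightarrow> ('x \<Rightarrow> 'u \<Rightarrow> 'u) set" where
  "alg_sections T A B B' p =
     {s \<in> alg_maps T A B B'. \<forall>x\<in>Ob T. \<forall>b\<in>carrier (Sec B x). p x (s x b) = b}"

definition add_der ::
  "('x, 'y) cat \<Rightarrow> ('x, 'y, 'u) alg \<Rightarrow> ('x, 'y, 'u) alg \<Rightarrow> ('x \<Rightarrow> 'u \<Rightarrow> 'u)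
     \<Rightarrow> ('x \<Rightarrow> 'u \<Rightarrow> 'u) \<Rightarrow> ('x \<Rightarrow> 'u \<Rightarrow> 'u) \<Rightarrow> 'x \<Rightarrow> 'u \<Rightarrow> 'u" where
  "add_der T C B' \<iota> D s =
     (\<lambda>x\<in>Ob T. \<lambda>c\<in>carrier (Sec C x). s x c \<oplus>\<^bsub>Sec B' x\<^esub> \<iota> x (D x c))"

section \<open>Restriction to slices and the site of algebras over an algebra\<close>

definition loc ::
  "('o, 'm) cat \<Rightarrow> ('o, 'm, 'u, 's) presheaf \<Rightarrow> ('m, 'm \<times> 'm, 'u, 's) presheaf" where
  "loc E F = \<lparr>Sec = (\<lambda>v. Sec F (src E v)), Res = (\<lambda>(h, w). Res F h)\<rparr>"

definition loc_map :: "('o, 'm) cat \<Rightarrow> 'o \<Rightarrow> ('o \<Rightarrow> 'a) \<Rightarrow> 'm \<Rightarrow> 'a" where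
  "loc_map E U \<eta> = (\<lambda>v\<in>Ob (slice E U). \<eta> (src E v))"

definition loc_alg ::
  "('o, 'm) cat \<Rightarrow> 'o \<Rightarrow> ('o, 'm, 'u) alg \<Rightarrow> ('m, 'm \<times> 'm, 'u) alg" where
  "loc_alg E U C = \<lparr>Sec = (\<lambda>v. Sec C (src E v)), Res = (\<lambda>(h, w). Res C h),
     Str = loc_map E U (Str C)\<rparr>"

text \<open>For \<open>f : U \<rightarrow> U'\<close> and an algebra \<open>C\<close> on \<open>E/U'\<close>, the algebra \<open>f\<^sup>* C\<close> on \<open>E/U\<close>.\<close>

definition pull_alg ::
  "('o, 'm) cat \<Rightarrow> 'm \<Rightarrow> ('m, 'm \<times> 'm, 'u) alg \<Rightarrow> ('m, 'm \<times> 'm, 'u) alg" where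
  "pull_alg E f C = \<lparr>Sec = (\<lambda>v. Sec C (cmp E f v)), Res = (\<lambda>(h, w). Res C (h, cmp E f w)),
     Str = (\<lambda>v\<in>Ob (slice E (src E f)). Str C (cmp E f v))\<rparr>"

record ('o, 'm, 'u) algob =
  base :: 'o
  ring_of :: "('m, 'm \<times> 'm, 'u) alg"
  aug :: "'m \<Rightarrow> 'u \<Rightarrow> 'u"

record ('o, 'm, 'u) algar =
  dom_ob :: "('o, 'm, 'u) algob"
  cod_ob :: "('o, 'm, 'u) algob"
  base_ar :: 'm
  ring_ar :: "'m \<Rightarrow> 'u \<Rightarrow> 'u"

definition pull_along ::
  "('o, 'm) cat \<Rightarrow> ('o, 'm, 'u) algar \<Rightarrow> ('m \<Rightarrow> 'u \<Rightarrow> 'u) \<Rightarrow> 'm \<Rightarrow> 'u \<Rightarrow> 'u" where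
  "pull_along E \<phi> \<eta> = (\<lambda>v\<in>Ob (slice E (base (dom_ob \<phi>))).
     compose (carrier (Sec (ring_of (dom_ob \<phi>)) v)) (\<eta> (cmp E (base_ar \<phi>) v)) (ring_ar \<phi> v))"

definition alg_cat ::
  "('o, 'm) cat \<Rightarrow> ('o, 'm, 'u) ring_presheaf \<Rightarrow> ('o, 'm, 'u) alg
     \<Rightarrow> (('o, 'm, 'u) algob, ('o, 'm, 'u) algar) cat" where
  "alg_cat E A B =
    (let obs = {X. base X \<in> Ob E \<and>
                   alg_sheaf (slice E (base X)) (loc E A) (ring_of X) \<and>
                   aug X \<in> alg_maps (slice E (base X)) (loc E A) (ring_of X)
                             (loc_alg E (base X) B)} in
     \<lparr>Ob = obs,
      Ar = {\<phi>. dom_ob \<phi> \<in> obs \<and> cod_ob \<phi> \<in> obs \<and>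
               base_ar \<phi> \<in> arrows E (base (dom_ob \<phi>)) (base (cod_ob \<phi>)) \<and>
               ring_ar \<phi> \<in> alg_maps (slice E (base (dom_ob \<phi>))) (loc E A)
                 (ring_of (dom_ob \<phi>)) (pull_alg E (base_ar \<phi>) (ring_of (cod_ob \<phi>))) \<and>
               pull_along E \<phi> (aug (cod_ob \<phi>)) = aug (dom_ob \<phi>)},
      src = dom_ob,
      tgt = cod_ob,
      idn = (\<lambda>X. \<lparr>dom_ob = X, cod_ob = X, base_ar = idn E (base X),
                  ring_ar = id_map (slice E (base X)) (ring_of X)\<rparr>),
      cmp = (\<lambda>\<psi> \<phi>. \<lparr>dom_ob = dom_ob \<phi>, cod_ob = cod_ob \<psi>,
                    base_ar = cmp E (base_ar \<psi>) (base_ar \<phi>),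
                    ring_ar = pull_along E \<phi> (ring_ar \<psi>)\<rparr>)\<rparr>)"

definition alg_cov ::
  "('o, 'm) cat \<Rightarrow> ('o, 'm, 'u) algob \<Rightarrow> ('o, 'm, 'u) algar set \<Rightarrow> bool" where
  "alg_cov E X R \<longleftrightarrow>
     (\<forall>v\<in>Ob (slice E (base X)). \<forall>\<Lambda> \<subseteq> carrier (Sec (ring_of X) v). finite \<Lambda> \<longrightarrow>
        (\<exists>K. epi_family E (src E v) K \<and>
           (\<forall>k\<in>K. \<exists>\<phi>\<in>R. \<exists>w \<in> arrows E (src E k) (base (dom_ob \<phi>)).
              cmp E (base_ar \<phi>) w = cmp E v k \<and>
              (\<forall>l\<in>\<Lambda>. \<exists>c\<in>carrier (Sec (ring_of (dom_ob \<phi>)) w).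
                 ring_ar \<phi> w c = Res (ring_of X) (k, v) l))))"

text \<open>The object \<open>(U, B\<^sub>U)\<close>, which is final in the site when \<open>U\<close> is final in \<open>E\<close>.\<close>

definition top_alg ::
  "('o, 'm) cat \<Rightarrow> 'o \<Rightarrow> ('o, 'm, 'u) alg \<Rightarrow> ('o, 'm, 'u) algob" where
  "top_alg E U B = \<lparr>base = U, ring_of = loc_alg E U B, aug = loc_map E U (id_map E B)\<rparr>"

definition Der_sheaf ::
  "('o, 'm) cat \<Rightarrow> ('o, 'm, 'u) ring_presheaf \<Rightarrow> ('o, 'm, 'u) module_presheaf
     \<Rightarrow> (('o, 'm, 'u) algob, ('o, 'm, 'u) algar, 'm \<Rightarrow> 'u \<Rightarrow> 'u) group_presheaf" where
  "Der_sheaf E A J =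
     \<lparr>Sec = (\<lambda>X. der_group (slice E (base X)) (loc E A) (ring_of X) (aug X) (loc E J)),
      Res = pull_along E\<rparr>"

definition ext_sheaf ::
  "('o, 'm) cat \<Rightarrow> ('o, 'm, 'u) ring_presheaf \<Rightarrow> ('o, 'm, 'u) alg \<Rightarrow> ('o \<Rightarrow> 'u \<Rightarrow> 'u)
     \<Rightarrow> (('o, 'm, 'u) algob, ('o, 'm, 'u) algar, 'm \<Rightarrow> 'u \<Rightarrow> 'u) set_presheaf" where
  "ext_sheaf E A B' p =
     \<lparr>Sec = (\<lambda>X. \<lparr>carrier =
        {\<eta> \<in> alg_maps (slice E (base X)) (loc E A) (ring_of X) (loc_alg E (base X) B').
           comp_map (slice E (base X)) (ring_of X) (loc_map E (base X) p) \<eta> = aug X}\<rparr>),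
      Res = pull_along E\<rparr>"

definition ext_action ::
  "('o, 'm) cat \<Rightarrow> ('o, 'm, 'u) alg \<Rightarrow> ('o \<Rightarrow> 'u \<Rightarrow> 'u) \<Rightarrow> ('o, 'm, 'u) algob
     \<Rightarrow> ('m \<Rightarrow> 'u \<Rightarrow> 'u) \<Rightarrow> ('m \<Rightarrow> 'u \<Rightarrow> 'u) \<Rightarrow> 'm \<Rightarrow> 'u \<Rightarrow> 'u" where
  "ext_action E B' \<iota> X = add_der (slice E (base X)) (ring_of X) (loc_alg E (base X) B')
     (loc_map E (base X) \<iota>)"

section \<open>Cohomology\<close>

definition ab_sheaf ::
  "('x, 'y) cat \<Rightarrow> ('x \<Rightarrow> 'y set \<Rightarrow> bool) \<Rightarrow> ('x, 'y, 'v) group_presheaf \<Rightarrow> bool" where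
  "ab_sheaf T cov F \<longleftrightarrow> sheaf T cov F \<and>
     (\<forall>x\<in>Ob T. comm_group (Sec F x)) \<and>
     (\<forall>f\<in>Ar T. Res F f \<in> hom (Sec F (tgt T f)) (Sec F (src T f)))"

definition ab_maps ::
  "('x, 'y) cat \<Rightarrow> ('x, 'y, 'v) group_presheaf \<Rightarrow> ('x, 'y, 'w) group_presheaf
     \<Rightarrow> ('x \<Rightarrow> 'v \<Rightarrow> 'w) set" where
  "ab_maps T F G = {\<eta> \<in> maps T F G. \<forall>x\<in>Ob T. \<eta> x \<in> hom (Sec F x) (Sec G x)}"

text \<open>Injective objects of the category of sheaves of abelian groups with values in \<open>'v\<close>.  The site
  below is not small, so \<open>'v\<close> stands for a larger universe than \<open>'u\<close>; once \<open>'v\<close> is large enough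
  compared with the site, these are the usual injective sheaves and there are enough of them.\<close>

definition injective_sheaf ::
  "('x, 'y) cat \<Rightarrow> ('x \<Rightarrow> 'y set \<Rightarrow> bool) \<Rightarrow> ('x, 'y, 'v) group_presheaf \<Rightarrow> bool" where
  "injective_sheaf T cov I \<longleftrightarrow> ab_sheaf T cov I \<and>
     (\<forall>(M :: ('x, 'y, 'v) group_presheaf) (N :: ('x, 'y, 'v) group_presheaf).
        ab_sheaf T cov M \<longrightarrow> ab_sheaf T cov N \<longrightarrow>
        (\<forall>m\<in>ab_maps T M N. (\<forall>x\<in>Ob T. inj_on (m x) (carrier (Sec M x))) \<longrightarrow>
           (\<forall>f\<in>ab_maps T M I. \<exists>g\<in>ab_maps T N I. comp_map T M g m = f)))"

definition kernel_sheaf ::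
  "('x, 'y, 'v) group_presheaf \<Rightarrow> ('x, 'y, 'w) group_presheaf \<Rightarrow> ('x \<Rightarrow> 'v \<Rightarrow> 'w)
     \<Rightarrow> ('x, 'y, 'v) group_presheaf" where
  "kernel_sheaf F G \<eta> =
     \<lparr>Sec = (\<lambda>x. (Sec F x)\<lparr>carrier := kernel (Sec F x) (Sec G x) (\<eta> x)\<rparr>), Res = Res F\<rparr>"

text \<open>Kernels of maps of sheaves are computed on sections and images locally, so the following
  expresses exactness of \<open>0 \<rightarrow> G \<rightarrow> I 0 \<rightarrow> I 1 \<rightarrow> \<dots>\<close>.\<close>

definition injective_resolution ::
  "('x, 'y) cat \<Rightarrow> ('x \<Rightarrow> 'y set \<Rightarrow> bool) \<Rightarrow> ('x, 'y, 'w) group_presheaf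
     \<Rightarrow> (nat \<Rightarrow> ('x, 'y, 'v) group_presheaf) \<Rightarrow> ('x \<Rightarrow> 'w \<Rightarrow> 'v) \<Rightarrow> (nat \<Rightarrow> 'x \<Rightarrow> 'v \<Rightarrow> 'v) \<Rightarrow> bool"
  where
  "injective_resolution T cov G I \<epsilon> d \<longleftrightarrow>
     (\<forall>n. injective_sheaf T cov (I n)) \<and>
     \<epsilon> \<in> ab_maps T G (I 0) \<and> (\<forall>n. d n \<in> ab_maps T (I n) (I (Suc n))) \<and>
     (\<forall>x\<in>Ob T. bij_betw (\<epsilon> x) (carrier (Sec G x)) (kernel (Sec (I 0) x) (Sec (I 1) x) (d 0 x))) \<and>
     (\<forall>n. \<forall>x\<in>Ob T. \<forall>s\<in>carrier (Sec (I n) x). d (Suc n) x (d n x s) = \<one>\<^bsub>Sec (I (Suc (Suc n))) x\<^esub>) \<and>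
     (\<forall>n. locally_surjective T cov (I n)
            (kernel_sheaf (I (Suc n)) (I (Suc (Suc n))) (d (Suc n))) (d n))"

text \<open>Global sections are sections over the final object \<open>z\<close>.  The \<open>n\<close>-th right derived functor
  of global sections is the \<open>n\<close>-th cohomology of the global sections of an injective resolution.\<close>

definition coboundaries ::
  "(nat \<Rightarrow> ('x, 'y, 'v) group_presheaf) \<Rightarrow> (nat \<Rightarrow> 'x \<Rightarrow> 'v \<Rightarrow> 'v) \<Rightarrow> 'x \<Rightarrow> nat \<Rightarrow> 'v set" where
  "coboundaries I d z n =
     (case n of 0 \<Rightarrow> {\<one>\<^bsub>Sec (I 0) z\<^esub>} | Suc k \<Rightarrow> d k z ` carrier (Sec (I k) z))"

definition cocycles ::
  "(nat \<Rightarrow> ('x, 'y, 'v) group_presheaf) \<Rightarrow> (nat \<Rightarrow> 'x \<Rightarrow> 'v \<Rightarrow> 'v) \<Rightarrow> 'x \<Rightarrow> nat \<Rightarrow> 'v monoid" where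
  "cocycles I d z n =
     (Sec (I n) z)\<lparr>carrier := kernel (Sec (I n) z) (Sec (I (Suc n)) z) (d n z)\<rparr>"

definition cohomology ::
  "(nat \<Rightarrow> ('x, 'y, 'v) group_presheaf) \<Rightarrow> (nat \<Rightarrow> 'x \<Rightarrow> 'v \<Rightarrow> 'v) \<Rightarrow> 'x \<Rightarrow> nat \<Rightarrow> 'v set monoid"
  where
  "cohomology I d z n = cocycles I d z n Mod coboundaries I d z n"

text \<open>The correspondence between \<open>G\<close>-torsors and \<open>H\<^sup>1\<close>: the class of a global 1-cocycle \<open>q\<close>
  corresponds to the torsor of local sections \<open>t\<close> of \<open>I 0\<close> with \<open>d 0 t = q\<close>, on which \<open>G\<close> acts by
  translation through \<open>\<epsilon>\<close>.  So the class of a torsor \<open>F\<close>, as a coset of coboundaries, is the set of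
  all cocycles \<open>q\<close> whose torsor is isomorphic to \<open>F\<close>; the zero class is the coset of coboundaries.\<close>

definition cocycle_torsor ::
  "('x, 'y) cat \<Rightarrow> 'x \<Rightarrow> (nat \<Rightarrow> ('x, 'y, 'v) group_presheaf) \<Rightarrow> (nat \<Rightarrow> 'x \<Rightarrow> 'v \<Rightarrow> 'v) \<Rightarrow> 'v
     \<Rightarrow> ('x, 'y, 'v) set_presheaf" where
  "cocycle_torsor T z I d q =
     \<lparr>Sec = (\<lambda>x. \<lparr>carrier = {t \<in> carrier (Sec (I 0) x). d 0 x t = Res (I 1) (bang T z x) q}\<rparr>),
      Res = Res (I 0)\<rparr>"

definition torsor_isomorphic ::
  "('x, 'y) cat \<Rightarrow> ('x, 'y, 'g) group_presheaf
     \<Rightarrow> ('x, 'y, 'v) set_presheaf \<Rightarrow> ('x \<Rightarrow> 'g \<Rightarrow> 'v \<Rightarrow> 'v)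
     \<Rightarrow> ('x, 'y, 'w) set_presheaf \<Rightarrow> ('x \<Rightarrow> 'g \<Rightarrow> 'w \<Rightarrow> 'w) \<Rightarrow> bool" where
  "torsor_isomorphic T G F act F' act' \<longleftrightarrow>
     (\<exists>\<theta>\<in>maps T F F'. \<forall>x\<in>Ob T.
        bij_betw (\<theta> x) (carrier (Sec F x)) (carrier (Sec F' x)) \<and>
        (\<forall>g\<in>carrier (Sec G x). \<forall>s\<in>carrier (Sec F x).
           \<theta> x (act x g s) = act' x g (\<theta> x s)))"

definition torsor_class ::
  "('x, 'y) cat \<Rightarrow> 'x \<Rightarrow> ('x, 'y, 'w) group_presheaf \<Rightarrow> (nat \<Rightarrow> ('x, 'y, 'v) group_presheaf)
     \<Rightarrow> ('x \<Rightarrow> 'w \<Rightarrow> 'v) \<Rightarrow> (nat \<Rightarrow> 'x \<Rightarrow> 'v \<Rightarrow> 'v)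
     \<Rightarrow> ('x, 'y, 's) set_presheaf \<Rightarrow> ('x \<Rightarrow> 'w \<Rightarrow> 's \<Rightarrow> 's) \<Rightarrow> 'v set" where
  "torsor_class T z G I \<epsilon> d F act =
     {q \<in> carrier (cocycles I d z 1).
        torsor_isomorphic T G F act (cocycle_torsor T z I d q)
          (\<lambda>x g t. \<epsilon> x g \<otimes>\<^bsub>Sec (I 0) x\<^esub> t)}"

text \<open>The identification of \<open>G(z)\<close> with \<open>H\<^sup>0\<close>.\<close>

definition to_H0 ::
  "'x \<Rightarrow> (nat \<Rightarrow> ('x, 'y, 'v) group_presheaf) \<Rightarrow> ('x \<Rightarrow> 'w \<Rightarrow> 'v) \<Rightarrow> (nat \<Rightarrow> 'x \<Rightarrow> 'v \<Rightarrow> 'v)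
     \<Rightarrow> 'w \<Rightarrow> 'v set" where
  "to_H0 z I \<epsilon> d g = coboundaries I d z 0 #>\<^bsub>cocycles I d z 0\<^esub> \<epsilon> z g"

section \<open>Torsors under a group\<close>

definition group_torsor :: "('g, 'r) monoid_scheme \<Rightarrow> 's set \<Rightarrow> ('g \<Rightarrow> 's \<Rightarrow> 's) \<Rightarrow> bool" where
  "group_torsor G X act \<longleftrightarrow> group_action G X act \<and> X \<noteq> {} \<and>
     bij_betw (\<lambda>(g, x). (act g x, x)) (carrier G \<times> X) (X \<times> X)"

end

theory Submission
  imports Defs "HOL-Algebra.RingHom"
begin

text \<open>The class of a torsor vanishes exactly when the torsor has a global section, and for the sheaf
  represented by \<open>B'\<close> a global section is an algebra section of \<open>B' \<rightarrow> B\<close>.  The proof makes both halves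
  of this sentence precise.

  The first half holds for any presheaf \<open>F\<close> on which \<open>G\<close> acts simply transitively wherever \<open>F\<close> has
  sections (\<open>torsor_class_trivial_iff\<close>).  The torsor of a cocycle \<open>q\<close> consists of the solutions \<open>t\<close> of
  \<open>d t = q\<close>, so it has a global section if and only if \<open>q\<close> is a coboundary.  If \<open>F\<close> itself has a global
  section \<open>\<sigma>\<close>, sending \<open>g \<sigma>\<close> to \<open>g t\<close> is an isomorphism onto the torsor of \<open>d t\<close>, for every \<open>t\<close>.
  That derivations act simply transitively on the maps into \<open>B'\<close> over \<open>B\<close> is the classical
  computation: because the kernel \<open>J\<close> has square zero, the difference of two lifts of a ring
  homomorphism is a derivation, and adding a derivation to a lift gives a lift (\<open>lifts_torsor\<close>).

  For the second half, the site has the final object \<open>(e, B)\<close>: an object \<open>(U, C)\<close> maps to it only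
  through its augmentation \<open>C \<rightarrow> B\<close> (\<open>terminal_top_alg\<close>).  Sections over it live on the slice over the
  final object \<open>e\<close>, which is a copy of the topos; hence they are the algebra sections of \<open>B' \<rightarrow> B\<close>, and the
  global sections of the sheaf of derivations are the derivations from \<open>B\<close> to \<open>J\<close>
  (\<open>ext_sheaf_global_sections\<close>, \<open>Der_sheaf_global_sections\<close>).  The latter are \<open>H\<^sup>0\<close>, and the simply
  transitive action on algebra sections is \<open>lifts_torsor\<close> once more, for the identity of \<open>B\<close>.\<close>

section \<open>Categories, slices and families of maps\<close>

lemma category_src_tgt:
  assumes "category T" "f \<in> Ar T"
  shows "src T f \<in> Ob T" "tgt T f \<in> Ob T"
  using assms by (auto simp: category_def)

lemma category_idn:
  assumes "category T" "x \<in> Ob T"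
  shows "idn T x \<in> Ar T" "src T (idn T x) = x" "tgt T (idn T x) = x"
  using assms by (auto simp: category_def arrows_def)

lemma category_cmp:
  assumes "category T" "f \<in> Ar T" "g \<in> Ar T" "tgt T f = src T g"
  shows "cmp T g f \<in> Ar T" "src T (cmp T g f) = src T f" "tgt T (cmp T g f) = tgt T g"
  using assms by (auto simp: category_def arrows_def)

lemma category_unit:
  assumes "category T" "f \<in> Ar T"
  shows "src T f = x \<Longrightarrow> cmp T f (idn T x) = f" "tgt T f = y \<Longrightarrow> cmp T (idn T y) f = f"
  using assms by (auto simp: category_def)

lemma category_assoc:
  assumes "category T" "f \<in> Ar T" "g \<in> Ar T" "h \<in> Ar T" "tgt T f = src T g" "tgt T g = src T h"
  shows "cmp T (cmp T h g) f = cmp T h (cmp T g f)"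
  using assms by (simp add: category_def)

lemmas category_simps = category_src_tgt category_idn category_cmp category_unit category_assoc

lemma terminal_eqI:
  assumes "terminal T z" "f \<in> arrows T x z" "g \<in> arrows T x z" "x \<in> Ob T"
  shows "f = g"
  using assms unfolding terminal_def by blast

lemma bang_arrow:
  assumes "terminal T z" "x \<in> Ob T"
  shows "bang T z x \<in> arrows T x z"
proof -
  have "\<exists>!f. f \<in> arrows T x z"
    using assms by (simp add: terminal_def)
  thus ?thesis
    unfolding bang_def by (rule theI')
qed

lemma bang_eqI:
  assumes "terminal T z" "x \<in> Ob T" "f \<in> arrows T x z"
  shows "bang T z x = f"
  using terminal_eqI[OF assms(1) bang_arrow[OF assms(1,2)] assms(3,2)] .

lemma bang_cmp:
  assumes "category T" "terminal T z" "f \<in> Ar T"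
  shows "cmp T (bang T z (tgt T f)) f = bang T z (src T f)"
proof -
  have "bang T z (tgt T f) \<in> arrows T (tgt T f) z"
    using assms by (simp add: bang_arrow category_simps)
  hence "cmp T (bang T z (tgt T f)) f \<in> arrows T (src T f) z"
    using assms by (simp add: arrows_def category_simps)
  thus ?thesis
    using assms by (metis bang_eqI category_src_tgt(1))
qed

lemma bang_self:
  assumes "category T" "terminal T z"
  shows "bang T z z = idn T z"
  using assms by (intro bang_eqI) (auto simp: terminal_def arrows_def category_simps)

lemma slice_simps [simp]:
  "v \<in> Ob (slice T U) \<longleftrightarrow> v \<in> Ar T \<and> tgt T v = U"
  "(h, w) \<in> Ar (slice T U) \<longleftrightarrow> h \<in> Ar T \<and> w \<in> Ar T \<and> tgt T w = U \<and> tgt T h = src T w"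
  "src (slice T U) (h, w) = cmp T w h"
  "tgt (slice T U) (h, w) = w"
  "idn (slice T U) w = (idn T (src T w), w)"
  "cmp (slice T U) (h, w) (h', w') = (cmp T h h', w)"
  by (auto simp: slice_def)

lemma category_slice:
  assumes "category T"
  shows "category (slice T U)"
  unfolding category_def using assms
  by (auto simp: arrows_def category_simps)

lemma loc_simps [simp]:
  "Sec (loc E F) v = Sec F (src E v)" "Res (loc E F) (h, w) = Res F h"
  "Sec (loc_alg E U C) v = Sec C (src E v)" "Res (loc_alg E U C) (h, w) = Res C h"
  "Str (loc_alg E U C) = loc_map E U (Str C)"
  by (simp_all add: loc_def loc_alg_def)

lemma pull_alg_simps [simp]:
  "Sec (pull_alg E f C) v = Sec C (cmp E f v)"
  "Res (pull_alg E f C) (h, w) = Res C (h, cmp E f w)"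
  by (simp_all add: pull_alg_def)

lemma Str_pull_alg [simp]:
  "v \<in> Ar E \<Longrightarrow> tgt E v = src E f \<Longrightarrow> Str (pull_alg E f C) v = Str C (cmp E f v)"
  by (simp add: pull_alg_def)

lemma loc_map_apply [simp]: "v \<in> Ar E \<Longrightarrow> tgt E v = U \<Longrightarrow> loc_map E U \<eta> v = \<eta> (src E v)"
  by (simp add: loc_map_def)

lemma maps_closed:
  assumes "\<eta> \<in> maps T F G" "x \<in> Ob T" "s \<in> carrier (Sec F x)"
  shows "\<eta> x s \<in> carrier (Sec G x)"
  using assms unfolding maps_def by (auto simp: PiE_def Pi_def)

lemma maps_natural:
  assumes "\<eta> \<in> maps T F G" "f \<in> Ar T" "s \<in> carrier (Sec F (tgt T f))"
  shows "\<eta> (src T f) (Res F f s) = Res G f (\<eta> (tgt T f) s)"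
  using assms unfolding maps_def by auto

lemma maps_natural_slice:
  assumes "\<eta> \<in> maps (slice E U) F G" "h \<in> Ar E" "w \<in> Ar E" "tgt E w = U" "tgt E h = src E w"
    and "s \<in> carrier (Sec F w)"
  shows "\<eta> (cmp E w h) (Res F (h, w) s) = Res G (h, w) (\<eta> w s)"
  using maps_natural[OF assms(1), of "(h, w)" s] assms by simp

text \<open>Morphisms are extensional in the object and in the section, so a morphism is determined by its
  values and can be rewritten as a double \<open>\<lambda>\<close>-abstraction.\<close>

lemma maps_restrict:
  assumes "\<eta> \<in> maps T F G"
  shows "\<eta> = (\<lambda>x\<in>Ob T. \<lambda>s\<in>carrier (Sec F x). \<eta> x s)"
proof (rule ext)
  fix x
  have *: "\<eta> \<in> extensional (Ob T)" "x \<in> Ob T \<Longrightarrow> \<eta> x \<in> extensional (carrier (Sec F x))"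
    using assms unfolding maps_def by (auto simp: PiE_def Pi_def)
  show "\<eta> x = (\<lambda>x\<in>Ob T. \<lambda>s\<in>carrier (Sec F x). \<eta> x s) x"
    using * by (auto simp: extensional_def fun_eq_iff)
qed

lemma maps_eqI:
  assumes "\<eta> \<in> maps T F G" "\<eta>' \<in> maps T F G'"
    and "\<And>x s. x \<in> Ob T \<Longrightarrow> s \<in> carrier (Sec F x) \<Longrightarrow> \<eta> x s = \<eta>' x s"
  shows "\<eta> = \<eta>'"
  by (subst maps_restrict[OF assms(1)], subst maps_restrict[OF assms(2)])
     (auto simp: assms(3) fun_eq_iff)

lemma maps_lamI:
  assumes "category T"
    and "\<And>x s. x \<in> Ob T \<Longrightarrow> s \<in> carrier (Sec F x) \<Longrightarrow> e x s \<in> carrier (Sec G x)"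
    and "\<And>f s. f \<in> Ar T \<Longrightarrow> s \<in> carrier (Sec F (tgt T f)) \<Longrightarrow>
           Res F f s \<in> carrier (Sec F (src T f)) \<and> e (src T f) (Res F f s) = Res G f (e (tgt T f) s)"
  shows "(\<lambda>x\<in>Ob T. \<lambda>s\<in>carrier (Sec F x). e x s) \<in> maps T F G"
  using assms unfolding maps_def by (auto simp: category_src_tgt)

lemma alg_maps_iff:
  "\<eta> \<in> alg_maps T A C D \<longleftrightarrow> \<eta> \<in> maps T C D \<and> (\<forall>x\<in>Ob T. \<eta> x \<in> ring_hom (Sec C x) (Sec D x)) \<and>
     (\<forall>x\<in>Ob T. \<forall>a\<in>carrier (Sec A x). \<eta> x (Str C x a) = Str D x a)"
  by (auto simp: alg_maps_def ring_maps_def)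

lemma maps_cong_cod:
  assumes "category T"
    and "\<And>x. x \<in> Ob T \<Longrightarrow> carrier (Sec D x) = carrier (Sec D' x)"
    and "\<And>f. f \<in> Ar T \<Longrightarrow> Res D f = Res D' f"
  shows "maps T C D = maps T C D'"
proof -
  have "(\<Pi>\<^sub>E x\<in>Ob T. carrier (Sec C x) \<rightarrow>\<^sub>E carrier (Sec D x)) =
        (\<Pi>\<^sub>E x\<in>Ob T. carrier (Sec C x) \<rightarrow>\<^sub>E carrier (Sec D' x))"
    using assms(2) by (intro PiE_cong) simp
  thus ?thesis
    unfolding maps_def using assms(3) by auto
qed

lemma alg_maps_cong_cod:
  assumes "category T"
    and "\<And>x. x \<in> Ob T \<Longrightarrow> Sec D x = Sec D' x"
    and "\<And>f. f \<in> Ar T \<Longrightarrow> Res D f = Res D' f"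
    and "\<And>x a. x \<in> Ob T \<Longrightarrow> a \<in> carrier (Sec A x) \<Longrightarrow> Str D x a = Str D' x a"
  shows "alg_maps T A C D = alg_maps T A C D'"
  using maps_cong_cod[of T D D' C] assms by (auto simp: alg_maps_iff)

text \<open>The restrictions of \<open>F\<close> and \<open>G\<close> to the slice enter only through their sections and restriction
  maps, because sheaves and algebras are restricted by two different operations, \<open>loc\<close> and
  \<open>loc_alg\<close>.\<close>

lemma loc_map_maps:
  assumes "category E" "\<eta> \<in> maps E F G"
    and "\<And>v. Sec F' v = Sec F (src E v)" "\<And>h w. Res F' (h, w) = Res F h"
    and "\<And>v. Sec G' v = Sec G (src E v)" "\<And>h w. Res G' (h, w) = Res G h"
  shows "loc_map E U \<eta> \<in> maps (slice E U) F' G'"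
proof -
  have "loc_map E U \<eta> \<in> (\<Pi>\<^sub>E v\<in>Ob (slice E U). carrier (Sec F' v) \<rightarrow>\<^sub>E carrier (Sec G' v))"
    using assms unfolding maps_def loc_map_def by (auto simp: category_src_tgt PiE_def Pi_def)
  moreover have "loc_map E U \<eta> (src (slice E U) f) (Res F' f s) = Res G' f (loc_map E U \<eta> (tgt (slice E U) f) s)"
    if "f \<in> Ar (slice E U)" "s \<in> carrier (Sec F' (tgt (slice E U) f))" for f s
  proof -
    obtain h w where f: "f = (h, w)" by (cases f)
    show ?thesis
      using that assms maps_natural[OF assms(2), of h s] by (simp add: f category_simps)
  qed
  ultimately show ?thesis
    unfolding maps_def by auto
qed

lemma loc_map_alg_maps:
  assumes "category E" "\<eta> \<in> alg_maps E A C D"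
  shows "loc_map E U \<eta> \<in> alg_maps (slice E U) (loc E A) (loc_alg E U C) (loc_alg E U D)"
  using assms loc_map_maps[of E \<eta> C D "loc_alg E U C" "loc_alg E U D" U]
  by (auto simp: alg_maps_iff category_simps)

section \<open>Restriction to the slice over a final object\<close>

text \<open>Over a final object \<open>e\<close> the slice is a copy of the category, an object \<open>x\<close> corresponding to
  its unique arrow to \<open>e\<close>; so restriction to it loses nothing.\<close>

lemma loc_map_bij_maps:
  assumes "category E" "terminal E e"
    and F: "\<And>f s. f \<in> Ar E \<Longrightarrow> s \<in> carrier (Sec F (tgt E f)) \<Longrightarrow> Res F f s \<in> carrier (Sec F (src E f))"
    and F': "\<And>v. Sec F' v = Sec F (src E v)" "\<And>h w. Res F' (h, w) = Res F h"
    and G': "\<And>v. Sec G' v = Sec G (src E v)" "\<And>h w. Res G' (h, w) = Res G h"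
  shows "bij_betw (loc_map E e) (maps E F G) (maps (slice E e) F' G')"
proof (rule bij_betwI')
  have bang: "bang E e x \<in> Ar E" "src E (bang E e x) = x" "tgt E (bang E e x) = e" if "x \<in> Ob E" for x
    using bang_arrow[OF assms(2) that] by (auto simp: arrows_def)
  show "(loc_map E e \<eta> = loc_map E e \<eta>') = (\<eta> = \<eta>')"
    if "\<eta> \<in> maps E F G" "\<eta>' \<in> maps E F G" for \<eta> \<eta>'
  proof
    assume eq: "loc_map E e \<eta> = loc_map E e \<eta>'"
    show "\<eta> = \<eta>'"
    proof (rule maps_eqI[OF that])
      show "\<eta> x s = \<eta>' x s" if "x \<in> Ob E" for x s
        using fun_cong[OF eq, of "bang E e x"] bang[OF that] by simp
    qed
  qed simp
  show "loc_map E e \<eta> \<in> maps (slice E e) F' G'" if "\<eta> \<in> maps E F G" for \<eta>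
    using loc_map_maps[OF assms(1) that F' G'] .
  show "\<exists>\<eta>\<in>maps E F G. \<eta>' = loc_map E e \<eta>" if \<eta>': "\<eta>' \<in> maps (slice E e) F' G'" for \<eta>'
  proof
    \<comment> \<open>the value at \<open>x\<close> is read off at the unique arrow from \<open>x\<close> to \<open>e\<close>\<close>
    let ?\<eta> = "\<lambda>x\<in>Ob E. \<lambda>s\<in>carrier (Sec F x). \<eta>' (bang E e x) s"
    show *: "?\<eta> \<in> maps E F G"
    proof (rule maps_lamI[OF assms(1)])
      show "\<eta>' (bang E e x) s \<in> carrier (Sec G x)" if "x \<in> Ob E" "s \<in> carrier (Sec F x)" for x s
        using maps_closed[OF \<eta>', of "bang E e x" s] that bang[OF that(1)] F' G' by simp
      show "Res F f s \<in> carrier (Sec F (src E f)) \<and>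
            \<eta>' (bang E e (src E f)) (Res F f s) = Res G f (\<eta>' (bang E e (tgt E f)) s)"
        if "f \<in> Ar E" "s \<in> carrier (Sec F (tgt E f))" for f s
        using maps_natural_slice[OF \<eta>', of f "bang E e (tgt E f)" s] that assms(1,2) F F' G'
          bang[of "tgt E f"]
        by (simp add: category_simps bang_cmp)
    qed
    show "\<eta>' = loc_map E e ?\<eta>"
    proof (rule maps_eqI[OF \<eta>' loc_map_maps[OF assms(1) * F' G']])
      show "\<eta>' v s = loc_map E e ?\<eta> v s" if "v \<in> Ob (slice E e)" "s \<in> carrier (Sec F' v)" for v s
        using that F' assms bang_eqI[OF assms(2), of "src E v" v]
        by (simp add: category_simps arrows_def)
    qed
  qed
qed

text \<open>The form in which the bijection is used: derivations and algebra sections are the maps that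
  satisfy a condition at every object, and each object of the slice carries the condition of its
  source.\<close>

lemma loc_map_bij_maps_where:
  assumes "category E" "terminal E e"
    and F: "\<And>f s. f \<in> Ar E \<Longrightarrow> s \<in> carrier (Sec F (tgt E f)) \<Longrightarrow> Res F f s \<in> carrier (Sec F (src E f))"
    and F': "\<And>v. Sec F' v = Sec F (src E v)" "\<And>h w. Res F' (h, w) = Res F h"
    and G': "\<And>v. Sec G' v = Sec G (src E v)" "\<And>h w. Res G' (h, w) = Res G h"
    and P: "\<And>v \<eta>. v \<in> Ob (slice E e) \<Longrightarrow> P' v \<eta> = P (src E v) \<eta>"
  shows "bij_betw (loc_map E e) {\<eta> \<in> maps E F G. \<forall>x\<in>Ob E. P x (\<eta> x)}
           {\<eta> \<in> maps (slice E e) F' G'. \<forall>v\<in>Ob (slice E e). P' v (\<eta> v)}"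
proof -
  have "(\<forall>v\<in>Ob (slice E e). P' v (loc_map E e \<eta> v)) \<longleftrightarrow> (\<forall>x\<in>Ob E. P x (\<eta> x))" for \<eta>
  proof
    assume *: "\<forall>v\<in>Ob (slice E e). P' v (loc_map E e \<eta> v)"
    show "\<forall>x\<in>Ob E. P x (\<eta> x)"
    proof
      fix x assume "x \<in> Ob E"
      hence "bang E e x \<in> Ar E" "src E (bang E e x) = x" "tgt E (bang E e x) = e"
        using bang_arrow[OF assms(2)] by (auto simp: arrows_def)
      thus "P x (\<eta> x)"
        using *[rule_format, of "bang E e x"] P by simp
    qed
  qed (use assms(1) P in \<open>auto simp: category_simps\<close>)
  moreover have "bij_betw (loc_map E e) (maps E F G) (maps (slice E e) F' G')"
    using assms(1,2) F F' G' by (rule loc_map_bij_maps)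
  ultimately show ?thesis
    by (intro bij_betw_Collect)
qed

text \<open>Two arrows \<open>g\<close> and \<open>h\<close> from the source of \<open>v\<close> to \<open>y\<close> automatically commute with the arrows to
  \<open>e\<close>, so they are arrows of the slice and can be compared there.\<close>

lemma epi_family_slice_terminal:
  assumes "category E" "terminal E e" "epi_family (slice E e) v R" "v \<in> Ob (slice E e)"
  shows "epi_family E (src E v) (fst ` R)"
  unfolding epi_family_def
proof (intro conjI ballI impI)
  have R: "R \<subseteq> {f \<in> Ar (slice E e). tgt (slice E e) f = v}"
    using assms(3) by (simp add: epi_family_def)
  thus "fst ` R \<subseteq> {f \<in> Ar E. tgt E f = src E v}"
    by auto
  fix y g h
  assume y: "y \<in> Ob E" and g: "g \<in> arrows E (src E v) y" and h: "h \<in> arrows E (src E v) y"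
    and eq: "\<forall>r\<in>fst ` R. cmp E g r = cmp E h r"
  let ?b = "bang E e y"
  have b: "?b \<in> Ar E" "src E ?b = y" "tgt E ?b = e"
    using bang_arrow[OF assms(2) y] by (auto simp: arrows_def)
  have "cmp E ?b k = v" if "k \<in> arrows E (src E v) y" for k
    using that b assms(1,4) terminal_eqI[OF assms(2), of "cmp E ?b k" "src E v" v]
    by (simp add: arrows_def category_simps)
  hence "(g, ?b) \<in> arrows (slice E e) v ?b" "(h, ?b) \<in> arrows (slice E e) v ?b"
    using g h b by (auto simp: arrows_def)
  moreover have "\<forall>r\<in>R. cmp (slice E e) (g, ?b) r = cmp (slice E e) (h, ?b) r"
    using eq by auto
  moreover have "?b \<in> Ob (slice E e)"
    using b by simp
  ultimately have "(g, ?b) = (h, ?b)"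
    using assms(3) unfolding epi_family_def by blast
  thus "g = h" by simp
qed

lemma sheaf_slice_terminal:
  assumes "category E" "terminal E e" "sheaf E (epi_family E) F"
    and F': "\<And>v. Sec F' v = Sec F (src E v)" "\<And>h w. Res F' (h, w) = Res F h"
  shows "sheaf (slice E e) (epi_family (slice E e)) F'"
  unfolding sheaf_def
proof (intro conjI ballI allI impI)
  have pre: "presheaf E F"
    using assms(3) by (simp add: sheaf_def)
  thus "presheaf (slice E e) F'"
    using assms(1) unfolding presheaf_def by (auto simp: F' category_simps Pi_def)
  fix v R m
  assume v: "v \<in> Ob (slice E e)"
    and R: "R \<subseteq> {f \<in> Ar (slice E e). tgt (slice E e) f = v} \<and> epi_family (slice E e) v R"
    and m: "matching (slice E e) F' R m"
  have Rv: "\<And>r. r \<in> R \<Longrightarrow> r = (fst r, v) \<and> fst r \<in> Ar E \<and> tgt E (fst r) = src E v"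
    using R by auto
  have img: "h \<in> fst ` R \<longleftrightarrow> (h, v) \<in> R" for h
    using Rv by force
  have v': "v \<in> Ar E" "tgt E v = e"
    using v by auto
  have "matching E F (fst ` R) (\<lambda>h. m (h, v))"
    unfolding matching_def
  proof (intro conjI ballI impI)
    show "m (h, v) \<in> carrier (Sec F (src E h))" if "h \<in> fst ` R" for h
      using m that Rv[of "(h, v)"] v' assms(1) unfolding matching_def
      by (auto simp: img F' category_simps)
    fix r r' g g'
    assume r: "r \<in> fst ` R" "r' \<in> fst ` R" and g: "g \<in> Ar E" "g' \<in> Ar E"
      and eq: "tgt E g = src E r \<and> tgt E g' = src E r' \<and> cmp E r g = cmp E r' g'"
    have *: "(r, v) \<in> R" "(r', v) \<in> R"
      using r by (simp_all add: img)
    have "Res F' (g, cmp E v r) (m (r, v)) = Res F' (g', cmp E v r') (m (r', v))"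
      using m[unfolded matching_def, THEN conjunct2, rule_format, OF *,
          of "(g, cmp E v r)" "(g', cmp E v r')"] Rv[OF *(1)] Rv[OF *(2)] g eq v' assms(1)
      by (simp add: category_simps)
    thus "Res F g (m (r, v)) = Res F g' (m (r', v))"
      by (simp add: F')
  qed
  moreover have "epi_family E (src E v) (fst ` R)"
    using epi_family_slice_terminal[OF assms(1,2) _ v] R by blast
  moreover have "src E v \<in> Ob E"
    using v' assms(1) by (simp add: category_simps)
  moreover have "fst ` R \<subseteq> {f \<in> Ar E. tgt E f = src E v}"
    using Rv by auto
  ultimately have "\<exists>!s. s \<in> carrier (Sec F (src E v)) \<and> (\<forall>r\<in>fst ` R. Res F r s = m (r, v))"
    using assms(3)[unfolded sheaf_def, THEN conjunct2, rule_format,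
        of "src E v" "fst ` R" "\<lambda>h. m (h, v)"] by simp
  moreover have "(\<forall>r\<in>fst ` R. Res F r s = m (r, v)) \<longleftrightarrow> (\<forall>r\<in>R. Res F' r s = m r)" for s
  proof -
    have "Res F' r s = Res F (fst r) s" "m (fst r, v) = m r" if "r \<in> R" for r
      using Rv[OF that] F'(2)[of "fst r" v] by metis+
    thus ?thesis
      by simp
  qed
  ultimately show "\<exists>!s. s \<in> carrier (Sec F' v) \<and> (\<forall>r\<in>R. Res F' r s = m r)"
    by (simp add: F')
qed

lemma alg_sheaf_slice_terminal:
  assumes "category E" "terminal E e" "alg_sheaf E A C"
  shows "alg_sheaf (slice E e) (loc E A) (loc_alg E e C)"
proof -
  have ring: "small_sheaf E (epi_family E) C" "\<And>x. x \<in> Ob E \<Longrightarrow> cring (Sec C x)"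
     "\<And>f. f \<in> Ar E \<Longrightarrow> Res C f \<in> ring_hom (Sec C (tgt E f)) (Sec C (src E f))"
    and Str: "Str C \<in> maps E A C" "\<And>x. x \<in> Ob E \<Longrightarrow> Str C x \<in> ring_hom (Sec A x) (Sec C x)"
    using assms(3) by (auto simp: alg_sheaf_def ring_sheaf_def ring_maps_def)
  have "small_sheaf (slice E e) (epi_family (slice E e)) (loc_alg E e C)"
    using ring(1) sheaf_slice_terminal[OF assms(1,2), of C "loc_alg E e C"] assms(1)
    by (auto simp: small_sheaf_def category_simps)
  moreover have "loc_map E e (Str C) \<in> maps (slice E e) (loc E A) (loc_alg E e C)"
    by (rule loc_map_maps[OF assms(1) Str(1)]) simp_all
  moreover have "Res C h \<in> ring_hom (Sec C (src E w)) (Sec C (src E h))"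
    if "h \<in> Ar E" "tgt E h = src E w" for h w
    using ring(3)[OF that(1)] that(2) by simp
  ultimately show ?thesis
    using ring(2) Str assms(1)
    by (auto simp: alg_sheaf_def ring_sheaf_def ring_maps_def category_simps)
qed

section \<open>The site of algebras over an algebra\<close>

lemma alg_cat_simps [simp]:
  "X \<in> Ob (alg_cat E A B) \<longleftrightarrow> base X \<in> Ob E \<and>
     alg_sheaf (slice E (base X)) (loc E A) (ring_of X) \<and>
     aug X \<in> alg_maps (slice E (base X)) (loc E A) (ring_of X) (loc_alg E (base X) B)"
  "src (alg_cat E A B) \<phi> = dom_ob \<phi>" "tgt (alg_cat E A B) \<phi> = cod_ob \<phi>"
  "idn (alg_cat E A B) X = \<lparr>dom_ob = X, cod_ob = X, base_ar = idn E (base X),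
     ring_ar = id_map (slice E (base X)) (ring_of X)\<rparr>"
  "cmp (alg_cat E A B) \<psi> \<phi> = \<lparr>dom_ob = dom_ob \<phi>, cod_ob = cod_ob \<psi>,
     base_ar = cmp E (base_ar \<psi>) (base_ar \<phi>), ring_ar = pull_along E \<phi> (ring_ar \<psi>)\<rparr>"
  by (auto simp: alg_cat_def Let_def)

lemma alg_cat_Ar_iff:
  "\<phi> \<in> Ar (alg_cat E A B) \<longleftrightarrow>
     dom_ob \<phi> \<in> Ob (alg_cat E A B) \<and> cod_ob \<phi> \<in> Ob (alg_cat E A B) \<and>
     base_ar \<phi> \<in> arrows E (base (dom_ob \<phi>)) (base (cod_ob \<phi>)) \<and>
     ring_ar \<phi> \<in> alg_maps (slice E (base (dom_ob \<phi>))) (loc E A)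
       (ring_of (dom_ob \<phi>)) (pull_alg E (base_ar \<phi>) (ring_of (cod_ob \<phi>))) \<and>
     pull_along E \<phi> (aug (cod_ob \<phi>)) = aug (dom_ob \<phi>)"
  by (simp add: alg_cat_def Let_def)

lemma alg_cat_base_arD:
  assumes "\<phi> \<in> Ar (alg_cat E A B)"
  shows "base_ar \<phi> \<in> Ar E" "src E (base_ar \<phi>) = base (dom_ob \<phi>)"
    "tgt E (base_ar \<phi>) = base (cod_ob \<phi>)"
  using assms by (auto simp: alg_cat_Ar_iff arrows_def)

lemma alg_cat_ring_arD:
  assumes "\<phi> \<in> Ar (alg_cat E A B)" "v \<in> Ar E" "tgt E v = base (dom_ob \<phi>)"
  shows "ring_ar \<phi> v \<in> ring_hom (Sec (ring_of (dom_ob \<phi>)) v)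
           (Sec (ring_of (cod_ob \<phi>)) (cmp E (base_ar \<phi>) v))"
    and "a \<in> carrier (Sec A (src E v)) \<Longrightarrow> ring_ar \<phi> v (Str (ring_of (dom_ob \<phi>)) v a) =
           Str (ring_of (cod_ob \<phi>)) (cmp E (base_ar \<phi>) v) a"
  using assms alg_cat_base_arD[OF assms(1)] unfolding alg_cat_Ar_iff
  by (auto simp: alg_maps_iff)

lemma alg_cat_ring_ar_closed:
  assumes "\<phi> \<in> Ar (alg_cat E A B)" "v \<in> Ar E" "tgt E v = base (dom_ob \<phi>)"
    and "c \<in> carrier (Sec (ring_of (dom_ob \<phi>)) v)"
  shows "ring_ar \<phi> v c \<in> carrier (Sec (ring_of (cod_ob \<phi>)) (cmp E (base_ar \<phi>) v))"
  using alg_cat_ring_arD(1)[OF assms(1-3)] assms(4) by (auto simp: ring_hom_def)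

lemma alg_cat_ring_ar_natural:
  assumes "\<phi> \<in> Ar (alg_cat E A B)"
    and "h \<in> Ar E" "w \<in> Ar E" "tgt E w = base (dom_ob \<phi>)" "tgt E h = src E w"
    and "c \<in> carrier (Sec (ring_of (dom_ob \<phi>)) w)"
  shows "ring_ar \<phi> (cmp E w h) (Res (ring_of (dom_ob \<phi>)) (h, w) c) =
         Res (ring_of (cod_ob \<phi>)) (h, cmp E (base_ar \<phi>) w) (ring_ar \<phi> w c)"
proof -
  have "ring_ar \<phi> \<in> maps (slice E (base (dom_ob \<phi>)))
       (ring_of (dom_ob \<phi>)) (pull_alg E (base_ar \<phi>) (ring_of (cod_ob \<phi>)))"
    using assms(1) by (simp add: alg_cat_Ar_iff alg_maps_iff)
  from maps_natural_slice[OF this assms(2-6)] show ?thesis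
    by simp
qed

lemma alg_sheafD:
  assumes "alg_sheaf T A C"
  shows "x \<in> Ob T \<Longrightarrow> cring (Sec C x)"
    "f \<in> Ar T \<Longrightarrow> Res C f \<in> ring_hom (Sec C (tgt T f)) (Sec C (src T f))"
    "x \<in> Ob T \<Longrightarrow> Str C x \<in> ring_hom (Sec A x) (Sec C x)"
    "presheaf T C"
  using assms
  by (auto simp: alg_sheaf_def ring_sheaf_def ring_maps_def small_sheaf_def sheaf_def)

lemma id_map_alg_maps:
  assumes "category T" "alg_sheaf T A C"
  shows "id_map T C \<in> alg_maps T A C C"
proof -
  have "id_map T C \<in> maps T C C"
    unfolding id_map_def
    using alg_sheafD(4)[OF assms(2)] by (intro maps_lamI assms(1)) (auto simp: presheaf_def)
  moreover have "Str C x a \<in> carrier (Sec C x)" if "x \<in> Ob T" "a \<in> carrier (Sec A x)" for x a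
    using alg_sheafD(3)[OF assms(2) that(1)] that(2) by (auto simp: ring_hom_def)
  ultimately show ?thesis
    using alg_sheafD(1)[OF assms(2)]
    by (auto simp: alg_maps_iff id_map_def ring_hom_def cring_def ring.ring_simprules)
qed

lemma pull_along_lam:
  "pull_along E \<phi> \<eta> = (\<lambda>v\<in>Ob (slice E (base (dom_ob \<phi>))). \<lambda>c\<in>carrier (Sec (ring_of (dom_ob \<phi>)) v).
     \<eta> (cmp E (base_ar \<phi>) v) (ring_ar \<phi> v c))"
  by (simp add: pull_along_def compose_def)

lemma pull_along_apply [simp]:
  "v \<in> Ar E \<Longrightarrow> tgt E v = base (dom_ob \<phi>) \<Longrightarrow> c \<in> carrier (Sec (ring_of (dom_ob \<phi>)) v) \<Longrightarrow>
     pull_along E \<phi> \<eta> v c = \<eta> (cmp E (base_ar \<phi>) v) (ring_ar \<phi> v c)"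
  by (simp add: pull_along_lam)

text \<open>The target \<open>D'\<close> stands for the pullback of \<open>D\<close> along the underlying arrow of \<open>\<phi>\<close>.  It is described by
  its sections and restriction maps on the slice, which lets it be \<open>pull_alg\<close> of an algebra as well
  as the restriction to a smaller slice of a module on \<open>E\<close>.\<close>

lemma pull_along_maps:
  assumes "category E" "\<phi> \<in> Ar (alg_cat E A B)"
    and \<eta>: "\<eta> \<in> maps (slice E (base (cod_ob \<phi>))) (ring_of (cod_ob \<phi>)) D"
    and D': "\<And>v. v \<in> Ob (slice E (base (dom_ob \<phi>))) \<Longrightarrow>
               carrier (Sec D' v) = carrier (Sec D (cmp E (base_ar \<phi>) v))"
      "\<And>h w. (h, w) \<in> Ar (slice E (base (dom_ob \<phi>))) \<Longrightarrow>
               Res D' (h, w) = Res D (h, cmp E (base_ar \<phi>) w)"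
  shows "pull_along E \<phi> \<eta> \<in> maps (slice E (base (dom_ob \<phi>))) (ring_of (dom_ob \<phi>)) D'"
  unfolding pull_along_lam
proof (rule maps_lamI[OF category_slice[OF assms(1)]])
  note \<phi> = alg_cat_base_arD[OF assms(2)]
  let ?f = "base_ar \<phi>" and ?C = "ring_of (dom_ob \<phi>)" and ?U = "base (dom_ob \<phi>)"
  show "\<eta> (cmp E ?f v) (ring_ar \<phi> v c) \<in> carrier (Sec D' v)"
    if v: "v \<in> Ob (slice E ?U)" and c: "c \<in> carrier (Sec ?C v)" for v c
    using maps_closed[OF \<eta>, of "cmp E ?f v" "ring_ar \<phi> v c"] v c \<phi> assms(1) D'(1)[OF v]
      alg_cat_ring_ar_closed[OF assms(2), of v c]
    by (simp add: category_simps)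
  fix k c assume k: "k \<in> Ar (slice E ?U)" and c: "c \<in> carrier (Sec ?C (tgt (slice E ?U) k))"
  obtain h w where [simp]: "k = (h, w)" by (cases k)
  have hw: "h \<in> Ar E" "w \<in> Ar E" "tgt E w = ?U" "tgt E h = src E w"
    using k by auto
  have C: "alg_sheaf (slice E ?U) (loc E A) ?C"
    using assms(2) by (simp add: alg_cat_Ar_iff)
  have cw: "c \<in> carrier (Sec ?C w)"
    using c by simp
  have Res: "Res ?C (h, w) c \<in> carrier (Sec ?C (cmp E w h))"
    using alg_sheafD(2)[OF C k] cw by (auto simp: ring_hom_def)
  have "\<eta> (cmp E ?f (cmp E w h)) (ring_ar \<phi> (cmp E w h) (Res ?C (h, w) c)) =
        \<eta> (cmp E (cmp E ?f w) h) (Res (ring_of (cod_ob \<phi>)) (h, cmp E ?f w) (ring_ar \<phi> w c))"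
    using alg_cat_ring_ar_natural[OF assms(2) hw cw] hw \<phi> assms(1) by (simp add: category_simps)
  also have "\<dots> = Res D (h, cmp E ?f w) (\<eta> (cmp E ?f w) (ring_ar \<phi> w c))"
    using hw \<phi> assms(1) alg_cat_ring_ar_closed[OF assms(2), of w c] cw
    by (intro maps_natural_slice[OF \<eta>]) (simp_all add: category_simps)
  finally show "Res ?C k c \<in> carrier (Sec ?C (src (slice E ?U) k)) \<and>
      \<eta> (cmp E ?f (src (slice E ?U) k)) (ring_ar \<phi> (src (slice E ?U) k) (Res ?C k c)) =
      Res D' k (\<eta> (cmp E ?f (tgt (slice E ?U) k)) (ring_ar \<phi> (tgt (slice E ?U) k) c))"
    using Res D'(2)[of h w] k by simp
qed

text \<open>The composite of ring homomorphisms, where only the values on the carrier are prescribed: a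
  component of \<open>pull_along\<close> is such a composite, made undefined off the carrier.\<close>

lemma ring_hom_compose_on_carrier:
  assumes "ring R" "f \<in> ring_hom R S" "g \<in> ring_hom S P" "\<And>c. c \<in> carrier R \<Longrightarrow> k c = g (f c)"
  shows "k \<in> ring_hom R P"
  using assms
  by (auto simp: ring_hom_def Pi_def ring.ring_simprules monoid.m_closed[OF ring.is_monoid])

lemma pull_along_alg_maps:
  assumes "category E" "\<phi> \<in> Ar (alg_cat E A B)"
    and \<eta>: "\<eta> \<in> alg_maps (slice E (base (cod_ob \<phi>))) (loc E A) (ring_of (cod_ob \<phi>)) D"
  shows "pull_along E \<phi> \<eta> \<in> alg_maps (slice E (base (dom_ob \<phi>))) (loc E A) (ring_of (dom_ob \<phi>))
           (pull_alg E (base_ar \<phi>) D)"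
proof -
  note \<phi> = alg_cat_base_arD[OF assms(2)]
  let ?f = "base_ar \<phi>" and ?C = "ring_of (dom_ob \<phi>)" and ?U = "base (dom_ob \<phi>)"
  have C: "alg_sheaf (slice E ?U) (loc E A) ?C"
    using assms(2) by (simp add: alg_cat_Ar_iff)
  have \<eta>_maps: "\<eta> \<in> maps (slice E (base (cod_ob \<phi>))) (ring_of (cod_ob \<phi>)) D"
    using \<eta> by (simp add: alg_maps_iff)
  have "pull_along E \<phi> \<eta> \<in> maps (slice E ?U) ?C (pull_alg E ?f D)"
    by (rule pull_along_maps[OF assms(1,2) \<eta>_maps]) simp_all
  moreover have "pull_along E \<phi> \<eta> v \<in> ring_hom (Sec ?C v) (Sec (pull_alg E ?f D) v)"
    "a \<in> carrier (Sec (loc E A) v) \<Longrightarrow>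
       pull_along E \<phi> \<eta> v (Str ?C v a) = Str (pull_alg E ?f D) v a"
    if "v \<in> Ob (slice E ?U)" for v a
  proof -
    have v: "v \<in> Ar E" "tgt E v = ?U"
      using that by auto
    hence fv: "cmp E ?f v \<in> Ob (slice E (base (cod_ob \<phi>)))"
      using \<phi> assms(1) by (simp add: category_simps)
    have \<eta>_hom: "\<eta> (cmp E ?f v) \<in> ring_hom (Sec (ring_of (cod_ob \<phi>)) (cmp E ?f v)) (Sec D (cmp E ?f v))"
      using \<eta> fv by (simp add: alg_maps_iff)
    have "ring (Sec ?C v)"
      using alg_sheafD(1)[OF C that] by (rule cring.axioms)
    thus "pull_along E \<phi> \<eta> v \<in> ring_hom (Sec ?C v) (Sec (pull_alg E ?f D) v)"
      using v ring_hom_compose_on_carrier[OF _ alg_cat_ring_arD(1)[OF assms(2) v] \<eta>_hom] by simp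
    assume a: "a \<in> carrier (Sec (loc E A) v)"
    have "Str ?C v a \<in> carrier (Sec ?C v)"
      using alg_sheafD(3)[OF C that] a by (auto simp: ring_hom_def)
    thus "pull_along E \<phi> \<eta> v (Str ?C v a) = Str (pull_alg E ?f D) v a"
      using v \<eta> fv a alg_cat_ring_arD(2)[OF assms(2) v] \<phi> assms(1)
      by (simp add: alg_maps_iff category_simps)
  qed
  ultimately show ?thesis
    by (simp add: alg_maps_iff)
qed

lemma pull_along_cmp:
  assumes "category E" "\<phi> \<in> Ar (alg_cat E A B)" "\<psi> \<in> Ar (alg_cat E A B)" "cod_ob \<phi> = dom_ob \<psi>"
  shows "pull_along E (cmp (alg_cat E A B) \<psi> \<phi>) \<eta> = pull_along E \<phi> (pull_along E \<psi> \<eta>)"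
proof -
  note \<phi> = alg_cat_base_arD[OF assms(2)] and \<psi> = alg_cat_base_arD[OF assms(3)]
  have "\<eta> (cmp E (cmp E (base_ar \<psi>) (base_ar \<phi>)) v) (pull_along E \<phi> (ring_ar \<psi>) v c) =
        pull_along E \<psi> \<eta> (cmp E (base_ar \<phi>) v) (ring_ar \<phi> v c)"
    if "v \<in> Ob (slice E (base (dom_ob \<phi>)))" "c \<in> carrier (Sec (ring_of (dom_ob \<phi>)) v)" for v c
    using that \<phi> \<psi> assms alg_cat_ring_ar_closed[OF assms(2), of v c]
    by (simp add: category_simps)
  thus ?thesis
    unfolding pull_along_lam[of E "cmp (alg_cat E A B) \<psi> \<phi>"]
      pull_along_lam[of E \<phi> "pull_along E \<psi> \<eta>"]
    by (auto intro!: restrict_ext)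
qed

lemma pull_along_idn:
  assumes "category E" "\<eta> \<in> maps (slice E (base X)) (ring_of X) D"
  shows "pull_along E (idn (alg_cat E A B) X) \<eta> = \<eta>"
  by (subst (2) maps_restrict[OF assms(2)])
     (auto simp: pull_along_lam id_map_def fun_eq_iff restrict_def assms(1) category_simps)

lemma category_alg_cat:
  assumes "category E"
  shows "category (alg_cat E A B)"
  unfolding category_def
proof (intro conjI ballI impI)
  let ?T = "alg_cat E A B"
  fix \<phi> assume \<phi>: "\<phi> \<in> Ar ?T"
  show "src ?T \<phi> \<in> Ob ?T" "tgt ?T \<phi> \<in> Ob ?T"
    using \<phi> by (simp_all add: alg_cat_Ar_iff)
  have ring_ar: "ring_ar \<phi> \<in> maps (slice E (base (dom_ob \<phi>))) (ring_of (dom_ob \<phi>))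
      (pull_alg E (base_ar \<phi>) (ring_of (cod_ob \<phi>)))"
    using \<phi> by (simp add: alg_cat_Ar_iff alg_maps_iff)
  show "cmp ?T \<phi> (idn ?T (src ?T \<phi>)) = \<phi>"
    using pull_along_idn[OF assms ring_ar, of A B] alg_cat_base_arD[OF \<phi>] assms
    by (simp add: category_simps)
  have "pull_along E \<phi> (id_map (slice E (base (cod_ob \<phi>))) (ring_of (cod_ob \<phi>))) = ring_ar \<phi>"
    using alg_cat_base_arD[OF \<phi>] assms alg_cat_ring_ar_closed[OF \<phi>]
    by (subst maps_restrict[OF ring_ar])
       (auto simp: pull_along_lam id_map_def fun_eq_iff restrict_def category_simps)
  thus "cmp ?T (idn ?T (tgt ?T \<phi>)) \<phi> = \<phi>"
    using alg_cat_base_arD[OF \<phi>] assms by (simp add: category_simps)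
  fix \<psi> assume \<psi>: "\<psi> \<in> Ar ?T" and cod: "tgt ?T \<phi> = src ?T \<psi>"
  note \<phi>_base = alg_cat_base_arD[OF \<phi>] and \<psi>_base = alg_cat_base_arD[OF \<psi>]
  let ?f = "base_ar \<phi>" and ?g = "base_ar \<psi>" and ?U = "base (dom_ob \<phi>)"
  have "alg_maps (slice E ?U) (loc E A) (ring_of (dom_ob \<phi>))
          (pull_alg E ?f (pull_alg E ?g (ring_of (cod_ob \<psi>)))) =
        alg_maps (slice E ?U) (loc E A) (ring_of (dom_ob \<phi>))
          (pull_alg E (cmp E ?g ?f) (ring_of (cod_ob \<psi>)))"
  proof (rule alg_maps_cong_cod[OF category_slice[OF assms]])
    fix k assume "k \<in> Ar (slice E ?U)"
    then show "Res (pull_alg E ?f (pull_alg E ?g (ring_of (cod_ob \<psi>)))) k =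
               Res (pull_alg E (cmp E ?g ?f) (ring_of (cod_ob \<psi>))) k"
      using \<phi>_base \<psi>_base cod assms by (cases k) (simp add: category_simps)
  qed (use \<phi>_base \<psi>_base cod assms in \<open>simp_all add: category_simps\<close>)
  moreover have "ring_ar \<psi> \<in> alg_maps (slice E (base (cod_ob \<phi>))) (loc E A) (ring_of (cod_ob \<phi>))
      (pull_alg E ?g (ring_of (cod_ob \<psi>)))"
    using \<psi> cod by (simp add: alg_cat_Ar_iff)
  ultimately have "pull_along E \<phi> (ring_ar \<psi>) \<in> alg_maps (slice E ?U) (loc E A)
      (ring_of (dom_ob \<phi>)) (pull_alg E (cmp E ?g ?f) (ring_of (cod_ob \<psi>)))"
    using pull_along_alg_maps[OF assms \<phi>] by blast
  moreover have "pull_along E (cmp ?T \<psi> \<phi>) (aug (cod_ob \<psi>)) = aug (dom_ob \<phi>)"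
    using pull_along_cmp[OF assms \<phi> \<psi>] cod \<phi> \<psi> by (simp add: alg_cat_Ar_iff)
  ultimately show "cmp ?T \<psi> \<phi> \<in> arrows ?T (src ?T \<phi>) (tgt ?T \<psi>)"
    using \<phi> \<psi> \<phi>_base \<psi>_base cod assms
    by (simp add: arrows_def alg_cat_Ar_iff category_simps)
  fix \<chi> assume \<chi>: "\<chi> \<in> Ar ?T" and cod': "tgt ?T \<psi> = src ?T \<chi>"
  show "cmp ?T \<chi> (cmp ?T \<psi> \<phi>) = cmp ?T (cmp ?T \<chi> \<psi>) \<phi>"
    using pull_along_cmp[OF assms \<phi> \<psi>, of "ring_ar \<chi>"] cod cod' assms
      \<phi>_base \<psi>_base alg_cat_base_arD[OF \<chi>]
    by (simp add: category_simps)
next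
  let ?T = "alg_cat E A B"
  fix X assume X: "X \<in> Ob ?T"
  have U: "base X \<in> Ob E" and C: "alg_sheaf (slice E (base X)) (loc E A) (ring_of X)"
    using X by simp_all
  have "id_map (slice E (base X)) (ring_of X) \<in>
      alg_maps (slice E (base X)) (loc E A) (ring_of X) (ring_of X)"
    using category_slice[OF assms] C by (rule id_map_alg_maps)
  also have "\<dots> = alg_maps (slice E (base X)) (loc E A) (ring_of X)
      (pull_alg E (idn E (base X)) (ring_of X))"
  proof (rule alg_maps_cong_cod[OF category_slice[OF assms]])
    fix k assume "k \<in> Ar (slice E (base X))"
    then show "Res (ring_of X) k = Res (pull_alg E (idn E (base X)) (ring_of X)) k"
      using assms by (cases k) (simp add: category_simps)
  qed (use U assms in \<open>simp_all add: category_simps\<close>)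
  finally have "id_map (slice E (base X)) (ring_of X) \<in> \<dots>" .
  moreover have "aug X \<in> maps (slice E (base X)) (ring_of X) (loc_alg E (base X) B)"
    using X by (simp add: alg_maps_iff)
  note pull_along_idn[OF assms this, of A B]
  ultimately show "idn ?T X \<in> arrows ?T X X"
    using X U assms by (simp add: arrows_def alg_cat_Ar_iff category_simps)
qed

text \<open>An object \<open>(U, C)\<close> maps to \<open>(e, B)\<close> only by its augmentation: the augmentation of \<open>(e, B)\<close> is the
  identity, so pulling it back along an arrow returns the algebra map of that arrow, and
  compatibility with augmentations then leaves no choice.\<close>

lemma pull_along_aug_top_alg:
  assumes "category E" "dom_ob \<phi> = X" "cod_ob \<phi> = top_alg E e B"
    and "base_ar \<phi> \<in> arrows E (base X) e"
    and \<rho>: "ring_ar \<phi> \<in> maps (slice E (base X)) (ring_of X) (pull_alg E (base_ar \<phi>) (loc_alg E e B))"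
  shows "pull_along E \<phi> (aug (top_alg E e B)) = ring_ar \<phi>"
proof -
  have "aug (top_alg E e B) (cmp E (base_ar \<phi>) v) (ring_ar \<phi> v c) = ring_ar \<phi> v c"
    if "v \<in> Ob (slice E (base X))" "c \<in> carrier (Sec (ring_of X) v)" for v c
    using that assms maps_closed[OF \<rho> that]
    by (simp add: top_alg_def arrows_def category_simps id_map_def)
  thus ?thesis
    by (subst maps_restrict[OF \<rho>]) (auto simp: pull_along_lam assms(2) fun_eq_iff restrict_def)
qed

lemma top_alg_Ob:
  assumes "category E" "terminal E e" "alg_sheaf E A B"
  shows "top_alg E e B \<in> Ob (alg_cat E A B)"
proof -
  have "id_map E B \<in> alg_maps E A B B"
    using assms(1,3) by (rule id_map_alg_maps)
  from loc_map_alg_maps[OF assms(1) this, of e] show ?thesis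
    using alg_sheaf_slice_terminal[OF assms] assms(2) by (simp add: top_alg_def terminal_def)
qed

lemma top_alg_arrow_iff:
  assumes "category E" "terminal E e" "alg_sheaf E A B" "X \<in> Ob (alg_cat E A B)"
  shows "\<phi> \<in> arrows (alg_cat E A B) X (top_alg E e B) \<longleftrightarrow>
    \<phi> = \<lparr>dom_ob = X, cod_ob = top_alg E e B, base_ar = bang E e (base X), ring_ar = aug X\<rparr>"
    (is "_ \<longleftrightarrow> \<phi> = ?\<beta>")
proof
  let ?z = "top_alg E e B"
  have U: "base X \<in> Ob E"
    using assms(4) by simp
  assume \<phi>: "\<phi> \<in> arrows (alg_cat E A B) X ?z"
  hence dom: "dom_ob \<phi> = X" "cod_ob \<phi> = ?z" and Ar: "\<phi> \<in> Ar (alg_cat E A B)"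
    by (auto simp: arrows_def)
  hence base: "base_ar \<phi> \<in> arrows E (base X) e"
    by (simp add: alg_cat_Ar_iff top_alg_def)
  have "ring_ar \<phi> \<in> maps (slice E (base X)) (ring_of X) (pull_alg E (base_ar \<phi>) (loc_alg E e B))"
    using Ar by (simp add: alg_cat_Ar_iff dom alg_maps_iff top_alg_def)
  from pull_along_aug_top_alg[OF assms(1) dom base this] have "ring_ar \<phi> = aug X"
    using Ar by (simp add: alg_cat_Ar_iff dom)
  thus "\<phi> = ?\<beta>"
    using dom bang_eqI[OF assms(2) U base] by simp
next
  let ?z = "top_alg E e B"
  have U: "base X \<in> Ob E"
    using assms(4) by simp
  note b = bang_arrow[OF assms(2) U]
  have "alg_maps (slice E (base X)) (loc E A) (ring_of X) (loc_alg E (base X) B) =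
        alg_maps (slice E (base X)) (loc E A) (ring_of X)
          (pull_alg E (bang E e (base X)) (loc_alg E e B))"
  proof (rule alg_maps_cong_cod[OF category_slice[OF assms(1)]])
    fix k assume "k \<in> Ar (slice E (base X))"
    then show "Res (loc_alg E (base X) B) k = Res (pull_alg E (bang E e (base X)) (loc_alg E e B)) k"
      by (cases k) simp
  qed (use assms(1) b in \<open>simp_all add: arrows_def category_simps\<close>)
  hence aug: "aug X \<in> alg_maps (slice E (base X)) (loc E A) (ring_of X)
          (pull_alg E (bang E e (base X)) (loc_alg E e B))"
    using assms(4) by simp
  hence "pull_along E ?\<beta> (aug ?z) = aug X"
    using pull_along_aug_top_alg[OF assms(1), of ?\<beta> X e B] b by (simp add: alg_maps_iff)
  hence "?\<beta> \<in> arrows (alg_cat E A B) X ?z"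
    using aug assms(4) top_alg_Ob[OF assms(1-3)] b
    by (simp add: arrows_def alg_cat_Ar_iff top_alg_def)
  thus "\<phi> = ?\<beta> \<Longrightarrow> \<phi> \<in> arrows (alg_cat E A B) X ?z"
    by simp
qed

lemma terminal_top_alg:
  assumes "category E" "terminal E e" "alg_sheaf E A B"
  shows "terminal (alg_cat E A B) (top_alg E e B)"
  using top_alg_arrow_iff[OF assms] top_alg_Ob[OF assms] unfolding terminal_def by simp

section \<open>Torsors under a group\<close>

text \<open>A simply transitive action, given by a function \<open>a\<close> that may take arbitrary values off \<open>X\<close>; it is cut
  down to \<open>X\<close> because the permutations in \<open>BijGroup\<close> are extensional.\<close>

lemma group_torsorI:
  assumes "group G" "X \<noteq> {}"
    and closed: "\<And>g x. g \<in> carrier G \<Longrightarrow> x \<in> X \<Longrightarrow> a g x \<in> X"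
    and one: "\<And>x. x \<in> X \<Longrightarrow> a \<one>\<^bsub>G\<^esub> x = x"
    and mult: "\<And>g h x. g \<in> carrier G \<Longrightarrow> h \<in> carrier G \<Longrightarrow> x \<in> X \<Longrightarrow>
                 a (g \<otimes>\<^bsub>G\<^esub> h) x = a g (a h x)"
    and uniq: "\<And>x y. x \<in> X \<Longrightarrow> y \<in> X \<Longrightarrow> \<exists>!g. g \<in> carrier G \<and> a g x = y"
  shows "group_torsor G X (\<lambda>g. \<lambda>x\<in>X. a g x)"
proof -
  interpret group G by fact
  have inv: "a (inv\<^bsub>G\<^esub> g) (a g x) = x" "a g (a (inv\<^bsub>G\<^esub> g) x) = x" if "g \<in> carrier G" "x \<in> X" for g x
    using that mult[of "inv\<^bsub>G\<^esub> g" g x] mult[of g "inv\<^bsub>G\<^esub> g" x] one by auto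
  have "bij_betw (\<lambda>x\<in>X. a g x) X X" if "g \<in> carrier G" for g
    by (rule bij_betw_byWitness[where f' = "a (inv\<^bsub>G\<^esub> g)"]) (use that inv closed in auto)
  hence "(\<lambda>g. \<lambda>x\<in>X. a g x) \<in> hom G (BijGroup X)"
    using closed mult by (auto simp: hom_def BijGroup_def Bij_def compose_def intro!: restrict_ext)
  hence "group_action G X (\<lambda>g. \<lambda>x\<in>X. a g x)"
    by (simp add: group_action_def group_hom_def group_hom_axioms_def group_BijGroup group_axioms)
  moreover have "bij_betw (\<lambda>(g, x). ((\<lambda>x\<in>X. a g x) x, x)) (carrier G \<times> X) (X \<times> X)"
  proof (rule bij_betwI')
    show "\<exists>q\<in>carrier G \<times> X. r = (case q of (g, x) \<Rightarrow> ((\<lambda>x\<in>X. a g x) x, x))" if "r \<in> X \<times> X" for r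
    proof -
      from that obtain y x where r: "r = (y, x)" "y \<in> X" "x \<in> X"
        by auto
      then obtain g where "g \<in> carrier G" "a g x = y"
        using uniq[of x y] by blast
      thus ?thesis
        using r by (intro bexI[of _ "(g, x)"]) auto
    qed
    show "((case q of (g, x) \<Rightarrow> ((\<lambda>x\<in>X. a g x) x, x)) = (case r of (g, x) \<Rightarrow> ((\<lambda>x\<in>X. a g x) x, x))) =
        (q = r)" if "q \<in> carrier G \<times> X" "r \<in> carrier G \<times> X" for q r
    proof -
      obtain g x h y where q: "q = (g, x)" "r = (h, y)"
        by (cases q; cases r)
      show ?thesis
        using that uniq[of x "a h x"] closed[of h x] by (auto simp: q)
    qed
  qed (use closed in auto)
  ultimately show ?thesis
    using assms(2) by (simp add: group_torsor_def)
qed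

lemma group_torsorD:
  assumes "group_torsor G X (\<lambda>g. \<lambda>x\<in>X. a g x)"
  shows "group G" and "g \<in> carrier G \<Longrightarrow> x \<in> X \<Longrightarrow> a g x \<in> X"
    and "g \<in> carrier G \<Longrightarrow> h \<in> carrier G \<Longrightarrow> x \<in> X \<Longrightarrow> a (g \<otimes>\<^bsub>G\<^esub> h) x = a g (a h x)"
    and "x \<in> X \<Longrightarrow> y \<in> X \<Longrightarrow> \<exists>!g. g \<in> carrier G \<and> a g x = y"
proof -
  interpret group_action G X "\<lambda>g. \<lambda>x\<in>X. a g x"
    using assms by (simp add: group_torsor_def)
  show "group G"
    using group_hom by (rule group_hom.axioms(1))
  show closed: "a g x \<in> X" if "g \<in> carrier G" "x \<in> X" for g x
    using element_image[OF that refl] that by simp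
  show "a (g \<otimes>\<^bsub>G\<^esub> h) x = a g (a h x)" if "g \<in> carrier G" "h \<in> carrier G" "x \<in> X"
    using composition_rule[OF that(3,1,2)] that closed by simp
  assume xy: "x \<in> X" "y \<in> X"
  have bij: "bij_betw (\<lambda>(g, x). ((\<lambda>x\<in>X. a g x) x, x)) (carrier G \<times> X) (X \<times> X)"
    using assms by (simp add: group_torsor_def)
  have "(y, x) \<in> (\<lambda>(g, x). ((\<lambda>x\<in>X. a g x) x, x)) ` (carrier G \<times> X)"
    using bij xy by (auto simp: bij_betw_def)
  then obtain g where "g \<in> carrier G" "a g x = y"
    by auto
  moreover have "g = h" if "g \<in> carrier G" "h \<in> carrier G" "a g x = a h x" for g h
    using inj_onD[OF bij_betw_imp_inj_on[OF bij], of "(g, x)" "(h, x)"] that xy by auto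
  ultimately show "\<exists>!g. g \<in> carrier G \<and> a g x = y"
    by blast
qed

lemma group_torsor_iso:
  assumes "group_torsor G X act" "\<kappa> \<in> iso G H" "group H"
  shows "group_torsor H X (\<lambda>h. act (inv_into (carrier G) \<kappa> h))"
proof -
  have act: "group_action G X act" "X \<noteq> {}"
     "bij_betw (\<lambda>(g, x). (act g x, x)) (carrier G \<times> X) (X \<times> X)"
    using assms(1) by (auto simp: group_torsor_def)
  have G: "group G" "act \<in> hom G (BijGroup X)"
    using act(1) by (auto simp: group_action_def group_hom_def group_hom_axioms_def)
  have inv: "inv_into (carrier G) \<kappa> \<in> iso H G"
    using group.iso_set_sym[OF G(1) assms(2)] .
  hence "(\<lambda>h. act (inv_into (carrier G) \<kappa> h)) \<in> hom H (BijGroup X)"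
    using hom_compose[OF _ G(2), of "inv_into (carrier G) \<kappa>" H] by (simp add: iso_def o_def)
  hence "group_action H X (\<lambda>h. act (inv_into (carrier G) \<kappa> h))"
    by (simp add: group_action_def group_hom_def group_hom_axioms_def group_BijGroup assms(3))
  moreover have "bij_betw (\<lambda>(h, x). (inv_into (carrier G) \<kappa> h, x)) (carrier H \<times> X) (carrier G \<times> X)"
    using inv unfolding iso_def bij_betw_def inj_on_def by (auto simp: image_iff) blast
  from bij_betw_trans[OF this act(3)]
  have "bij_betw (\<lambda>(h, x). (act (inv_into (carrier G) \<kappa> h) x, x)) (carrier H \<times> X) (X \<times> X)"
    by (rule bij_betw_cong[THEN iffD1, rotated]) auto
  ultimately show ?thesis
    using act(2) by (simp add: group_torsor_def)
qed

section \<open>Derivations and lifts to a square-zero extension\<close>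

text \<open>The conditions are on the rings and modules of sections at one object or one arrow at a time.  So they
  pass from a topos to each of its slices, and the locale covers both the derivations of \<open>B\<close> on \<open>E\<close>
  and those of \<open>C\<close> on \<open>E/U\<close> for an object \<open>(U, C)\<close> of the site.\<close>

locale derivation_presheaves =
  fixes T :: "('x, 'y) cat" and A :: "('x, 'y, 'u) ring_presheaf"
    and B :: "('x, 'y, 'u) alg" and J :: "('x, 'y, 'u) module_presheaf"
    and C :: "('x, 'y, 'u) alg" and \<beta> :: "'x \<Rightarrow> 'u \<Rightarrow> 'u"
  assumes category: "category T"
    and module_J: "x \<in> Ob T \<Longrightarrow> module (Sec B x) (Sec J x)"
    and Res_J_closed: "f \<in> Ar T \<Longrightarrow> j \<in> carrier (Sec J (tgt T f)) \<Longrightarrow>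
          Res J f j \<in> carrier (Sec J (src T f))"
    and Res_J_add: "f \<in> Ar T \<Longrightarrow> j \<in> carrier (Sec J (tgt T f)) \<Longrightarrow> k \<in> carrier (Sec J (tgt T f)) \<Longrightarrow>
          Res J f (j \<oplus>\<^bsub>Sec J (tgt T f)\<^esub> k) = Res J f j \<oplus>\<^bsub>Sec J (src T f)\<^esub> Res J f k"
    and cring_C: "x \<in> Ob T \<Longrightarrow> cring (Sec C x)"
    and Res_C: "f \<in> Ar T \<Longrightarrow> Res C f \<in> ring_hom (Sec C (tgt T f)) (Sec C (src T f))"
    and Str_C: "x \<in> Ob T \<Longrightarrow> a \<in> carrier (Sec A x) \<Longrightarrow> Str C x a \<in> carrier (Sec C x)"
    and \<beta>_alg: "\<beta> \<in> alg_maps T A C B"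
begin

lemma Res_C_closed:
  "f \<in> Ar T \<Longrightarrow> c \<in> carrier (Sec C (tgt T f)) \<Longrightarrow> Res C f c \<in> carrier (Sec C (src T f))"
  using Res_C by (auto simp: ring_hom_def)

lemma \<beta>_closed: "x \<in> Ob T \<Longrightarrow> c \<in> carrier (Sec C x) \<Longrightarrow> \<beta> x c \<in> carrier (Sec B x)"
  using \<beta>_alg by (auto simp: alg_maps_iff ring_hom_def)

lemma Res_J_zero:
  assumes "f \<in> Ar T"
  shows "Res J f \<zero>\<^bsub>Sec J (tgt T f)\<^esub> = \<zero>\<^bsub>Sec J (src T f)\<^esub>"
proof -
  interpret S: module "Sec B (src T f)" "Sec J (src T f)"
    using module_J category assms by (simp add: category_simps)
  interpret R: module "Sec B (tgt T f)" "Sec J (tgt T f)"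
    using module_J category assms by (simp add: category_simps)
  show ?thesis
    using Res_J_add[OF assms, of "\<zero>\<^bsub>Sec J (tgt T f)\<^esub>" "\<zero>\<^bsub>Sec J (tgt T f)\<^esub>"] Res_J_closed[OF assms]
    by (metis R.M.l_zero R.M.zero_closed S.M.add.l_cancel_one)
qed

lemma Res_J_minus:
  assumes "f \<in> Ar T" "j \<in> carrier (Sec J (tgt T f))"
  shows "Res J f (\<ominus>\<^bsub>Sec J (tgt T f)\<^esub> j) = \<ominus>\<^bsub>Sec J (src T f)\<^esub> Res J f j"
proof -
  interpret S: module "Sec B (src T f)" "Sec J (src T f)"
    using module_J category assms by (simp add: category_simps)
  interpret R: module "Sec B (tgt T f)" "Sec J (tgt T f)"
    using module_J category assms by (simp add: category_simps)
  have "Res J f (\<ominus>\<^bsub>Sec J (tgt T f)\<^esub> j) \<oplus>\<^bsub>Sec J (src T f)\<^esub> Res J f j = \<zero>\<^bsub>Sec J (src T f)\<^esub>"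
    using Res_J_add[OF assms(1), of "\<ominus>\<^bsub>Sec J (tgt T f)\<^esub> j" j] assms Res_J_zero R.M.l_neg by simp
  thus ?thesis
    using S.M.minus_equality Res_J_closed assms by simp
qed

lemma derivationD:
  assumes "D \<in> derivations T A C \<beta> J" "x \<in> Ob T"
  shows "c \<in> carrier (Sec C x) \<Longrightarrow> D x c \<in> carrier (Sec J x)"
    and "c \<in> carrier (Sec C x) \<Longrightarrow> c' \<in> carrier (Sec C x) \<Longrightarrow>
      D x (c \<oplus>\<^bsub>Sec C x\<^esub> c') = D x c \<oplus>\<^bsub>Sec J x\<^esub> D x c'"
    and "c \<in> carrier (Sec C x) \<Longrightarrow> c' \<in> carrier (Sec C x) \<Longrightarrow>
      D x (c \<otimes>\<^bsub>Sec C x\<^esub> c') = \<beta> x c \<odot>\<^bsub>Sec J x\<^esub> D x c' \<oplus>\<^bsub>Sec J x\<^esub> \<beta> x c' \<odot>\<^bsub>Sec J x\<^esub> D x c"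
    and "a \<in> carrier (Sec A x) \<Longrightarrow> c \<in> carrier (Sec C x) \<Longrightarrow>
      D x (Str C x a \<otimes>\<^bsub>Sec C x\<^esub> c) = \<beta> x (Str C x a) \<odot>\<^bsub>Sec J x\<^esub> D x c"
  using assms maps_closed[of D T C J x c] by (auto simp: derivations_def)

lemma derivation_natural:
  assumes "D \<in> derivations T A C \<beta> J" "f \<in> Ar T" "c \<in> carrier (Sec C (tgt T f))"
  shows "D (src T f) (Res C f c) = Res J f (D (tgt T f) c)"
  using maps_natural[of D T C J f c] assms by (auto simp: derivations_def)

lemma derivation_eqI:
  assumes "D \<in> derivations T A C \<beta> J" "D' \<in> derivations T A C \<beta> J"
    and "\<And>x c. x \<in> Ob T \<Longrightarrow> c \<in> carrier (Sec C x) \<Longrightarrow> D x c = D' x c"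
  shows "D = D'"
  using assms maps_eqI[of D T C J D' J] by (auto simp: derivations_def)

lemma derivation_lamI:
  assumes closed: "\<And>x c. x \<in> Ob T \<Longrightarrow> c \<in> carrier (Sec C x) \<Longrightarrow> D x c \<in> carrier (Sec J x)"
    and natural: "\<And>f c. f \<in> Ar T \<Longrightarrow> c \<in> carrier (Sec C (tgt T f)) \<Longrightarrow>
      D (src T f) (Res C f c) = Res J f (D (tgt T f) c)"
    and add: "\<And>x c c'. x \<in> Ob T \<Longrightarrow> c \<in> carrier (Sec C x) \<Longrightarrow> c' \<in> carrier (Sec C x) \<Longrightarrow>
      D x (c \<oplus>\<^bsub>Sec C x\<^esub> c') = D x c \<oplus>\<^bsub>Sec J x\<^esub> D x c'"
    and mult: "\<And>x c c'. x \<in> Ob T \<Longrightarrow> c \<in> carrier (Sec C x) \<Longrightarrow> c' \<in> carrier (Sec C x) \<Longrightarrow>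
      D x (c \<otimes>\<^bsub>Sec C x\<^esub> c') = \<beta> x c \<odot>\<^bsub>Sec J x\<^esub> D x c' \<oplus>\<^bsub>Sec J x\<^esub> \<beta> x c' \<odot>\<^bsub>Sec J x\<^esub> D x c"
    and linear: "\<And>x a c. x \<in> Ob T \<Longrightarrow> a \<in> carrier (Sec A x) \<Longrightarrow> c \<in> carrier (Sec C x) \<Longrightarrow>
      D x (Str C x a \<otimes>\<^bsub>Sec C x\<^esub> c) = \<beta> x (Str C x a) \<odot>\<^bsub>Sec J x\<^esub> D x c"
  shows "(\<lambda>x\<in>Ob T. \<lambda>c\<in>carrier (Sec C x). D x c) \<in> derivations T A C \<beta> J"
proof -
  have "(\<lambda>x\<in>Ob T. \<lambda>c\<in>carrier (Sec C x). D x c) \<in> maps T C J"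
    using category closed natural Res_C_closed by (intro maps_lamI) auto
  moreover have "c \<oplus>\<^bsub>Sec C x\<^esub> c' \<in> carrier (Sec C x)" "c \<otimes>\<^bsub>Sec C x\<^esub> c' \<in> carrier (Sec C x)"
    if "x \<in> Ob T" "c \<in> carrier (Sec C x)" "c' \<in> carrier (Sec C x)" for x c c'
    using cring.cring_simprules(1,5)[OF cring_C] that by auto
  ultimately show ?thesis
    using add mult linear Str_C by (simp add: derivations_def)
qed

lemma comm_group_der_group: "comm_group (der_group T A C \<beta> J)"
proof (rule comm_groupI)
  have C_closed: "c \<oplus>\<^bsub>Sec C x\<^esub> c' \<in> carrier (Sec C x)" "c \<otimes>\<^bsub>Sec C x\<^esub> c' \<in> carrier (Sec C x)"
    if "x \<in> Ob T" "c \<in> carrier (Sec C x)" "c' \<in> carrier (Sec C x)" for x c c'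
    using cring.cring_simprules(1,5)[OF cring_C] that by auto
  let ?G = "der_group T A C \<beta> J"
  have mult_closed: "D \<otimes>\<^bsub>?G\<^esub> D' \<in> derivations T A C \<beta> J"
    if D: "D \<in> derivations T A C \<beta> J" and D': "D' \<in> derivations T A C \<beta> J" for D D'
    unfolding der_group_def monoid.simps
  proof (rule derivation_lamI)
    fix x assume x: "x \<in> Ob T"
    interpret module "Sec B x" "Sec J x" by (rule module_J[OF x])
    note Dx = derivationD[OF D x] derivationD[OF D' x] \<beta>_closed[OF x] Str_C[OF x] C_closed[OF x]
    show "D x c \<oplus>\<^bsub>Sec J x\<^esub> D' x c \<in> carrier (Sec J x)" if "c \<in> carrier (Sec C x)" for c
      using that Dx by simp
    fix c c' assume c: "c \<in> carrier (Sec C x)" "c' \<in> carrier (Sec C x)"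
    show "D x (c \<oplus>\<^bsub>Sec C x\<^esub> c') \<oplus>\<^bsub>Sec J x\<^esub> D' x (c \<oplus>\<^bsub>Sec C x\<^esub> c') =
        D x c \<oplus>\<^bsub>Sec J x\<^esub> D' x c \<oplus>\<^bsub>Sec J x\<^esub> (D x c' \<oplus>\<^bsub>Sec J x\<^esub> D' x c')"
      using c Dx by (simp add: M.a_ac)
    show "D x (c \<otimes>\<^bsub>Sec C x\<^esub> c') \<oplus>\<^bsub>Sec J x\<^esub> D' x (c \<otimes>\<^bsub>Sec C x\<^esub> c') =
        \<beta> x c \<odot>\<^bsub>Sec J x\<^esub> (D x c' \<oplus>\<^bsub>Sec J x\<^esub> D' x c') \<oplus>\<^bsub>Sec J x\<^esub>
        \<beta> x c' \<odot>\<^bsub>Sec J x\<^esub> (D x c \<oplus>\<^bsub>Sec J x\<^esub> D' x c)"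
      using c Dx by (simp add: M.a_ac smult_r_distr)
  next
    fix x a c assume x: "x \<in> Ob T" and ac: "a \<in> carrier (Sec A x)" "c \<in> carrier (Sec C x)"
    interpret module "Sec B x" "Sec J x" by (rule module_J[OF x])
    show "D x (Str C x a \<otimes>\<^bsub>Sec C x\<^esub> c) \<oplus>\<^bsub>Sec J x\<^esub> D' x (Str C x a \<otimes>\<^bsub>Sec C x\<^esub> c) =
        \<beta> x (Str C x a) \<odot>\<^bsub>Sec J x\<^esub> (D x c \<oplus>\<^bsub>Sec J x\<^esub> D' x c)"
      using ac derivationD[OF D x] derivationD[OF D' x] \<beta>_closed[OF x] Str_C[OF x]
      by (simp add: smult_r_distr)
  next
    fix f c assume fc: "f \<in> Ar T" "c \<in> carrier (Sec C (tgt T f))"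
    show "D (src T f) (Res C f c) \<oplus>\<^bsub>Sec J (src T f)\<^esub> D' (src T f) (Res C f c) =
        Res J f (D (tgt T f) c \<oplus>\<^bsub>Sec J (tgt T f)\<^esub> D' (tgt T f) c)"
      using fc category derivation_natural[OF D] derivation_natural[OF D'] derivationD(1)[OF D]
        derivationD(1)[OF D'] by (simp add: Res_J_add category_simps)
  qed
  thus "\<And>D D'. D \<in> carrier ?G \<Longrightarrow> D' \<in> carrier ?G \<Longrightarrow> D \<otimes>\<^bsub>?G\<^esub> D' \<in> carrier ?G"
    by (simp add: der_group_def)
  show one: "\<one>\<^bsub>?G\<^esub> \<in> carrier ?G"
    unfolding der_group_def monoid.simps partial_object.simps
  proof (rule derivation_lamI)
    fix x assume x: "x \<in> Ob T"
    interpret module "Sec B x" "Sec J x" by (rule module_J[OF x])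
    fix c c' assume c: "c \<in> carrier (Sec C x)" "c' \<in> carrier (Sec C x)"
    show "\<zero>\<^bsub>Sec J x\<^esub> = \<beta> x c \<odot>\<^bsub>Sec J x\<^esub> \<zero>\<^bsub>Sec J x\<^esub> \<oplus>\<^bsub>Sec J x\<^esub> \<beta> x c' \<odot>\<^bsub>Sec J x\<^esub> \<zero>\<^bsub>Sec J x\<^esub>"
      using c \<beta>_closed[OF x] by simp
  next
    fix x a assume x: "x \<in> Ob T" and a: "a \<in> carrier (Sec A x)"
    interpret module "Sec B x" "Sec J x" by (rule module_J[OF x])
    show "\<zero>\<^bsub>Sec J x\<^esub> = \<beta> x (Str C x a) \<odot>\<^bsub>Sec J x\<^esub> \<zero>\<^bsub>Sec J x\<^esub>"
      using a \<beta>_closed[OF x] Str_C[OF x] by simp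
  qed (use module_J in \<open>auto simp: Res_J_zero module_def abelian_group_def abelian_monoid.zero_closed
        abelian_monoid.l_zero\<close>)
  have eqI: "D = D'" if "D \<in> carrier ?G" "D' \<in> carrier ?G"
    "\<And>x c. x \<in> Ob T \<Longrightarrow> c \<in> carrier (Sec C x) \<Longrightarrow> D x c = D' x c" for D D'
    using derivation_eqI that by (simp add: der_group_def)
  have J: "abelian_group (Sec J x)" if "x \<in> Ob T" for x
    using module_J[OF that] by (simp add: module_def)
  have closed: "D x c \<in> carrier (Sec J x)" if "D \<in> carrier ?G" "x \<in> Ob T" "c \<in> carrier (Sec C x)" for D x c
    using that derivationD(1) by (simp add: der_group_def)
  have mult: "(D \<otimes>\<^bsub>?G\<^esub> D') x c = D x c \<oplus>\<^bsub>Sec J x\<^esub> D' x c"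
    "\<one>\<^bsub>?G\<^esub> x c = \<zero>\<^bsub>Sec J x\<^esub>" if "x \<in> Ob T" "c \<in> carrier (Sec C x)" for D D' x c
    using that by (simp_all add: der_group_def)
  have Gc: "D \<otimes>\<^bsub>?G\<^esub> D' \<in> carrier ?G" if "D \<in> carrier ?G" "D' \<in> carrier ?G" for D D'
    using that mult_closed by (simp add: der_group_def)
  note abelian = abelian_group.axioms(1) abelian_monoid.a_assoc abelian_monoid.a_comm
    abelian_monoid.a_lcomm abelian_monoid.l_zero abelian_monoid.a_closed
  fix D assume D: "D \<in> carrier ?G"
  show "\<one>\<^bsub>?G\<^esub> \<otimes>\<^bsub>?G\<^esub> D = D"
    using D one J closed by (intro eqI Gc) (simp_all add: mult abelian)
  show "D \<otimes>\<^bsub>?G\<^esub> D' = D' \<otimes>\<^bsub>?G\<^esub> D" if D': "D' \<in> carrier ?G" for D'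
    using D D' J closed by (intro eqI Gc) (simp_all add: mult abelian)
  show "D \<otimes>\<^bsub>?G\<^esub> D' \<otimes>\<^bsub>?G\<^esub> D'' = D \<otimes>\<^bsub>?G\<^esub> (D' \<otimes>\<^bsub>?G\<^esub> D'')"
    if D': "D' \<in> carrier ?G" "D'' \<in> carrier ?G" for D' D''
    using D D' J closed by (intro eqI Gc) (simp_all add: mult abelian)
  let ?D' = "\<lambda>x\<in>Ob T. \<lambda>c\<in>carrier (Sec C x). \<ominus>\<^bsub>Sec J x\<^esub> D x c"
  have D_der: "D \<in> derivations T A C \<beta> J"
    using D by (simp add: der_group_def)
  have "?D' \<in> carrier ?G"
    unfolding der_group_def partial_object.simps
  proof (rule derivation_lamI)
    fix x assume x: "x \<in> Ob T"
    interpret module "Sec B x" "Sec J x" by (rule module_J[OF x])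
    note Dx = derivationD[OF D_der x] \<beta>_closed[OF x]
    show "\<ominus>\<^bsub>Sec J x\<^esub> D x c \<in> carrier (Sec J x)" if "c \<in> carrier (Sec C x)" for c
      using that Dx by simp
    fix c c' assume c: "c \<in> carrier (Sec C x)" "c' \<in> carrier (Sec C x)"
    show "\<ominus>\<^bsub>Sec J x\<^esub> D x (c \<oplus>\<^bsub>Sec C x\<^esub> c') = \<ominus>\<^bsub>Sec J x\<^esub> D x c \<oplus>\<^bsub>Sec J x\<^esub> \<ominus>\<^bsub>Sec J x\<^esub> D x c'"
      using c Dx by (simp add: M.minus_add)
    show "\<ominus>\<^bsub>Sec J x\<^esub> D x (c \<otimes>\<^bsub>Sec C x\<^esub> c') =
        \<beta> x c \<odot>\<^bsub>Sec J x\<^esub> (\<ominus>\<^bsub>Sec J x\<^esub> D x c') \<oplus>\<^bsub>Sec J x\<^esub> \<beta> x c' \<odot>\<^bsub>Sec J x\<^esub> (\<ominus>\<^bsub>Sec J x\<^esub> D x c)"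
      using c Dx by (simp add: M.minus_add smult_r_minus)
  next
    fix x a c assume x: "x \<in> Ob T" and ac: "a \<in> carrier (Sec A x)" "c \<in> carrier (Sec C x)"
    interpret module "Sec B x" "Sec J x" by (rule module_J[OF x])
    show "\<ominus>\<^bsub>Sec J x\<^esub> D x (Str C x a \<otimes>\<^bsub>Sec C x\<^esub> c) =
        \<beta> x (Str C x a) \<odot>\<^bsub>Sec J x\<^esub> (\<ominus>\<^bsub>Sec J x\<^esub> D x c)"
      using ac derivationD[OF D_der x] \<beta>_closed[OF x] Str_C[OF x] by (simp add: smult_r_minus)
  next
    fix f c assume fc: "f \<in> Ar T" "c \<in> carrier (Sec C (tgt T f))"
    show "\<ominus>\<^bsub>Sec J (src T f)\<^esub> D (src T f) (Res C f c) = Res J f (\<ominus>\<^bsub>Sec J (tgt T f)\<^esub> D (tgt T f) c)"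
      using fc category derivation_natural[OF D_der] derivationD(1)[OF D_der]
      by (simp add: Res_J_minus category_simps)
  qed
  moreover from this have "?D' \<otimes>\<^bsub>?G\<^esub> D = \<one>\<^bsub>?G\<^esub>"
    using D one J closed by (intro eqI Gc) (simp_all add: mult abelian_group.l_neg)
  ultimately show "\<exists>D'\<in>carrier ?G. D' \<otimes>\<^bsub>?G\<^esub> D = \<one>\<^bsub>?G\<^esub>"
    by blast
qed

text \<open>The Leibniz rule for \<open>1 = 1 * 1\<close> gives \<open>D 1 = D 1 + D 1\<close>, and linearity over \<open>A\<close> extends the vanishing
  to the image of \<open>A\<close>.\<close>

lemma derivation_zero:
  assumes D: "D \<in> derivations T A C \<beta> J" and x: "x \<in> Ob T"
  shows "D x \<one>\<^bsub>Sec C x\<^esub> = \<zero>\<^bsub>Sec J x\<^esub>"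
    and "a \<in> carrier (Sec A x) \<Longrightarrow> D x (Str C x a) = \<zero>\<^bsub>Sec J x\<^esub>"
proof -
  interpret module "Sec B x" "Sec J x" by (rule module_J[OF x])
  interpret C: cring "Sec C x" by (rule cring_C[OF x])
  have "\<beta> x \<one>\<^bsub>Sec C x\<^esub> = \<one>\<^bsub>Sec B x\<^esub>"
    using \<beta>_alg x by (auto simp: alg_maps_iff ring_hom_def)
  hence "D x \<one>\<^bsub>Sec C x\<^esub> = D x \<one>\<^bsub>Sec C x\<^esub> \<oplus>\<^bsub>Sec J x\<^esub> D x \<one>\<^bsub>Sec C x\<^esub>"
    using derivationD(3)[OF D x C.one_closed C.one_closed] derivationD(1)[OF D x C.one_closed]
    by simp
  thus one: "D x \<one>\<^bsub>Sec C x\<^esub> = \<zero>\<^bsub>Sec J x\<^esub>"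
    using derivationD(1)[OF D x C.one_closed] by (metis M.add.l_cancel_one)
  show "D x (Str C x a) = \<zero>\<^bsub>Sec J x\<^esub>" if a: "a \<in> carrier (Sec A x)"
    using derivationD(4)[OF D x a C.one_closed] Str_C[OF x a] \<beta>_closed[OF x] one
    by simp
qed

end


text \<open>A square-zero extension \<open>p : B' \<rightarrow> B\<close> with ideal \<open>\<iota> : J \<rightarrow> B'\<close>, again described on sections, together with a
  map \<open>\<beta> : C \<rightarrow> B\<close> that is to be lifted to \<open>B'\<close>.  For \<open>\<beta> = id\<close> the lifts are the algebra sections of \<open>p\<close>;
  on a slice, with \<open>\<beta>\<close> the augmentation, they are the sections of the sheaf represented by \<open>B'\<close>.\<close>

locale square_zero_lifting = derivation_presheaves T A B J C \<beta>
  for T :: "('x, 'y) cat" and A :: "('x, 'y, 'u) ring_presheaf"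
    and B :: "('x, 'y, 'u) alg" and J :: "('x, 'y, 'u) module_presheaf"
    and C :: "('x, 'y, 'u) alg" and \<beta> :: "'x \<Rightarrow> 'u \<Rightarrow> 'u" +
  fixes B' :: "('x, 'y, 'u) alg" and p \<iota> :: "'x \<Rightarrow> 'u \<Rightarrow> 'u"
  assumes cring_B': "x \<in> Ob T \<Longrightarrow> cring (Sec B' x)"
    and Res_B': "f \<in> Ar T \<Longrightarrow> Res B' f \<in> ring_hom (Sec B' (tgt T f)) (Sec B' (src T f))"
    and p_alg: "p \<in> alg_maps T A B' B"
    and kernel_square_zero: "x \<in> Ob T \<Longrightarrow> k \<in> a_kernel (Sec B' x) (Sec B x) (p x) \<Longrightarrow>
          l \<in> a_kernel (Sec B' x) (Sec B x) (p x) \<Longrightarrow> k \<otimes>\<^bsub>Sec B' x\<^esub> l = \<zero>\<^bsub>Sec B' x\<^esub>"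
    and \<iota>_maps: "\<iota> \<in> maps T J B'"
    and \<iota>_kernel: "x \<in> Ob T \<Longrightarrow>
          bij_betw (\<iota> x) (carrier (Sec J x)) (a_kernel (Sec B' x) (Sec B x) (p x))"
    and \<iota>_add: "x \<in> Ob T \<Longrightarrow> j \<in> carrier (Sec J x) \<Longrightarrow> k \<in> carrier (Sec J x) \<Longrightarrow>
          \<iota> x (j \<oplus>\<^bsub>Sec J x\<^esub> k) = \<iota> x j \<oplus>\<^bsub>Sec B' x\<^esub> \<iota> x k"
    and \<iota>_smult: "x \<in> Ob T \<Longrightarrow> b \<in> carrier (Sec B' x) \<Longrightarrow> j \<in> carrier (Sec J x) \<Longrightarrow>
          \<iota> x (p x b \<odot>\<^bsub>Sec J x\<^esub> j) = b \<otimes>\<^bsub>Sec B' x\<^esub> \<iota> x j"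
begin

definition lifts :: "('x \<Rightarrow> 'u \<Rightarrow> 'u) set" where
  "lifts = {\<eta> \<in> alg_maps T A C B'. \<forall>x\<in>Ob T. \<forall>c\<in>carrier (Sec C x). p x (\<eta> x c) = \<beta> x c}"

abbreviation add :: "('x \<Rightarrow> 'u \<Rightarrow> 'u) \<Rightarrow> ('x \<Rightarrow> 'u \<Rightarrow> 'u) \<Rightarrow> 'x \<Rightarrow> 'u \<Rightarrow> 'u" where
  "add \<equiv> add_der T C B' \<iota>"

lemma ring_p:
  assumes "x \<in> Ob T"
  shows "p x \<in> ring_hom (Sec B' x) (Sec B x)" "ring_hom_ring (Sec B' x) (Sec B x) (p x)"
proof -
  show "p x \<in> ring_hom (Sec B' x) (Sec B x)"
    using p_alg assms by (simp add: alg_maps_iff)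
  thus "ring_hom_ring (Sec B' x) (Sec B x) (p x)"
    using cring_B'[OF assms] module_J[OF assms]
    by (intro ring_hom_ringI2) (auto simp: cring_def module_def)
qed

lemma \<iota>_in_kernel:
  assumes "x \<in> Ob T" "j \<in> carrier (Sec J x)"
  shows "\<iota> x j \<in> a_kernel (Sec B' x) (Sec B x) (p x)"
    and "\<iota> x j \<in> carrier (Sec B' x)" "p x (\<iota> x j) = \<zero>\<^bsub>Sec B x\<^esub>"
  using \<iota>_kernel[OF assms(1)] assms(2) by (auto simp: bij_betw_def a_kernel_def')

lemma \<iota>_inj:
  "x \<in> Ob T \<Longrightarrow> j \<in> carrier (Sec J x) \<Longrightarrow> k \<in> carrier (Sec J x) \<Longrightarrow> \<iota> x j = \<iota> x k \<Longrightarrow> j = k"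
  using bij_betw_imp_inj_on[OF \<iota>_kernel] by (auto dest: inj_onD)

lemma \<iota>_cancel:
  assumes "x \<in> Ob T" "b \<in> carrier (Sec B' x)" "j \<in> carrier (Sec J x)" "k \<in> carrier (Sec J x)"
    and eq: "b \<oplus>\<^bsub>Sec B' x\<^esub> \<iota> x j = b \<oplus>\<^bsub>Sec B' x\<^esub> \<iota> x k"
  shows "j = k"
proof (rule \<iota>_inj)
  interpret B': cring "Sec B' x" by (rule cring_B'[OF assms(1)])
  show "\<iota> x j = \<iota> x k"
    using arg_cong[OF eq, of "\<lambda>c. \<ominus>\<^bsub>Sec B' x\<^esub> b \<oplus>\<^bsub>Sec B' x\<^esub> c"] assms(1-4) \<iota>_in_kernel(2)
    by (simp add: B'.r_neg1)
qed fact+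

lemma \<iota>_zero: "x \<in> Ob T \<Longrightarrow> \<iota> x \<zero>\<^bsub>Sec J x\<^esub> = \<zero>\<^bsub>Sec B' x\<^esub>"
proof -
  assume x: "x \<in> Ob T"
  interpret module "Sec B x" "Sec J x" by (rule module_J[OF x])
  interpret B': cring "Sec B' x" by (rule cring_B'[OF x])
  show ?thesis
    using \<iota>_add[OF x, of "\<zero>\<^bsub>Sec J x\<^esub>" "\<zero>\<^bsub>Sec J x\<^esub>"] \<iota>_in_kernel(2)[OF x, of "\<zero>\<^bsub>Sec J x\<^esub>"]
    by (metis B'.add.l_cancel_one M.l_zero M.zero_closed)
qed

lemma liftD:
  assumes "\<eta> \<in> lifts" "x \<in> Ob T"
  shows "c \<in> carrier (Sec C x) \<Longrightarrow> \<eta> x c \<in> carrier (Sec B' x)"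
    and "c \<in> carrier (Sec C x) \<Longrightarrow> c' \<in> carrier (Sec C x) \<Longrightarrow>
      \<eta> x (c \<oplus>\<^bsub>Sec C x\<^esub> c') = \<eta> x c \<oplus>\<^bsub>Sec B' x\<^esub> \<eta> x c'"
    and "c \<in> carrier (Sec C x) \<Longrightarrow> c' \<in> carrier (Sec C x) \<Longrightarrow>
      \<eta> x (c \<otimes>\<^bsub>Sec C x\<^esub> c') = \<eta> x c \<otimes>\<^bsub>Sec B' x\<^esub> \<eta> x c'"
    and "\<eta> x \<one>\<^bsub>Sec C x\<^esub> = \<one>\<^bsub>Sec B' x\<^esub>"
    and "a \<in> carrier (Sec A x) \<Longrightarrow> \<eta> x (Str C x a) = Str B' x a"
    and "c \<in> carrier (Sec C x) \<Longrightarrow> p x (\<eta> x c) = \<beta> x c"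
  using assms by (auto simp: lifts_def alg_maps_iff ring_hom_def)

lemma lift_maps: "\<eta> \<in> lifts \<Longrightarrow> \<eta> \<in> maps T C B'"
  by (simp add: lifts_def alg_maps_iff)

lemma add_apply:
  "x \<in> Ob T \<Longrightarrow> c \<in> carrier (Sec C x) \<Longrightarrow> add D \<eta> x c = \<eta> x c \<oplus>\<^bsub>Sec B' x\<^esub> \<iota> x (D x c)"
  by (simp add: add_der_def)

text \<open>The source of the Leibniz rule: in the product of \<open>b + \<iota> j\<close> and \<open>b' + \<iota> j'\<close> the term \<open>\<iota> j * \<iota> j'\<close> vanishes, and the
  cross terms are the action of \<open>p b\<close> and \<open>p b'\<close> on \<open>J\<close>.\<close>

lemma square_zero_mult:
  assumes "x \<in> Ob T" "b \<in> carrier (Sec B' x)" "b' \<in> carrier (Sec B' x)"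
    "j \<in> carrier (Sec J x)" "j' \<in> carrier (Sec J x)"
  shows "(b \<oplus>\<^bsub>Sec B' x\<^esub> \<iota> x j) \<otimes>\<^bsub>Sec B' x\<^esub> (b' \<oplus>\<^bsub>Sec B' x\<^esub> \<iota> x j') =
    b \<otimes>\<^bsub>Sec B' x\<^esub> b' \<oplus>\<^bsub>Sec B' x\<^esub> \<iota> x (p x b \<odot>\<^bsub>Sec J x\<^esub> j' \<oplus>\<^bsub>Sec J x\<^esub> p x b' \<odot>\<^bsub>Sec J x\<^esub> j)"
proof -
  interpret module "Sec B x" "Sec J x" by (rule module_J[OF assms(1)])
  interpret B': cring "Sec B' x" by (rule cring_B'[OF assms(1)])
  note i = \<iota>_in_kernel(2)[OF assms(1)] and k = \<iota>_in_kernel(1)[OF assms(1)]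
  have "p x b \<in> carrier (Sec B x)" "p x b' \<in> carrier (Sec B x)"
    using ring_p(1)[OF assms(1)] assms(2,3) by (auto simp: ring_hom_def)
  hence "\<iota> x (p x b \<odot>\<^bsub>Sec J x\<^esub> j' \<oplus>\<^bsub>Sec J x\<^esub> p x b' \<odot>\<^bsub>Sec J x\<^esub> j) =
      b \<otimes>\<^bsub>Sec B' x\<^esub> \<iota> x j' \<oplus>\<^bsub>Sec B' x\<^esub> b' \<otimes>\<^bsub>Sec B' x\<^esub> \<iota> x j"
    using assms by (simp add: \<iota>_add \<iota>_smult)
  moreover have "\<iota> x j \<otimes>\<^bsub>Sec B' x\<^esub> \<iota> x j' = \<zero>\<^bsub>Sec B' x\<^esub>"
    using kernel_square_zero[OF assms(1) k k] assms by simp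
  ultimately show ?thesis
    using assms i by (simp add: B'.l_distr B'.r_distr B'.a_ac B'.m_ac)
qed

lemma add_lift:
  assumes D: "D \<in> derivations T A C \<beta> J" and \<eta>: "\<eta> \<in> lifts"
  shows "add D \<eta> \<in> lifts"
proof -
  have "add D \<eta> \<in> maps T C B'"
    unfolding add_der_def
  proof (rule maps_lamI[OF category])
    show "\<eta> x c \<oplus>\<^bsub>Sec B' x\<^esub> \<iota> x (D x c) \<in> carrier (Sec B' x)"
      if "x \<in> Ob T" "c \<in> carrier (Sec C x)" for x c
      using that \<iota>_in_kernel(2) liftD(1)[OF \<eta>] derivationD(1)[OF D] cring.cring_simprules(1)[OF cring_B']
      by simp
    fix f c assume fc: "f \<in> Ar T" "c \<in> carrier (Sec C (tgt T f))"
    have x: "tgt T f \<in> Ob T"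
      using category fc by (simp add: category_simps)
    have "Res B' f (\<eta> (tgt T f) c \<oplus>\<^bsub>Sec B' (tgt T f)\<^esub> \<iota> (tgt T f) (D (tgt T f) c)) =
        Res B' f (\<eta> (tgt T f) c) \<oplus>\<^bsub>Sec B' (src T f)\<^esub> Res B' f (\<iota> (tgt T f) (D (tgt T f) c))"
      using ring_hom_add[OF Res_B'[OF fc(1)] liftD(1)[OF \<eta> x fc(2)]
        \<iota>_in_kernel(2)[OF x derivationD(1)[OF D x fc(2)]]] .
    thus "Res C f c \<in> carrier (Sec C (src T f)) \<and>
        \<eta> (src T f) (Res C f c) \<oplus>\<^bsub>Sec B' (src T f)\<^esub> \<iota> (src T f) (D (src T f) (Res C f c)) =
        Res B' f (\<eta> (tgt T f) c \<oplus>\<^bsub>Sec B' (tgt T f)\<^esub> \<iota> (tgt T f) (D (tgt T f) c))"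
      using Res_C_closed[OF fc] maps_natural[OF lift_maps[OF \<eta>] fc] derivation_natural[OF D fc]
        maps_natural[OF \<iota>_maps fc(1) derivationD(1)[OF D x fc(2)]]
      by simp
  qed
  moreover have "add D \<eta> x \<in> ring_hom (Sec C x) (Sec B' x) \<and>
      (\<forall>a\<in>carrier (Sec A x). add D \<eta> x (Str C x a) = Str B' x a) \<and>
      (\<forall>c\<in>carrier (Sec C x). p x (add D \<eta> x c) = \<beta> x c)"
    if x: "x \<in> Ob T" for x
  proof (intro conjI ballI ring_hom_memI)
    interpret module "Sec B x" "Sec J x" by (rule module_J[OF x])
    interpret B': cring "Sec B' x" by (rule cring_B'[OF x])
    interpret C: cring "Sec C x" by (rule cring_C[OF x])
    interpret p: ring_hom_ring "Sec B' x" "Sec B x" "p x" by (rule ring_p(2)[OF x])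
    note Dx = derivationD[OF D x] and \<eta>x = liftD[OF \<eta> x] and ix = \<iota>_in_kernel(2,3)[OF x]
    fix c assume c: "c \<in> carrier (Sec C x)"
    show "add D \<eta> x c \<in> carrier (Sec B' x)"
      using c Dx \<eta>x ix x by (simp add: add_apply)
    show "p x (add D \<eta> x c) = \<beta> x c"
      using c Dx(1) \<eta>x(1,6) ix x \<beta>_closed[OF x c] by (simp add: add_apply)
    fix c' assume c': "c' \<in> carrier (Sec C x)"
    show "add D \<eta> x (c \<oplus>\<^bsub>Sec C x\<^esub> c') = add D \<eta> x c \<oplus>\<^bsub>Sec B' x\<^esub> add D \<eta> x c'"
      using c c' Dx(1,2) \<eta>x(1,2) ix x by (simp add: add_apply \<iota>_add B'.a_ac)
    show "add D \<eta> x (c \<otimes>\<^bsub>Sec C x\<^esub> c') = add D \<eta> x c \<otimes>\<^bsub>Sec B' x\<^esub> add D \<eta> x c'"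
      using c c' Dx(1,3) \<eta>x(1,3,6) x by (simp add: add_apply square_zero_mult)
  next
    interpret B': cring "Sec B' x" by (rule cring_B'[OF x])
    interpret C: cring "Sec C x" by (rule cring_C[OF x])
    show "add D \<eta> x \<one>\<^bsub>Sec C x\<^esub> = \<one>\<^bsub>Sec B' x\<^esub>"
      using derivation_zero(1)[OF D x] liftD(4)[OF \<eta> x] x by (simp add: add_apply \<iota>_zero)
    fix a assume a: "a \<in> carrier (Sec A x)"
    show "add D \<eta> x (Str C x a) = Str B' x a"
      using derivation_zero(2)[OF D x a] liftD(5)[OF \<eta> x a] liftD(1)[OF \<eta> x Str_C[OF x a]] x Str_C[OF x a]
      by (simp add: add_apply \<iota>_zero)
  qed
  ultimately show ?thesis
    by (simp add: lifts_def alg_maps_iff)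
qed

text \<open>Two lifts have the same image under \<open>p\<close>, so their difference lies in the kernel of \<open>p\<close>, that is, in the
  image of \<open>\<iota>\<close>.  The rules for the difference \<open>D\<close> follow from those for the lifts, because \<open>\<eta> + \<iota> j\<close>
  determines \<open>j\<close>.\<close>

lemma difference_derivation:
  assumes \<eta>: "\<eta> \<in> lifts" and \<eta>': "\<eta>' \<in> lifts"
  shows "\<exists>D\<in>derivations T A C \<beta> J. add D \<eta> = \<eta>'"
proof -
  define D where "D x c = inv_into (carrier (Sec J x)) (\<iota> x) (\<eta>' x c \<ominus>\<^bsub>Sec B' x\<^esub> \<eta> x c)" for x c
  have D: "D x c \<in> carrier (Sec J x)" "\<eta>' x c = \<eta> x c \<oplus>\<^bsub>Sec B' x\<^esub> \<iota> x (D x c)"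
    if x: "x \<in> Ob T" and c: "c \<in> carrier (Sec C x)" for x c
  proof -
    interpret module "Sec B x" "Sec J x" by (rule module_J[OF x])
    interpret B': cring "Sec B' x" by (rule cring_B'[OF x])
    interpret p: ring_hom_ring "Sec B' x" "Sec B x" "p x" by (rule ring_p(2)[OF x])
    note \<eta>x = liftD(1,6)[OF \<eta> x c] liftD(1,6)[OF \<eta>' x c]
    have "\<eta>' x c \<ominus>\<^bsub>Sec B' x\<^esub> \<eta> x c \<in> a_kernel (Sec B' x) (Sec B x) (p x)"
      unfolding a_kernel_def' a_minus_def using \<eta>x \<beta>_closed[OF x c] by (simp add: R.r_neg)
    hence "D x c \<in> carrier (Sec J x) \<and> \<iota> x (D x c) = \<eta>' x c \<ominus>\<^bsub>Sec B' x\<^esub> \<eta> x c"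
      using \<iota>_kernel[OF x] unfolding D_def
      by (auto simp: bij_betw_def f_inv_into_f inv_into_into)
    moreover have "\<eta> x c \<oplus>\<^bsub>Sec B' x\<^esub> (\<eta>' x c \<ominus>\<^bsub>Sec B' x\<^esub> \<eta> x c) = \<eta>' x c"
      unfolding a_minus_def using \<eta>x(1,3) by (subst B'.a_lcomm) (simp_all add: B'.r_neg)
    ultimately show "D x c \<in> carrier (Sec J x)" "\<eta>' x c = \<eta> x c \<oplus>\<^bsub>Sec B' x\<^esub> \<iota> x (D x c)"
      by auto
  qed
  \<comment> \<open>the values of \<open>D\<close> are characterised by \<open>\<eta>' = \<eta> + \<iota> D\<close>, which turns each rule for \<open>D\<close> into one for \<open>\<eta>'\<close>\<close>
  have D_eqI: "D x c = j" if "x \<in> Ob T" "c \<in> carrier (Sec C x)" "j \<in> carrier (Sec J x)"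
    "\<eta>' x c = \<eta> x c \<oplus>\<^bsub>Sec B' x\<^esub> \<iota> x j" for x c j
    using \<iota>_cancel[OF that(1) liftD(1)[OF \<eta> that(1,2)] D(1)[OF that(1,2)] that(3)]
      D(2)[OF that(1,2)] that(4) by simp
  let ?D = "\<lambda>x\<in>Ob T. \<lambda>c\<in>carrier (Sec C x). D x c"
  have "?D \<in> derivations T A C \<beta> J"
  proof (rule derivation_lamI)
    show "D x c \<in> carrier (Sec J x)" if "x \<in> Ob T" "c \<in> carrier (Sec C x)" for x c
      using D(1) that .
    fix x assume x: "x \<in> Ob T"
    interpret module "Sec B x" "Sec J x" by (rule module_J[OF x])
    interpret B': cring "Sec B' x" by (rule cring_B'[OF x])
    interpret C: cring "Sec C x" by (rule cring_C[OF x])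
    note \<eta>x = liftD[OF \<eta> x] and \<eta>'x = liftD[OF \<eta>' x]
    fix c c' assume c: "c \<in> carrier (Sec C x)" and c': "c' \<in> carrier (Sec C x)"
    have closed: "\<eta> x c \<in> carrier (Sec B' x)" "\<eta> x c' \<in> carrier (Sec B' x)"
      "\<iota> x (D x c) \<in> carrier (Sec B' x)" "\<iota> x (D x c') \<in> carrier (Sec B' x)"
      using c c' \<eta>x(1) \<iota>_in_kernel(2) D(1) x by auto
    show "D x (c \<oplus>\<^bsub>Sec C x\<^esub> c') = D x c \<oplus>\<^bsub>Sec J x\<^esub> D x c'"
    proof (rule D_eqI[OF x])
      show "\<eta>' x (c \<oplus>\<^bsub>Sec C x\<^esub> c') = \<eta> x (c \<oplus>\<^bsub>Sec C x\<^esub> c') \<oplus>\<^bsub>Sec B' x\<^esub> \<iota> x (D x c \<oplus>\<^bsub>Sec J x\<^esub> D x c')"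
        using c c' closed D(1)[OF x]
        by (simp add: \<eta>x(2) \<eta>'x(2) D(2)[OF x c] D(2)[OF x c'] \<iota>_add[OF x] B'.a_ac)
    qed (use c c' D(1)[OF x] in auto)
    show "D x (c \<otimes>\<^bsub>Sec C x\<^esub> c') =
        \<beta> x c \<odot>\<^bsub>Sec J x\<^esub> D x c' \<oplus>\<^bsub>Sec J x\<^esub> \<beta> x c' \<odot>\<^bsub>Sec J x\<^esub> D x c"
    proof (rule D_eqI[OF x])
      show "\<eta>' x (c \<otimes>\<^bsub>Sec C x\<^esub> c') = \<eta> x (c \<otimes>\<^bsub>Sec C x\<^esub> c') \<oplus>\<^bsub>Sec B' x\<^esub>
          \<iota> x (\<beta> x c \<odot>\<^bsub>Sec J x\<^esub> D x c' \<oplus>\<^bsub>Sec J x\<^esub> \<beta> x c' \<odot>\<^bsub>Sec J x\<^esub> D x c)"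
        using c c' closed D(1)[OF x]
        by (simp add: \<eta>x(3,6) \<eta>'x(3) D(2)[OF x c] D(2)[OF x c'] square_zero_mult[OF x])
    qed (use c c' D(1)[OF x] \<beta>_closed[OF x] in auto)
  next
    fix x a c assume x: "x \<in> Ob T" and a: "a \<in> carrier (Sec A x)" and c: "c \<in> carrier (Sec C x)"
    interpret module "Sec B x" "Sec J x" by (rule module_J[OF x])
    interpret B': cring "Sec B' x" by (rule cring_B'[OF x])
    interpret C: cring "Sec C x" by (rule cring_C[OF x])
    have Str: "Str B' x a \<in> carrier (Sec B' x)" "p x (Str B' x a) = \<beta> x (Str C x a)"
      using liftD(1,5,6)[OF \<eta> x] Str_C[OF x a] a by metis+
    have closed: "\<eta> x c \<in> carrier (Sec B' x)" "\<iota> x (D x c) \<in> carrier (Sec B' x)"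
      using c liftD(1)[OF \<eta> x] \<iota>_in_kernel(2) D(1) x by auto
    show "D x (Str C x a \<otimes>\<^bsub>Sec C x\<^esub> c) = \<beta> x (Str C x a) \<odot>\<^bsub>Sec J x\<^esub> D x c"
    proof (rule D_eqI[OF x])
      show "\<eta>' x (Str C x a \<otimes>\<^bsub>Sec C x\<^esub> c) = \<eta> x (Str C x a \<otimes>\<^bsub>Sec C x\<^esub> c) \<oplus>\<^bsub>Sec B' x\<^esub>
          \<iota> x (\<beta> x (Str C x a) \<odot>\<^bsub>Sec J x\<^esub> D x c)"
        using a c closed Str Str_C[OF x a] D[OF x c] \<iota>_smult[OF x Str(1) D(1)[OF x c]]
        by (simp add: liftD(3,5)[OF \<eta> x] liftD(3,5)[OF \<eta>' x] B'.r_distr)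
    qed (use a c Str_C[OF x a] D(1)[OF x] \<beta>_closed[OF x] in auto)
  next
    fix f c assume fc: "f \<in> Ar T" "c \<in> carrier (Sec C (tgt T f))"
    have x: "src T f \<in> Ob T" "tgt T f \<in> Ob T"
      using category fc by (simp_all add: category_simps)
    note D' = D[OF x(2) fc(2)]
    show "D (src T f) (Res C f c) = Res J f (D (tgt T f) c)"
    proof (rule D_eqI[OF x(1) Res_C_closed[OF fc] Res_J_closed[OF fc(1) D'(1)]])
      have "\<eta>' (src T f) (Res C f c) =
          Res B' f (\<eta> (tgt T f) c \<oplus>\<^bsub>Sec B' (tgt T f)\<^esub> \<iota> (tgt T f) (D (tgt T f) c))"
        using maps_natural[OF lift_maps[OF \<eta>'] fc] D'(2) by simp
      also have "\<dots> = Res B' f (\<eta> (tgt T f) c) \<oplus>\<^bsub>Sec B' (src T f)\<^esub>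
          Res B' f (\<iota> (tgt T f) (D (tgt T f) c))"
        by (rule ring_hom_add[OF Res_B'[OF fc(1)] liftD(1)[OF \<eta> x(2) fc(2)]
              \<iota>_in_kernel(2)[OF x(2) D'(1)]])
      also have "\<dots> = \<eta> (src T f) (Res C f c) \<oplus>\<^bsub>Sec B' (src T f)\<^esub>
          \<iota> (src T f) (Res J f (D (tgt T f) c))"
        using maps_natural[OF lift_maps[OF \<eta>] fc] maps_natural[OF \<iota>_maps fc(1) D'(1)] by simp
      finally show "\<eta>' (src T f) (Res C f c) = \<eta> (src T f) (Res C f c) \<oplus>\<^bsub>Sec B' (src T f)\<^esub>
          \<iota> (src T f) (Res J f (D (tgt T f) c))" .
    qed
  qed
  moreover from this have "add ?D \<eta> = \<eta>'"
    using D by (intro maps_eqI[OF lift_maps[OF add_lift[OF _ \<eta>]] lift_maps[OF \<eta>']]) (auto simp: add_apply)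
  ultimately show ?thesis
    by blast
qed

theorem lifts_torsor:
  assumes "lifts \<noteq> {}"
  shows "group_torsor (der_group T A C \<beta> J) lifts (\<lambda>D. \<lambda>\<eta>\<in>lifts. add D \<eta>)"
proof (rule group_torsorI[OF _ assms])
  let ?G = "der_group T A C \<beta> J"
  show group: "group ?G"
    using comm_group_der_group by (rule comm_group.axioms(2))
  show closed: "add D \<eta> \<in> lifts" if "D \<in> carrier ?G" "\<eta> \<in> lifts" for D \<eta>
    using that add_lift by (simp add: der_group_def)
  have eqI: "\<eta> = \<eta>'" if "\<eta> \<in> lifts" "\<eta>' \<in> lifts"
    "\<And>x c. x \<in> Ob T \<Longrightarrow> c \<in> carrier (Sec C x) \<Longrightarrow> \<eta> x c = \<eta>' x c" for \<eta> \<eta>'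
    using that maps_eqI lift_maps by blast
  have J: "D x c \<in> carrier (Sec J x)" if "D \<in> carrier ?G" "x \<in> Ob T" "c \<in> carrier (Sec C x)" for D x c
    using that derivationD(1) by (simp add: der_group_def)
  note B' = cring.axioms(1)[OF cring_B'] ring.ring_simprules
  have mult: "(D \<otimes>\<^bsub>?G\<^esub> D') x c = D x c \<oplus>\<^bsub>Sec J x\<^esub> D' x c"
    "\<one>\<^bsub>?G\<^esub> x c = \<zero>\<^bsub>Sec J x\<^esub>" if "x \<in> Ob T" "c \<in> carrier (Sec C x)" for D D' x c
    using that by (simp_all add: der_group_def)
  fix \<eta> assume \<eta>: "\<eta> \<in> lifts"
  show "add \<one>\<^bsub>?G\<^esub> \<eta> = \<eta>"
    using \<eta> liftD(1)[OF \<eta>]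
    by (intro eqI closed group.is_monoid[OF group, THEN monoid.one_closed])
       (simp_all add: add_apply mult \<iota>_zero B')
  show "add (D \<otimes>\<^bsub>?G\<^esub> D') \<eta> = add D (add D' \<eta>)" if "D \<in> carrier ?G" "D' \<in> carrier ?G" for D D'
    using that \<eta> liftD(1)[OF \<eta>] J[OF that(1)] J[OF that(2)] \<iota>_in_kernel(2)
      monoid.m_closed[OF group.is_monoid[OF group]]
    by (intro eqI closed) (simp_all add: add_apply mult \<iota>_add B')
  fix \<eta>' assume \<eta>': "\<eta>' \<in> lifts"
  show "\<exists>!D. D \<in> carrier ?G \<and> add D \<eta> = \<eta>'"
  proof (rule ex_ex1I)
    show "\<exists>D. D \<in> carrier ?G \<and> add D \<eta> = \<eta>'"
      using difference_derivation[OF \<eta> \<eta>'] by (auto simp: der_group_def)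
    fix D D' assume D: "D \<in> carrier ?G \<and> add D \<eta> = \<eta>'" "D' \<in> carrier ?G \<and> add D' \<eta> = \<eta>'"
    have "D x c = D' x c" if x: "x \<in> Ob T" and c: "c \<in> carrier (Sec C x)" for x c
    proof -
      have "\<eta> x c \<oplus>\<^bsub>Sec B' x\<^esub> \<iota> x (D x c) = \<eta> x c \<oplus>\<^bsub>Sec B' x\<^esub> \<iota> x (D' x c)"
        using D x c by (metis add_apply)
      thus ?thesis
        using \<iota>_cancel[OF x liftD(1)[OF \<eta> x c]] J[OF _ x c] D by blast
    qed
    thus "D = D'"
      using derivation_eqI D by (simp add: der_group_def)
  qed
qed

end

section \<open>Torsor classes and global sections\<close>

lemma resolutionD:
  assumes "injective_resolution T cov G I \<epsilon> d"
  shows "presheaf T (I n)"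
    "x \<in> Ob T \<Longrightarrow> comm_group (Sec (I n) x)"
    "f \<in> Ar T \<Longrightarrow> Res (I n) f \<in> hom (Sec (I n) (tgt T f)) (Sec (I n) (src T f))"
    "\<epsilon> \<in> maps T G (I 0)" "x \<in> Ob T \<Longrightarrow> \<epsilon> x \<in> hom (Sec G x) (Sec (I 0) x)"
    "d n \<in> maps T (I n) (I (Suc n))" "x \<in> Ob T \<Longrightarrow> d n x \<in> hom (Sec (I n) x) (Sec (I (Suc n)) x)"
    "x \<in> Ob T \<Longrightarrow>
       bij_betw (\<epsilon> x) (carrier (Sec G x)) (kernel (Sec (I 0) x) (Sec (I 1) x) (d 0 x))"
    "x \<in> Ob T \<Longrightarrow> s \<in> carrier (Sec (I n) x) \<Longrightarrow>
       d (Suc n) x (d n x s) = \<one>\<^bsub>Sec (I (Suc (Suc n))) x\<^esub>"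
  using assms
  by (auto simp: injective_resolution_def injective_sheaf_def ab_sheaf_def sheaf_def ab_maps_def)

lemma resolution_group_hom:
  assumes "injective_resolution T cov G I \<epsilon> d" "x \<in> Ob T"
  shows "group_hom (Sec (I n) x) (Sec (I (Suc n)) x) (d n x)"
  using resolutionD(2,7)[OF assms(1,2)]
  by (auto simp: group_hom_def group_hom_axioms_def comm_group_def)

lemma one_cohomology_1: "\<one>\<^bsub>cohomology I d z 1\<^esub> = d 0 z ` carrier (Sec (I 0) z)"
  by (simp add: cohomology_def FactGroup_def coboundaries_def)

lemma presheafD:
  assumes "presheaf T F"
  shows "f \<in> Ar T \<Longrightarrow> s \<in> carrier (Sec F (tgt T f)) \<Longrightarrow> Res F f s \<in> carrier (Sec F (src T f))"
    "x \<in> Ob T \<Longrightarrow> s \<in> carrier (Sec F x) \<Longrightarrow> Res F (idn T x) s = s"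
    "f \<in> Ar T \<Longrightarrow> g \<in> Ar T \<Longrightarrow> tgt T f = src T g \<Longrightarrow> s \<in> carrier (Sec F (tgt T g)) \<Longrightarrow>
       Res F (cmp T g f) s = Res F f (Res F g s)"
  using assms unfolding presheaf_def by (auto simp: Pi_iff)

lemma presheaf_bang:
  assumes "category T" "terminal T z" "presheaf T F" "s \<in> carrier (Sec F z)"
  shows "x \<in> Ob T \<Longrightarrow> Res F (bang T z x) s \<in> carrier (Sec F x)"
    and "f \<in> Ar T \<Longrightarrow> Res F f (Res F (bang T z (tgt T f)) s) = Res F (bang T z (src T f)) s"
    and "Res F (bang T z z) s = s"
proof -
  have bang: "bang T z x \<in> Ar T" "src T (bang T z x) = x" "tgt T (bang T z x) = z" if "x \<in> Ob T" for x
    using bang_arrow[OF assms(2) that] by (auto simp: arrows_def)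
  show "Res F (bang T z x) s \<in> carrier (Sec F x)" if "x \<in> Ob T"
    using presheafD(1)[OF assms(3) bang(1)[OF that], of s] bang[OF that] assms(4) by simp
  show "Res F f (Res F (bang T z (tgt T f)) s) = Res F (bang T z (src T f)) s" if "f \<in> Ar T"
    using presheafD(3)[OF assms(3) that bang(1), of "tgt T f" s] that assms bang[of "tgt T f"]
    by (simp add: bang_cmp category_simps)
  show "Res F (bang T z z) s = s"
    using presheafD(2)[OF assms(3) _ assms(4)] assms(1,2) by (simp add: bang_self terminal_def)
qed

text \<open>A global section of the torsor of a cocycle \<open>q\<close> exhibits \<open>q\<close> as a coboundary, since restriction along
  the arrow from \<open>z\<close> to itself is the identity.\<close>

lemma cocycle_torsor_section:
  assumes "category T" "terminal T z" "injective_resolution T cov G I \<epsilon> d"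
    and "q \<in> carrier (Sec (I 1) z)" "t \<in> carrier (Sec (cocycle_torsor T z I d q) z)"
  shows "t \<in> carrier (Sec (I 0) z)" "d 0 z t = q"
  using assms(5) presheaf_bang(3)[OF assms(1,2) resolutionD(1)[OF assms(3), of 1] assms(4)]
  by (simp_all add: cocycle_torsor_def)

text \<open>Over \<open>x\<close> the torsor of \<open>d t\<close> is the coset of \<open>t\<close> under the kernel of \<open>d\<close>, and \<open>\<epsilon>\<close> identifies \<open>G\<close> with
  that kernel.\<close>

lemma coboundary_torsor_fibre:
  assumes "category T" "terminal T z" and res: "injective_resolution T cov G I \<epsilon> d"
    and t: "t \<in> carrier (Sec (I 0) z)" and x: "x \<in> Ob T"
  shows "bij_betw (\<lambda>g. \<epsilon> x g \<otimes>\<^bsub>Sec (I 0) x\<^esub> Res (I 0) (bang T z x) t) (carrier (Sec G x))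
           (carrier (Sec (cocycle_torsor T z I d (d 0 z t)) x))"
proof -
  interpret d: group_hom "Sec (I 0) x" "Sec (I (Suc 0)) x" "d 0 x"
    using resolution_group_hom[OF res x] .
  let ?t = "Res (I 0) (bang T z x) t"
  have bang: "bang T z x \<in> Ar T" "src T (bang T z x) = x" "tgt T (bang T z x) = z"
    using bang_arrow[OF assms(2) x] by (auto simp: arrows_def)
  have tx: "?t \<in> carrier (Sec (I 0) x)"
    using presheaf_bang(1)[OF assms(1,2) resolutionD(1)[OF res] t x] .
  have dt: "Res (I 1) (bang T z x) (d 0 z t) = d 0 x ?t"
    using maps_natural[OF resolutionD(6)[OF res] bang(1), of t 0] bang t by simp
  let ?K = "kernel (Sec (I 0) x) (Sec (I 1) x) (d 0 x)"
  have "bij_betw (\<lambda>k. k \<otimes>\<^bsub>Sec (I 0) x\<^esub> ?t) ?K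
      (carrier (Sec (cocycle_torsor T z I d (d 0 z t)) x))"
  proof (rule bij_betw_byWitness[where f' = "\<lambda>s. s \<otimes>\<^bsub>Sec (I 0) x\<^esub> inv\<^bsub>Sec (I 0) x\<^esub> ?t"])
    show "(\<lambda>k. k \<otimes>\<^bsub>Sec (I 0) x\<^esub> ?t) ` ?K \<subseteq> carrier (Sec (cocycle_torsor T z I d (d 0 z t)) x)"
      using tx dt by (auto simp: kernel_def cocycle_torsor_def)
    show "(\<lambda>s. s \<otimes>\<^bsub>Sec (I 0) x\<^esub> inv\<^bsub>Sec (I 0) x\<^esub> ?t) `
        carrier (Sec (cocycle_torsor T z I d (d 0 z t)) x) \<subseteq> ?K"
      using tx dt by (auto simp: kernel_def cocycle_torsor_def)
  qed (use tx in \<open>auto simp: kernel_def cocycle_torsor_def d.G.m_assoc\<close>)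
  with resolutionD(8)[OF res x] show ?thesis
    using bij_betw_trans[of "\<epsilon> x" "carrier (Sec G x)" ?K "\<lambda>k. k \<otimes>\<^bsub>Sec (I 0) x\<^esub> ?t"]
    by (simp add: o_def)
qed

text \<open>Both torsors have a global section, \<open>\<sigma>\<close> on one side and \<open>t\<close> on the other, and the isomorphism carries
  \<open>g \<sigma>\<close> to \<open>g t\<close>.\<close>

lemma torsor_isomorphic_coboundary:
  assumes T: "category T" "terminal T z" and res: "injective_resolution T cov G I \<epsilon> d"
    and G: "presheaf T G" and F: "presheaf T F"
    and torsor: "\<And>x. x \<in> Ob T \<Longrightarrow> carrier (Sec F x) \<noteq> {} \<Longrightarrow>
           group_torsor (Sec G x) (carrier (Sec F x)) (\<lambda>g. \<lambda>s\<in>carrier (Sec F x). act x g s)"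
    and natural: "\<And>f g s. f \<in> Ar T \<Longrightarrow> g \<in> carrier (Sec G (tgt T f)) \<Longrightarrow> s \<in> carrier (Sec F (tgt T f)) \<Longrightarrow>
           Res F f (act (tgt T f) g s) = act (src T f) (Res G f g) (Res F f s)"
    and \<sigma>: "\<sigma> \<in> carrier (Sec F z)" and t: "t \<in> carrier (Sec (I 0) z)"
  shows "torsor_isomorphic T G F act (cocycle_torsor T z I d (d 0 z t))
           (\<lambda>x g s. \<epsilon> x g \<otimes>\<^bsub>Sec (I 0) x\<^esub> s)"
proof -
  let ?F' = "cocycle_torsor T z I d (d 0 z t)"
  define \<sigma>' where "\<sigma>' x = Res F (bang T z x) \<sigma>" for x
  define t' where "t' x = Res (I 0) (bang T z x) t" for x
  have \<sigma>': "\<sigma>' x \<in> carrier (Sec F x)" and t': "t' x \<in> carrier (Sec (I 0) x)" if "x \<in> Ob T" for x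
    unfolding \<sigma>'_def t'_def
    using presheaf_bang(1)[OF T F \<sigma> that] presheaf_bang(1)[OF T resolutionD(1)[OF res] t that] .
  have torsor': "group_torsor (Sec G x) (carrier (Sec F x)) (\<lambda>g. \<lambda>s\<in>carrier (Sec F x). act x g s)"
    if "x \<in> Ob T" for x
    using torsor[OF that] \<sigma>'[OF that] by blast
  \<comment> \<open>the group element that moves the restriction of \<open>\<sigma>\<close> to \<open>s\<close>\<close>
  define \<delta> where "\<delta> x s = (THE g. g \<in> carrier (Sec G x) \<and> act x g (\<sigma>' x) = s)" for x s
  have \<delta>: "\<delta> x s \<in> carrier (Sec G x)" "act x (\<delta> x s) (\<sigma>' x) = s"
    if "x \<in> Ob T" "s \<in> carrier (Sec F x)" for x s
    using theI'[OF group_torsorD(4)[OF torsor'[OF that(1)] \<sigma>'[OF that(1)] that(2)]]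
    unfolding \<delta>_def by auto
  have \<delta>_act: "\<delta> x (act x g (\<sigma>' x)) = g" if "x \<in> Ob T" "g \<in> carrier (Sec G x)" for x g
  proof -
    have "act x g (\<sigma>' x) \<in> carrier (Sec F x)"
      using group_torsorD(2)[OF torsor'] \<sigma>' that by blast
    thus ?thesis
      using group_torsorD(4)[OF torsor'[OF that(1)] \<sigma>'[OF that(1)]] \<delta>[OF that(1)] that(2) by blast
  qed
  have \<delta>_bij: "bij_betw (\<delta> x) (carrier (Sec F x)) (carrier (Sec G x))" if "x \<in> Ob T" for x
    using \<delta>[OF that] \<delta>_act[OF that] group_torsorD(2)[OF torsor'[OF that] _ \<sigma>'[OF that]]
    by (intro bij_betw_byWitness[where f' = "\<lambda>g. act x g (\<sigma>' x)"]) auto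
  let ?\<theta> = "\<lambda>x\<in>Ob T. \<lambda>s\<in>carrier (Sec F x). \<epsilon> x (\<delta> x s) \<otimes>\<^bsub>Sec (I 0) x\<^esub> t' x"
  have bij: "bij_betw (\<lambda>s. \<epsilon> x (\<delta> x s) \<otimes>\<^bsub>Sec (I 0) x\<^esub> t' x) (carrier (Sec F x)) (carrier (Sec ?F' x))"
    if "x \<in> Ob T" for x
    using bij_betw_trans[OF \<delta>_bij[OF that] coboundary_torsor_fibre[OF T res t that]]
    by (simp add: o_def t'_def)
  have "?\<theta> \<in> maps T F ?F'"
  proof (rule maps_lamI[OF T(1)])
    show "\<epsilon> x (\<delta> x s) \<otimes>\<^bsub>Sec (I 0) x\<^esub> t' x \<in> carrier (Sec ?F' x)"
      if "x \<in> Ob T" "s \<in> carrier (Sec F x)" for x s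
      using bij_betwE[OF bij[OF that(1)]] that(2) by blast
    fix f s assume f: "f \<in> Ar T" and s: "s \<in> carrier (Sec F (tgt T f))"
    let ?x = "tgt T f" and ?y = "src T f"
    have xy: "?x \<in> Ob T" "?y \<in> Ob T"
      using T(1) f by (simp_all add: category_simps)
    note g = \<delta>[OF xy(1) s]
    have "Res F f s = act ?y (Res G f (\<delta> ?x s)) (\<sigma>' ?y)"
      using natural[OF f g(1) \<sigma>'[OF xy(1)]] g(2) presheaf_bang(2)[OF T F \<sigma> f] by (simp add: \<sigma>'_def)
    hence "\<delta> ?y (Res F f s) = Res G f (\<delta> ?x s)"
      using \<delta>_act[OF xy(2) presheafD(1)[OF G f g(1)]] by simp
    moreover have "\<epsilon> ?y (Res G f (\<delta> ?x s)) = Res (I 0) f (\<epsilon> ?x (\<delta> ?x s))"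
      using maps_natural[OF resolutionD(4)[OF res] f g(1)] .
    moreover have "t' ?y = Res (I 0) f (t' ?x)"
      using presheaf_bang(2)[OF T resolutionD(1)[OF res] t f] by (simp add: t'_def)
    moreover have "Res (I 0) f (\<epsilon> ?x (\<delta> ?x s) \<otimes>\<^bsub>Sec (I 0) ?x\<^esub> t' ?x) =
        Res (I 0) f (\<epsilon> ?x (\<delta> ?x s)) \<otimes>\<^bsub>Sec (I 0) ?y\<^esub> Res (I 0) f (t' ?x)"
      using hom_mult[OF resolutionD(3)[OF res f] maps_closed[OF resolutionD(4)[OF res] xy(1) g(1)]
          t'[OF xy(1)]] .
    ultimately show "Res F f s \<in> carrier (Sec F ?y) \<and>
        \<epsilon> ?y (\<delta> ?y (Res F f s)) \<otimes>\<^bsub>Sec (I 0) ?y\<^esub> t' ?y =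
        Res ?F' f (\<epsilon> ?x (\<delta> ?x s) \<otimes>\<^bsub>Sec (I 0) ?x\<^esub> t' ?x)"
      using presheafD(1)[OF F f s] by (simp add: cocycle_torsor_def)
  qed
  moreover have "bij_betw (?\<theta> x) (carrier (Sec F x)) (carrier (Sec ?F' x)) \<and>
      (\<forall>g\<in>carrier (Sec G x). \<forall>s\<in>carrier (Sec F x).
         ?\<theta> x (act x g s) = \<epsilon> x g \<otimes>\<^bsub>Sec (I 0) x\<^esub> ?\<theta> x s)" if x: "x \<in> Ob T" for x
  proof (intro conjI ballI)
    show "bij_betw (?\<theta> x) (carrier (Sec F x)) (carrier (Sec ?F' x))"
      using bij[OF x] x by (simp cong: bij_betw_cong)
    fix g s assume g: "g \<in> carrier (Sec G x)" and s: "s \<in> carrier (Sec F x)"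
    interpret G: group "Sec G x"
      using group_torsorD(1)[OF torsor'[OF x]] .
    interpret I: comm_group "Sec (I 0) x"
      using resolutionD(2)[OF res x] .
    note h = \<delta>[OF x s]
    have "\<delta> x (act x g s) = g \<otimes>\<^bsub>Sec G x\<^esub> \<delta> x s"
      using \<delta>_act[OF x G.m_closed[OF g h(1)]]
        group_torsorD(3)[OF torsor'[OF x] g h(1) \<sigma>'[OF x]] h(2) by simp
    moreover have "\<epsilon> x (g \<otimes>\<^bsub>Sec G x\<^esub> \<delta> x s) = \<epsilon> x g \<otimes>\<^bsub>Sec (I 0) x\<^esub> \<epsilon> x (\<delta> x s)"
      using hom_mult[OF resolutionD(5)[OF res x] g h(1)] .
    moreover have "act x g s \<in> carrier (Sec F x)"
      using group_torsorD(2)[OF torsor'[OF x] g s] .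
    moreover have "\<epsilon> x g \<in> carrier (Sec (I 0) x)" "\<epsilon> x (\<delta> x s) \<in> carrier (Sec (I 0) x)"
      using maps_closed[OF resolutionD(4)[OF res] x] g h(1) by auto
    ultimately show "?\<theta> x (act x g s) = \<epsilon> x g \<otimes>\<^bsub>Sec (I 0) x\<^esub> ?\<theta> x s"
      using x s t'[OF x] by (simp add: I.m_assoc)
  qed
  ultimately show ?thesis
    unfolding torsor_isomorphic_def by blast
qed

text \<open>The zero class is the set of all coboundaries.  If \<open>F\<close> has this class, then \<open>F\<close> is isomorphic to the
  torsor of the coboundary \<open>d 1\<close>, which has the global section \<open>1\<close>.  Conversely, a global section
  \<open>\<sigma>\<close> of \<open>F\<close> is carried by any isomorphism to a global section of the torsor of \<open>q\<close>, so that \<open>q\<close> is a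
  coboundary, while the torsor of every coboundary is isomorphic to \<open>F\<close> by means of \<open>\<sigma>\<close>.\<close>

theorem torsor_class_trivial_iff:
  assumes T: "category T" "terminal T z" and res: "injective_resolution T cov G I \<epsilon> d"
    and G: "presheaf T G" and F: "presheaf T F"
    and torsor: "\<And>x. x \<in> Ob T \<Longrightarrow> carrier (Sec F x) \<noteq> {} \<Longrightarrow>
           group_torsor (Sec G x) (carrier (Sec F x)) (\<lambda>g. \<lambda>s\<in>carrier (Sec F x). act x g s)"
    and natural: "\<And>f g s. f \<in> Ar T \<Longrightarrow> g \<in> carrier (Sec G (tgt T f)) \<Longrightarrow> s \<in> carrier (Sec F (tgt T f)) \<Longrightarrow>
           Res F f (act (tgt T f) g s) = act (src T f) (Res G f g) (Res F f s)"
  shows "torsor_class T z G I \<epsilon> d F act = \<one>\<^bsub>cohomology I d z 1\<^esub> \<longleftrightarrow> carrier (Sec F z) \<noteq> {}"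
proof
  have z: "z \<in> Ob T"
    using T(2) by (simp add: terminal_def)
  interpret d: group_hom "Sec (I 0) z" "Sec (I (Suc 0)) z" "d 0 z"
    using resolution_group_hom[OF res z] .
  {
    assume "torsor_class T z G I \<epsilon> d F act = \<one>\<^bsub>cohomology I d z 1\<^esub>"
    hence "d 0 z \<one>\<^bsub>Sec (I 0) z\<^esub> \<in> torsor_class T z G I \<epsilon> d F act"
      by (simp only: one_cohomology_1 imageI d.G.one_closed)
    then obtain \<theta> where
      "bij_betw (\<theta> z) (carrier (Sec F z)) (carrier (Sec (cocycle_torsor T z I d (d 0 z \<one>\<^bsub>Sec (I 0) z\<^esub>)) z))"
      using z by (auto simp: torsor_class_def torsor_isomorphic_def)
    moreover have "carrier (Sec (cocycle_torsor T z I d (d 0 z \<one>\<^bsub>Sec (I 0) z\<^esub>)) z) \<noteq> {}"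
      using presheaf_bang(3)[OF T resolutionD(1)[OF res] d.hom_closed[OF d.G.one_closed]]
        d.G.one_closed by (auto simp: cocycle_torsor_def)
    ultimately show "carrier (Sec F z) \<noteq> {}"
      by (auto simp: bij_betw_def)
  }
  assume "carrier (Sec F z) \<noteq> {}"
  then obtain \<sigma> where \<sigma>: "\<sigma> \<in> carrier (Sec F z)"
    by blast
  have cocycle: "d 0 z t \<in> carrier (cocycles I d z 1)" if "t \<in> carrier (Sec (I 0) z)" for t
    using that resolutionD(9)[OF res z that] by (simp add: cocycles_def kernel_def)
  have "q \<in> torsor_class T z G I \<epsilon> d F act \<longleftrightarrow> q \<in> d 0 z ` carrier (Sec (I 0) z)" for q
  proof
    assume "q \<in> torsor_class T z G I \<epsilon> d F act"
    then obtain \<theta> where q: "q \<in> carrier (Sec (I 1) z)"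
      and \<theta>: "\<theta> \<in> maps T F (cocycle_torsor T z I d q)"
      by (auto simp: torsor_class_def torsor_isomorphic_def cocycles_def kernel_def)
    from cocycle_torsor_section[OF T res q maps_closed[OF \<theta> z \<sigma>]]
    show "q \<in> d 0 z ` carrier (Sec (I 0) z)"
      by auto
  next
    assume "q \<in> d 0 z ` carrier (Sec (I 0) z)"
    then obtain t where t: "t \<in> carrier (Sec (I 0) z)" "q = d 0 z t"
      by blast
    show "q \<in> torsor_class T z G I \<epsilon> d F act"
      using cocycle[OF t(1)] torsor_isomorphic_coboundary[OF T res G F torsor natural \<sigma> t(1)] t(2)
      by (simp add: torsor_class_def)
  qed
  thus "torsor_class T z G I \<epsilon> d F act = \<one>\<^bsub>cohomology I d z 1\<^esub>"
    unfolding one_cohomology_1 by blast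
qed

lemma group_cohomology_0:
  assumes res: "injective_resolution T cov G I \<epsilon> d" and z: "z \<in> Ob T"
  shows "group (cocycles I d z 0)" "group (cohomology I d z 0)"
proof -
  interpret d: group_hom "Sec (I 0) z" "Sec (I (Suc 0)) z" "d 0 z"
    using resolution_group_hom[OF res z] .
  show K: "group (cocycles I d z 0)"
    unfolding cocycles_def using subgroup.subgroup_is_group[OF d.subgroup_kernel d.G.group_axioms] .
  have "coboundaries I d z 0 = {\<one>\<^bsub>cocycles I d z 0\<^esub>}"
    by (simp add: coboundaries_def cocycles_def)
  thus "group (cohomology I d z 0)"
    unfolding cohomology_def using normal.factorgroup_is_group[OF group.one_is_normal[OF K]] by simp
qed

text \<open>In degree zero the only coboundary is \<open>1\<close>, so the classes are singletons and \<open>H\<^sup>0\<close> is the kernel of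
  \<open>d\<close>, with which \<open>\<epsilon>\<close> identifies \<open>G z\<close>.\<close>

lemma to_H0_iso:
  assumes res: "injective_resolution T cov G I \<epsilon> d" and z: "z \<in> Ob T" and G: "group (Sec G z)"
  shows "to_H0 z I \<epsilon> d \<in> iso (Sec G z) (cohomology I d z 0)"
proof -
  let ?K = "cocycles I d z 0"
  interpret K: group ?K
    using group_cohomology_0(1)[OF res z] .
  have cob: "coboundaries I d z 0 = {\<one>\<^bsub>?K\<^esub>}"
    by (simp add: coboundaries_def cocycles_def)
  have bij: "bij_betw (\<epsilon> z) (carrier (Sec G z)) (carrier ?K)"
    using resolutionD(8)[OF res z] by (simp add: cocycles_def)
  have to_H0: "to_H0 z I \<epsilon> d g = {\<epsilon> z g}" if "g \<in> carrier (Sec G z)" for g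
    using bij_betwE[OF bij] that by (simp add: to_H0_def cob r_coset_def)
  have carrier: "carrier (cohomology I d z 0) = (\<lambda>k. {k}) ` carrier ?K"
    by (auto simp: cohomology_def FactGroup_def cob RCOSETS_def r_coset_def)
  have mult: "{k} \<otimes>\<^bsub>cohomology I d z 0\<^esub> {l} = {k \<otimes>\<^bsub>?K\<^esub> l}" for k l
    by (simp add: cohomology_def FactGroup_def set_mult_def)
  have "to_H0 z I \<epsilon> d (g \<otimes>\<^bsub>Sec G z\<^esub> h) =
      to_H0 z I \<epsilon> d g \<otimes>\<^bsub>cohomology I d z 0\<^esub> to_H0 z I \<epsilon> d h"
    if "g \<in> carrier (Sec G z)" "h \<in> carrier (Sec G z)" for g h
    using that monoid.m_closed[OF group.is_monoid[OF G]] hom_mult[OF resolutionD(5)[OF res z] that(1,2)]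
    by (simp add: to_H0 mult) (simp add: cocycles_def)
  moreover have "bij_betw (to_H0 z I \<epsilon> d) (carrier (Sec G z)) (carrier (cohomology I d z 0))"
  proof -
    have "bij_betw (\<lambda>g. {\<epsilon> z g}) (carrier (Sec G z)) (carrier (cohomology I d z 0))"
      unfolding carrier using bij_betw_trans[OF bij, of "\<lambda>k. {k}"]
      by (simp add: o_def bij_betw_def inj_on_def)
    thus ?thesis
      using to_H0 by (simp cong: bij_betw_cong)
  qed
  ultimately show ?thesis
    by (auto simp: iso_def hom_def dest: bij_betwE)
qed

section \<open>Square-zero extensions as torsors on the site\<close>

lemma square_zero_extensionD:
  assumes "square_zero_extension E A B J B' p \<iota>"
  shows "alg_sheaf E A B'" "p \<in> alg_maps E A B' B" "\<iota> \<in> maps E J B'"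
    and "x \<in> Ob E \<Longrightarrow> k \<in> a_kernel (Sec B' x) (Sec B x) (p x) \<Longrightarrow>
          l \<in> a_kernel (Sec B' x) (Sec B x) (p x) \<Longrightarrow> k \<otimes>\<^bsub>Sec B' x\<^esub> l = \<zero>\<^bsub>Sec B' x\<^esub>"
    and "x \<in> Ob E \<Longrightarrow> bij_betw (\<iota> x) (carrier (Sec J x)) (a_kernel (Sec B' x) (Sec B x) (p x))"
    and "x \<in> Ob E \<Longrightarrow> j \<in> carrier (Sec J x) \<Longrightarrow> k \<in> carrier (Sec J x) \<Longrightarrow>
          \<iota> x (j \<oplus>\<^bsub>Sec J x\<^esub> k) = \<iota> x j \<oplus>\<^bsub>Sec B' x\<^esub> \<iota> x k"
    and "x \<in> Ob E \<Longrightarrow> b \<in> carrier (Sec B' x) \<Longrightarrow> j \<in> carrier (Sec J x) \<Longrightarrow>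
          \<iota> x (p x b \<odot>\<^bsub>Sec J x\<^esub> j) = b \<otimes>\<^bsub>Sec B' x\<^esub> \<iota> x j"
  using assms by (auto simp: square_zero_extension_def)

lemma module_sheafD:
  assumes "module_sheaf E B J"
  shows "presheaf E J" "x \<in> Ob E \<Longrightarrow> module (Sec B x) (Sec J x)"
    and "f \<in> Ar E \<Longrightarrow> j \<in> carrier (Sec J (tgt E f)) \<Longrightarrow> k \<in> carrier (Sec J (tgt E f)) \<Longrightarrow>
      Res J f (j \<oplus>\<^bsub>Sec J (tgt E f)\<^esub> k) = Res J f j \<oplus>\<^bsub>Sec J (src E f)\<^esub> Res J f k"
  using assms by (auto simp: module_sheaf_def small_sheaf_def sheaf_def)

text \<open>The two instances of the locale: the extension on \<open>E\<close> with the identity of \<open>B\<close> to be lifted, and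
  its restriction to the slice of an object of the site with the augmentation to be lifted.\<close>

lemma square_zero_lifting_global:
  assumes "category E" "alg_sheaf E A B" "module_sheaf E B J" "square_zero_extension E A B J B' p \<iota>"
  shows "square_zero_lifting E A B J B (id_map E B) B' p \<iota>"
proof (intro square_zero_lifting.intro derivation_presheaves.intro square_zero_lifting_axioms.intro)
  note ext = square_zero_extensionD[OF assms(4)]
  show "category E" "p \<in> alg_maps E A B' B" "\<iota> \<in> maps E J B'"
    using assms(1) ext by auto
  show "id_map E B \<in> alg_maps E A B B"
    using assms(1,2) by (rule id_map_alg_maps)
  show "Str B x a \<in> carrier (Sec B x)" if "x \<in> Ob E" "a \<in> carrier (Sec A x)" for x a
    using alg_sheafD(3)[OF assms(2)] that by (auto simp: ring_hom_def)
qed (simp_all add: square_zero_extensionD[OF assms(4)] module_sheafD[OF assms(3)]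
      presheafD(1)[OF module_sheafD(1)[OF assms(3)]] alg_sheafD[OF assms(2)]
      alg_sheafD[OF square_zero_extensionD(1)[OF assms(4)]])

lemma square_zero_lifting_slice:
  assumes "category E" "module_sheaf E B J" "square_zero_extension E A B J B' p \<iota>"
    and "X \<in> Ob (alg_cat E A B)"
  shows "square_zero_lifting (slice E (base X)) (loc E A) (loc_alg E (base X) B) (loc E J)
    (ring_of X) (aug X) (loc_alg E (base X) B') (loc_map E (base X) p) (loc_map E (base X) \<iota>)"
proof (intro square_zero_lifting.intro derivation_presheaves.intro square_zero_lifting_axioms.intro)
  note ext = square_zero_extensionD[OF assms(3)] and mod = module_sheafD[OF assms(2)]
  have X: "alg_sheaf (slice E (base X)) (loc E A) (ring_of X)"
    "aug X \<in> alg_maps (slice E (base X)) (loc E A) (ring_of X) (loc_alg E (base X) B)"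
    using assms(4) by auto
  show "category (slice E (base X))"
    using assms(1) by (rule category_slice)
  show "aug X \<in> alg_maps (slice E (base X)) (loc E A) (ring_of X) (loc_alg E (base X) B)"
    by fact
  show "loc_map E (base X) p \<in>
      alg_maps (slice E (base X)) (loc E A) (loc_alg E (base X) B') (loc_alg E (base X) B)"
    using assms(1) ext(2) by (rule loc_map_alg_maps)
  show "loc_map E (base X) \<iota> \<in> maps (slice E (base X)) (loc E J) (loc_alg E (base X) B')"
    by (rule loc_map_maps[OF assms(1) ext(3)]) simp_all
  fix v assume v: "v \<in> Ob (slice E (base X))"
  show "cring (Sec (ring_of X) v)"
    using alg_sheafD(1)[OF X(1) v] .
  show "Str (ring_of X) v a \<in> carrier (Sec (ring_of X) v)" if "a \<in> carrier (Sec (loc E A) v)" for a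
    using alg_sheafD(3)[OF X(1) v] that by (auto simp: ring_hom_def)
  have x: "src E v \<in> Ob E" "v \<in> Ar E" "tgt E v = base X"
    using v assms(1) by (auto simp: category_simps)
  note * = mod(2)[OF x(1)] ext(4-7)[OF x(1)] alg_sheafD(1)[OF ext(1) x(1)]
  show "module (Sec (loc_alg E (base X) B) v) (Sec (loc E J) v)"
    "cring (Sec (loc_alg E (base X) B') v)"
    "bij_betw (loc_map E (base X) \<iota> v) (carrier (Sec (loc E J) v))
       (a_kernel (Sec (loc_alg E (base X) B') v) (Sec (loc_alg E (base X) B) v) (loc_map E (base X) p v))"
    using * x by simp_all
  show "k \<otimes>\<^bsub>Sec (loc_alg E (base X) B') v\<^esub> l = \<zero>\<^bsub>Sec (loc_alg E (base X) B') v\<^esub>"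
    if "k \<in> a_kernel (Sec (loc_alg E (base X) B') v) (Sec (loc_alg E (base X) B) v) (loc_map E (base X) p v)"
      "l \<in> a_kernel (Sec (loc_alg E (base X) B') v) (Sec (loc_alg E (base X) B) v) (loc_map E (base X) p v)"
    for k l
    using * x that by simp
  fix j assume j: "j \<in> carrier (Sec (loc E J) v)"
  show "loc_map E (base X) \<iota> v (j \<oplus>\<^bsub>Sec (loc E J) v\<^esub> k) =
      loc_map E (base X) \<iota> v j \<oplus>\<^bsub>Sec (loc_alg E (base X) B') v\<^esub> loc_map E (base X) \<iota> v k"
    if "k \<in> carrier (Sec (loc E J) v)" for k
    using * x j that by simp
  show "loc_map E (base X) \<iota> v (loc_map E (base X) p v b \<odot>\<^bsub>Sec (loc E J) v\<^esub> j) =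
      b \<otimes>\<^bsub>Sec (loc_alg E (base X) B') v\<^esub> loc_map E (base X) \<iota> v j"
    if "b \<in> carrier (Sec (loc_alg E (base X) B') v)" for b
    using * x j that by simp
next
  note ext = square_zero_extensionD[OF assms(3)] and mod = module_sheafD[OF assms(2)]
  have X: "alg_sheaf (slice E (base X)) (loc E A) (ring_of X)"
    using assms(4) by auto
  fix f assume f: "f \<in> Ar (slice E (base X))"
  show "Res (ring_of X) f \<in>
      ring_hom (Sec (ring_of X) (tgt (slice E (base X)) f)) (Sec (ring_of X) (src (slice E (base X)) f))"
    using alg_sheafD(2)[OF X f] .
  obtain h w where hw: "f = (h, w)" "h \<in> Ar E" "w \<in> Ar E" "tgt E w = base X" "src E w = tgt E h"
    using f by (cases f) auto
  show "Res (loc_alg E (base X) B') f \<in> ring_hom (Sec (loc_alg E (base X) B') (tgt (slice E (base X)) f))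
      (Sec (loc_alg E (base X) B') (src (slice E (base X)) f))"
    using alg_sheafD(2)[OF ext(1) hw(2)] hw assms(1) by (simp add: category_simps)
  fix j assume j: "j \<in> carrier (Sec (loc E J) (tgt (slice E (base X)) f))"
  show "Res (loc E J) f j \<in> carrier (Sec (loc E J) (src (slice E (base X)) f))"
    using presheafD(1)[OF mod(1) hw(2), of j] j hw assms(1) by (simp add: category_simps)
  show "Res (loc E J) f (j \<oplus>\<^bsub>Sec (loc E J) (tgt (slice E (base X)) f)\<^esub> k) =
      Res (loc E J) f j \<oplus>\<^bsub>Sec (loc E J) (src (slice E (base X)) f)\<^esub> Res (loc E J) f k"
    if "k \<in> carrier (Sec (loc E J) (tgt (slice E (base X)) f))" for k
    using mod(3)[OF hw(2), of j k] j that hw assms(1) by (simp add: category_simps)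
qed

lemma Sec_Der_sheaf [simp]:
  "Sec (Der_sheaf E A J) X = der_group (slice E (base X)) (loc E A) (ring_of X) (aug X) (loc E J)"
  by (simp add: Der_sheaf_def)

lemma Sec_ext_sheaf:
  assumes "category E" "module_sheaf E B J" "square_zero_extension E A B J B' p \<iota>"
    and "X \<in> Ob (alg_cat E A B)"
  shows "carrier (Sec (ext_sheaf E A B' p) X) = square_zero_lifting.lifts (slice E (base X)) (loc E A)
    (ring_of X) (aug X) (loc_alg E (base X) B') (loc_map E (base X) p)"
proof -
  interpret square_zero_lifting "slice E (base X)" "loc E A" "loc_alg E (base X) B" "loc E J"
    "ring_of X" "aug X" "loc_alg E (base X) B'" "loc_map E (base X) p" "loc_map E (base X) \<iota>"
    using square_zero_lifting_slice[OF assms] .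
  have aug: "aug X \<in> maps (slice E (base X)) (ring_of X) (loc_alg E (base X) B)"
    using \<beta>_alg by (simp add: alg_maps_iff)
  have "comp_map (slice E (base X)) (ring_of X) (loc_map E (base X) p) \<eta> = aug X \<longleftrightarrow>
     (\<forall>v\<in>Ob (slice E (base X)). \<forall>c\<in>carrier (Sec (ring_of X) v). loc_map E (base X) p v (\<eta> v c) = aug X v c)"
    (is "?l = aug X \<longleftrightarrow> ?r") for \<eta>
  proof
    have l: "?l = (\<lambda>v\<in>Ob (slice E (base X)). \<lambda>c\<in>carrier (Sec (ring_of X) v). loc_map E (base X) p v (\<eta> v c))"
      by (simp add: comp_map_def compose_def)
    show ?r if "?l = aug X"
      using that[symmetric] by (simp add: l)
    show "?l = aug X" if ?r
      unfolding l by (subst maps_restrict[OF aug]) (use that in \<open>auto intro!: restrict_ext\<close>)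
  qed
  thus ?thesis
    by (auto simp: ext_sheaf_def lifts_def)
qed

lemma presheaf_Der_sheaf:
  assumes "category E"
  shows "presheaf (alg_cat E A B) (Der_sheaf E A J)"
  unfolding presheaf_def
proof (intro conjI ballI impI)
  let ?T = "alg_cat E A B" and ?G = "Der_sheaf E A J"
  note carrier = der_group_def derivations_def
  show "Res ?G \<phi> \<in> carrier (Sec ?G (tgt ?T \<phi>)) \<rightarrow> carrier (Sec ?G (src ?T \<phi>))" if \<phi>: "\<phi> \<in> Ar ?T" for \<phi>
  proof
    let ?C = "ring_of (dom_ob \<phi>)" and ?U = "base (dom_ob \<phi>)" and ?f = "base_ar \<phi>"
    let ?C' = "ring_of (cod_ob \<phi>)"
    fix D assume "D \<in> carrier (Sec ?G (tgt ?T \<phi>))"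
    hence D: "D \<in> derivations (slice E (base (cod_ob \<phi>))) (loc E A) ?C' (aug (cod_ob \<phi>)) (loc E J)"
      by (simp add: der_group_def)
    note \<phi>_base = alg_cat_base_arD[OF \<phi>]
    have C: "alg_sheaf (slice E ?U) (loc E A) ?C" and aug: "pull_along E \<phi> (aug (cod_ob \<phi>)) = aug (dom_ob \<phi>)"
      using \<phi> by (auto simp: alg_cat_Ar_iff)
    have "pull_along E \<phi> D \<in> maps (slice E ?U) ?C (loc E J)"
    proof (rule pull_along_maps[OF assms \<phi>])
      show "D \<in> maps (slice E (base (cod_ob \<phi>))) ?C' (loc E J)"
        using D by (simp add: derivations_def)
    qed (use \<phi>_base assms in \<open>simp_all add: category_simps\<close>)
    moreover
    {
      fix v assume v: "v \<in> Ob (slice E ?U)"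
      hence v': "v \<in> Ar E" "tgt E v = ?U"
        by auto
      let ?w = "cmp E ?f v"
      have w: "?w \<in> Ob (slice E (base (cod_ob \<phi>)))" and src: "src E ?w = src E v"
        using v' \<phi>_base assms by (simp_all add: category_simps)
      interpret C: cring "Sec ?C v"
        using alg_sheafD(1)[OF C v] .
      note \<rho> = alg_cat_ring_arD[OF \<phi> v'] and \<rho>_closed = alg_cat_ring_ar_closed[OF \<phi> v']
      have Str: "Str ?C v a \<in> carrier (Sec ?C v)" if "a \<in> carrier (Sec A (src E v))" for a
        using alg_sheafD(3)[OF C v] that by (auto simp: ring_hom_def)
      have aug_v: "aug (dom_ob \<phi>) v c = aug (cod_ob \<phi>) ?w (ring_ar \<phi> v c)" if "c \<in> carrier (Sec ?C v)" for c
        using v' that by (simp add: aug[symmetric])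
      have D_w: "D ?w (c \<oplus>\<^bsub>Sec ?C' ?w\<^esub> c') = D ?w c \<oplus>\<^bsub>Sec J (src E v)\<^esub> D ?w c'"
        "D ?w (c \<otimes>\<^bsub>Sec ?C' ?w\<^esub> c') = aug (cod_ob \<phi>) ?w c \<odot>\<^bsub>Sec J (src E v)\<^esub> D ?w c'
           \<oplus>\<^bsub>Sec J (src E v)\<^esub> aug (cod_ob \<phi>) ?w c' \<odot>\<^bsub>Sec J (src E v)\<^esub> D ?w c"
        if "c \<in> carrier (Sec ?C' ?w)" "c' \<in> carrier (Sec ?C' ?w)" for c c'
        using D w src that unfolding derivations_def by auto
      have D_Str: "D ?w (Str ?C' ?w a \<otimes>\<^bsub>Sec ?C' ?w\<^esub> c) = aug (cod_ob \<phi>) ?w (Str ?C' ?w a) \<odot>\<^bsub>Sec J (src E v)\<^esub> D ?w c"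
        if "a \<in> carrier (Sec A (src E v))" "c \<in> carrier (Sec ?C' ?w)" for a c
        using D w src that unfolding derivations_def by auto
      fix c assume c: "c \<in> carrier (Sec ?C v)"
      have add_mult: "pull_along E \<phi> D v (c \<oplus>\<^bsub>Sec ?C v\<^esub> c') = pull_along E \<phi> D v c \<oplus>\<^bsub>Sec J (src E v)\<^esub> pull_along E \<phi> D v c'"
        "pull_along E \<phi> D v (c \<otimes>\<^bsub>Sec ?C v\<^esub> c') =
          aug (dom_ob \<phi>) v c \<odot>\<^bsub>Sec J (src E v)\<^esub> pull_along E \<phi> D v c' \<oplus>\<^bsub>Sec J (src E v)\<^esub>
          aug (dom_ob \<phi>) v c' \<odot>\<^bsub>Sec J (src E v)\<^esub> pull_along E \<phi> D v c"
        if c': "c' \<in> carrier (Sec ?C v)" for c'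
        using c c' v' ring_hom_add[OF \<rho>(1) c c'] ring_hom_mult[OF \<rho>(1) c c'] \<rho>_closed[OF c] \<rho>_closed[OF c']
        by (simp_all add: aug_v D_w)
      have linear: "pull_along E \<phi> D v (Str ?C v a \<otimes>\<^bsub>Sec ?C v\<^esub> c) =
          aug (dom_ob \<phi>) v (Str ?C v a) \<odot>\<^bsub>Sec J (src E v)\<^esub> pull_along E \<phi> D v c"
        if a: "a \<in> carrier (Sec A (src E v))" for a
        using c a v' Str[OF a] ring_hom_mult[OF \<rho>(1) Str[OF a] c] \<rho>(2)[OF a] \<rho>_closed[OF c]
        by (simp add: aug_v D_Str)
      note add_mult linear
    }
    ultimately show "Res ?G \<phi> D \<in> carrier (Sec ?G (src ?T \<phi>))"
      by (simp add: Der_sheaf_def der_group_def derivations_def)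
  qed
  show "Res ?G (idn ?T X) D = D" if "D \<in> carrier (Sec ?G X)" for X D
    using that pull_along_idn[OF assms, of D X "loc E J" A B] by (simp add: Der_sheaf_def carrier)
  show "Res ?G (cmp ?T \<psi> \<phi>) D = Res ?G \<phi> (Res ?G \<psi> D)"
    if "\<phi> \<in> Ar ?T" "\<psi> \<in> Ar ?T" "tgt ?T \<phi> = src ?T \<psi>" for \<phi> \<psi> D
    using that pull_along_cmp[OF assms that(1,2), of D] by (simp add: Der_sheaf_def)
qed

lemma presheaf_ext_sheaf:
  assumes "category E"
  shows "presheaf (alg_cat E A B) (ext_sheaf E A B' p)"
  unfolding presheaf_def
proof (intro conjI ballI impI)
  let ?T = "alg_cat E A B" and ?F = "ext_sheaf E A B' p"
  show "Res ?F \<phi> \<in> carrier (Sec ?F (tgt ?T \<phi>)) \<rightarrow> carrier (Sec ?F (src ?T \<phi>))" if \<phi>: "\<phi> \<in> Ar ?T" for \<phi>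
  proof
    let ?C = "ring_of (dom_ob \<phi>)" and ?U = "base (dom_ob \<phi>)" and ?f = "base_ar \<phi>"
    let ?C' = "ring_of (cod_ob \<phi>)" and ?U' = "base (cod_ob \<phi>)"
    fix \<eta> assume "\<eta> \<in> carrier (Sec ?F (tgt ?T \<phi>))"
    hence \<eta>: "\<eta> \<in> alg_maps (slice E ?U') (loc E A) ?C' (loc_alg E ?U' B')"
      and lift: "comp_map (slice E ?U') ?C' (loc_map E ?U' p) \<eta> = aug (cod_ob \<phi>)"
      by (simp_all add: ext_sheaf_def)
    note \<phi>_base = alg_cat_base_arD[OF \<phi>]
    have "alg_maps (slice E ?U) (loc E A) ?C (pull_alg E ?f (loc_alg E ?U' B')) =
        alg_maps (slice E ?U) (loc E A) ?C (loc_alg E ?U B')"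
    proof (rule alg_maps_cong_cod[OF category_slice[OF assms]])
      fix k show "Res (pull_alg E ?f (loc_alg E ?U' B')) k = Res (loc_alg E ?U B') k"
        by (cases k) simp
    qed (use \<phi>_base assms in \<open>simp_all add: category_simps\<close>)
    hence "pull_along E \<phi> \<eta> \<in> alg_maps (slice E ?U) (loc E A) ?C (loc_alg E ?U B')"
      using pull_along_alg_maps[OF assms \<phi> \<eta>] by simp
    moreover have "comp_map (slice E ?U) ?C (loc_map E ?U p) (pull_along E \<phi> \<eta>) =
        pull_along E \<phi> (aug (cod_ob \<phi>))"
      unfolding lift[symmetric] pull_along_lam comp_map_def compose_def
      using \<phi>_base assms alg_cat_ring_ar_closed[OF \<phi>]
      by (auto intro!: restrict_ext simp: category_simps)
    moreover have "pull_along E \<phi> (aug (cod_ob \<phi>)) = aug (dom_ob \<phi>)"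
      using \<phi> by (simp add: alg_cat_Ar_iff)
    ultimately show "Res ?F \<phi> \<eta> \<in> carrier (Sec ?F (src ?T \<phi>))"
      by (simp add: ext_sheaf_def)
  qed
  show "Res ?F (idn ?T X) \<eta> = \<eta>" if "\<eta> \<in> carrier (Sec ?F X)" for X \<eta>
    using that pull_along_idn[OF assms, of \<eta> X "loc_alg E (base X) B'" A B]
    by (simp add: ext_sheaf_def alg_maps_iff)
  show "Res ?F (cmp ?T \<psi> \<phi>) \<eta> = Res ?F \<phi> (Res ?F \<psi> \<eta>)"
    if "\<phi> \<in> Ar ?T" "\<psi> \<in> Ar ?T" "tgt ?T \<phi> = src ?T \<psi>" for \<phi> \<psi> \<eta>
    using that pull_along_cmp[OF assms that(1,2), of \<eta>] by (simp add: ext_sheaf_def)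
qed

text \<open>Pulling back precomposes with the algebra map of \<open>\<phi>\<close>, while a derivation is added after it.\<close>

lemma ext_action_natural:
  assumes "category E" "\<phi> \<in> Ar (alg_cat E A B)"
  shows "pull_along E \<phi> (ext_action E B' \<iota> (cod_ob \<phi>) D \<eta>) =
    ext_action E B' \<iota> (dom_ob \<phi>) (pull_along E \<phi> D) (pull_along E \<phi> \<eta>)"
  unfolding pull_along_lam ext_action_def add_der_def
  using assms alg_cat_base_arD[OF assms(2)] alg_cat_ring_ar_closed[OF assms(2)]
  by (auto intro!: restrict_ext simp: category_simps)

lemma ext_sheaf_torsor:
  assumes "category E" "module_sheaf E B J" "square_zero_extension E A B J B' p \<iota>"
    and "X \<in> Ob (alg_cat E A B)" "carrier (Sec (ext_sheaf E A B' p) X) \<noteq> {}"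
  shows "group_torsor (Sec (Der_sheaf E A J) X) (carrier (Sec (ext_sheaf E A B' p) X))
    (\<lambda>D. \<lambda>\<eta>\<in>carrier (Sec (ext_sheaf E A B' p) X). ext_action E B' \<iota> X D \<eta>)"
  using square_zero_lifting.lifts_torsor[OF square_zero_lifting_slice[OF assms(1-4)]] assms(5)
  unfolding Sec_ext_sheaf[OF assms(1-4)] ext_action_def by simp

section \<open>Global sections\<close>

lemma lifts_global:
  assumes "square_zero_lifting E A B J B (id_map E B) B' p \<iota>"
  shows "square_zero_lifting.lifts E A B (id_map E B) B' p = alg_sections E A B B' p"
  unfolding square_zero_lifting.lifts_def[OF assms] alg_sections_def by (auto simp: id_map_def)

lemma ext_sheaf_global_sections:
  assumes "category E" "terminal E e" "alg_sheaf E A B" "module_sheaf E B J"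
    "square_zero_extension E A B J B' p \<iota>"
  shows "bij_betw (loc_map E e) (alg_sections E A B B' p)
    (carrier (Sec (ext_sheaf E A B' p) (top_alg E e B)))"
proof -
  let ?z = "top_alg E e B"
  define P where "P x \<eta> \<longleftrightarrow> \<eta> \<in> ring_hom (Sec B x) (Sec B' x) \<and>
      (\<forall>a\<in>carrier (Sec A x). \<eta> (Str B x a) = Str B' x a) \<and>
      (\<forall>b\<in>carrier (Sec B x). p x (\<eta> b) = b)" for x \<eta>
  have z: "?z \<in> Ob (alg_cat E A B)"
    using assms(1-3) by (rule top_alg_Ob)
  have x: "src E v \<in> Ob E" if "v \<in> Ar E" for v
    using assms(1) that by (rule category_src_tgt)
  have "carrier (Sec (ext_sheaf E A B' p) ?z) = {\<eta> \<in> maps (slice E e) (loc_alg E e B) (loc_alg E e B').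
      \<forall>v\<in>Ob (slice E e). P (src E v) (\<eta> v)}"
    unfolding Sec_ext_sheaf[OF assms(1,4,5) z]
      square_zero_lifting.lifts_def[OF square_zero_lifting_slice[OF assms(1,4,5) z]] P_def
    by (auto simp: alg_maps_iff top_alg_def id_map_def x)
  moreover have "alg_sections E A B B' p = {\<eta> \<in> maps E B B'. \<forall>x\<in>Ob E. P x (\<eta> x)}"
    by (auto simp: alg_sections_def alg_maps_iff P_def)
  moreover have "bij_betw (loc_map E e) {\<eta> \<in> maps E B B'. \<forall>x\<in>Ob E. P x (\<eta> x)}
      {\<eta> \<in> maps (slice E e) (loc_alg E e B) (loc_alg E e B'). \<forall>v\<in>Ob (slice E e). P (src E v) (\<eta> v)}"
    using assms(1,2) presheafD(1)[OF alg_sheafD(4)[OF assms(3)]]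
    by (rule loc_map_bij_maps_where) simp_all
  ultimately show ?thesis
    by simp
qed

lemma Der_sheaf_global_sections:
  assumes "category E" "terminal E e" "alg_sheaf E A B"
  shows "loc_map E e \<in> iso (der_group E A B (id_map E B) J) (Sec (Der_sheaf E A J) (top_alg E e B))"
proof -
  let ?z = "top_alg E e B"
  define P where "P x D \<longleftrightarrow> (\<forall>c\<in>carrier (Sec B x). \<forall>c'\<in>carrier (Sec B x).
        D (c \<oplus>\<^bsub>Sec B x\<^esub> c') = D c \<oplus>\<^bsub>Sec J x\<^esub> D c' \<and>
        D (c \<otimes>\<^bsub>Sec B x\<^esub> c') =
          id_map E B x c \<odot>\<^bsub>Sec J x\<^esub> D c' \<oplus>\<^bsub>Sec J x\<^esub> id_map E B x c' \<odot>\<^bsub>Sec J x\<^esub> D c) \<and>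
     (\<forall>a\<in>carrier (Sec A x). \<forall>c\<in>carrier (Sec B x).
        D (Str B x a \<otimes>\<^bsub>Sec B x\<^esub> c) = id_map E B x (Str B x a) \<odot>\<^bsub>Sec J x\<^esub> D c)" for x D
  have "carrier (Sec (Der_sheaf E A J) ?z) = {D \<in> maps (slice E e) (loc_alg E e B) (loc E J).
      \<forall>v\<in>Ob (slice E e). P (src E v) (D v)}"
    unfolding P_def by (auto simp: der_group_def derivations_def top_alg_def)
  moreover have "carrier (der_group E A B (id_map E B) J) = {D \<in> maps E B J. \<forall>x\<in>Ob E. P x (D x)}"
    unfolding P_def by (auto simp: der_group_def derivations_def)
  moreover have "bij_betw (loc_map E e) {D \<in> maps E B J. \<forall>x\<in>Ob E. P x (D x)}
      {D \<in> maps (slice E e) (loc_alg E e B) (loc E J). \<forall>v\<in>Ob (slice E e). P (src E v) (D v)}"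
    using assms(1,2) presheafD(1)[OF alg_sheafD(4)[OF assms(3)]]
    by (rule loc_map_bij_maps_where) simp_all
  ultimately have "bij_betw (loc_map E e) (carrier (der_group E A B (id_map E B) J))
      (carrier (Sec (Der_sheaf E A J) ?z))"
    by simp
  moreover have "loc_map E e (D \<otimes>\<^bsub>der_group E A B (id_map E B) J\<^esub> D') =
      loc_map E e D \<otimes>\<^bsub>Sec (Der_sheaf E A J) ?z\<^esub> loc_map E e D'" for D D'
    using assms(1)
    by (auto simp: der_group_def top_alg_def loc_map_def[of E e] fun_eq_iff restrict_def category_simps)
  ultimately show ?thesis
    by (auto simp: iso_def hom_def dest: bij_betwE)
qed

theorem theorem1:
  fixes E :: "('o, 'm) cat" and e :: 'o
    and A :: "('o, 'm, 'u) ring_presheaf"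
    and B B' :: "('o, 'm, 'u) alg"
    and J :: "('o, 'm, 'u) module_presheaf"
    and p \<iota> :: "'o \<Rightarrow> 'u \<Rightarrow> 'u"
    and I :: "nat \<Rightarrow> (('o, 'm, 'u) algob, ('o, 'm, 'u) algar, 'v) group_presheaf"
    and \<epsilon> :: "('o, 'm, 'u) algob \<Rightarrow> ('m \<Rightarrow> 'u \<Rightarrow> 'u) \<Rightarrow> 'v"
    and d :: "nat \<Rightarrow> ('o, 'm, 'u) algob \<Rightarrow> 'v \<Rightarrow> 'v"
  assumes "universe TYPE('u)" and "topos TYPE('u) E" and "terminal E e"
    and "ring_sheaf E A" and "alg_sheaf E A B" and "module_sheaf E B J"
    and "square_zero_extension E A B J B' p \<iota>"
    and "injective_resolution (alg_cat E A B) (alg_cov E) (Der_sheaf E A J) I \<epsilon> d"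
  shows "let z = top_alg E e B;
             H = cohomology I d z;
             \<omega> = torsor_class (alg_cat E A B) z (Der_sheaf E A J) I \<epsilon> d
                   (ext_sheaf E A B' p) (ext_action E B' \<iota>);
             Der = der_group E A B (id_map E B) J;
             \<kappa> = (\<lambda>D. to_H0 z I \<epsilon> d (loc_map E e D));
             \<Sigma> = alg_sections E A B B' p;
             act = (\<lambda>D. \<lambda>s\<in>\<Sigma>. add_der E B B' \<iota> D s)
         in (\<omega> = \<one>\<^bsub>H 1\<^esub> \<longleftrightarrow> \<Sigma> \<noteq> {}) \<and>
            \<kappa> \<in> iso Der (H 0) \<and>
            (\<omega> = \<one>\<^bsub>H 1\<^esub> \<longrightarrow>
               group_torsor Der \<Sigma> act \<and>
               group_torsor (H 0) \<Sigma> (\<lambda>h. act (inv_into (carrier Der) \<kappa> h)))"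
proof -
  let ?T = "alg_cat E A B" and ?z = "top_alg E e B" and ?G = "Der_sheaf E A J"
  let ?\<Sigma> = "alg_sections E A B B' p" and ?Der = "der_group E A B (id_map E B) J"
  let ?\<omega> = "torsor_class ?T ?z ?G I \<epsilon> d (ext_sheaf E A B' p) (ext_action E B' \<iota>)"
  let ?\<kappa> = "\<lambda>D. to_H0 ?z I \<epsilon> d (loc_map E e D)"
  have E: "category E"
    using assms(2) by (simp add: topos_def)
  have T: "category ?T" "terminal ?T ?z"
    using category_alg_cat[OF E] terminal_top_alg[OF E assms(3,5)] by auto
  have z: "?z \<in> Ob ?T"
    using T(2) by (simp only: terminal_def)
  interpret square_zero_lifting E A B J B "id_map E B" B' p \<iota>
    using square_zero_lifting_global[OF E assms(5-7)] .

  have "?\<omega> = \<one>\<^bsub>cohomology I d ?z 1\<^esub> \<longleftrightarrow> carrier (Sec (ext_sheaf E A B' p) ?z) \<noteq> {}"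
  proof (rule torsor_class_trivial_iff[OF T assms(8) presheaf_Der_sheaf[OF E] presheaf_ext_sheaf[OF E]])
    show "Res (ext_sheaf E A B' p) \<phi> (ext_action E B' \<iota> (tgt ?T \<phi>) D \<eta>) =
        ext_action E B' \<iota> (src ?T \<phi>) (Res ?G \<phi> D) (Res (ext_sheaf E A B' p) \<phi> \<eta>)"
      if "\<phi> \<in> Ar ?T" for \<phi> D \<eta>
      using ext_action_natural[OF E that] by (simp add: ext_sheaf_def Der_sheaf_def)
  qed (rule ext_sheaf_torsor[OF E assms(6,7)])
  hence \<omega>: "?\<omega> = \<one>\<^bsub>cohomology I d ?z 1\<^esub> \<longleftrightarrow> ?\<Sigma> \<noteq> {}"
    using ext_sheaf_global_sections[OF E assms(3,5-7)] by (auto simp: bij_betw_def)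

  have "group (Sec ?G ?z)"
    unfolding Sec_Der_sheaf
    using square_zero_lifting_slice[OF E assms(6,7) z, THEN square_zero_lifting.axioms(1),
        THEN derivation_presheaves.comm_group_der_group] by (rule comm_group.axioms(2))
  from iso_set_trans[OF Der_sheaf_global_sections[OF E assms(3,5)] to_H0_iso[OF assms(8) z this]]
  have \<kappa>: "?\<kappa> \<in> iso ?Der (cohomology I d ?z 0)"
    by (simp add: o_def)

  have \<Sigma>: "group_torsor ?Der ?\<Sigma> (\<lambda>D. \<lambda>s\<in>?\<Sigma>. add_der E B B' \<iota> D s)" if "?\<Sigma> \<noteq> {}"
    using lifts_torsor lifts_global[OF square_zero_lifting_axioms] that by simp
  from group_torsor_iso[OF this \<kappa> group_cohomology_0(2)[OF assms(8) z]] show ?thesis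
    unfolding Let_def using \<omega> \<kappa> \<Sigma> by blast
qed

end
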